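(* Let $d\ge6$ and let $\{S_n\}_{n\ge0}$ be the symmetric simple random walk on $\mathbb{Z}^d$ with $S_0=0$. Let $\mathcal R_n=\{S_0,\dots,S_n\}$ and $\mathcal C_n=\operatorname{Cap}(\mathcal R_n)$ for $n\ge0$. Let $\sigma_d>0$ be the constant for which $(\mathcal C_n-\mathbb E[\mathcal C_n])/\sqrt n$ converges in distribution, as $n\to\infty$, to a centered Gaussian random variable with variance $\sigma_d^2$. Then, as $n\to\infty$, the processes $$\left\{\frac{\mathcal C_{\lfloor nt\rfloor}-\mathbb E[\mathcal C_{\lfloor nt\rfloor}]}{\sigma_d\sqrt n}\right\}_{t\ge0}$$ converge weakly, in the Skorohod space $\mathcal D([0,\infty),\mathbb R)$ endowed with the $J_1$ topology, to a standard one-dimensional Brownian motion $\{B_t\}_{t\ge0}$.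
   Context: The symmetric simple random walk on $\mathbb{Z}^d$ has i.i.d. increments uniformly distributed on the $2d$ unit vectors $\pm e_1,\dots,\pm e_d$. For $x\in\mathbb{Z}^d$, $\mathbb P_x$ denotes the law of the walk started at $x$, and $\mathbb P=\mathbb P_0$ (with expectation $\mathbb E$). For $A\subseteq\mathbb{Z}^d$, $T_A^+=\inf\{n\ge1:S_n\in A\}$ (with $\inf\emptyset=\infty$), and, the walk being transient, the capacity of $A$ is $$\operatorname{Cap}(A)=\sum_{x\in A}\mathbb P_x(T_A^+=\infty).$$ Here $\operatorname{Cap}$ is a deterministic function of the set, and $\mathcal C_n$ is this function evaluated at the random set $\mathcal R_n$. The existence, for every $d\ge6$, of the constant $\sigma_d>0$ described in the claim is a known theorem of Asselah, Schapira and Sousi (the central limit theorem for the capacity of the range of simple random walk on $\mathbb Z^d$, $d\ge 6$). $\lfloor x\rfloor$ is the integer part of $x$. *)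

theory Defs
  imports "HOL-Probability.Probability"
begin

section \<open>Simple random walk on the integer lattice and capacity\<close>

definition unit_steps :: "(int ^ 'd) set" where
  "unit_steps = (\<Union>i. {axis i 1, - axis i 1})"

definition simple_random_walk ::
  "'a measure \<Rightarrow> (nat \<Rightarrow> 'a \<Rightarrow> int ^ 'd) \<Rightarrow> int ^ 'd \<Rightarrow> bool" where
  "simple_random_walk M S x \<longleftrightarrow>
     prob_space M \<and>
     (\<forall>n. S n \<in> measurable M (count_space UNIV)) \<and>
     (\<forall>\<omega>\<in>space M. S 0 \<omega> = x) \<and>
     prob_space.indep_vars M (\<lambda>_. count_space UNIV) (\<lambda>n \<omega>. S (Suc n) \<omega> - S n \<omega>) UNIV \<and>
     (\<forall>n. distr M (count_space UNIV) (\<lambda>\<omega>. S (Suc n) \<omega> - S n \<omega>)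
            = measure_pmf (pmf_of_set unit_steps))"

definition walk_law :: "int ^ 'd \<Rightarrow> (nat \<Rightarrow> int ^ 'd) measure" where
  "walk_law x =
     distr (PiM UNIV (\<lambda>_. measure_pmf (pmf_of_set unit_steps)))
           (PiM UNIV (\<lambda>_. count_space UNIV))
           (\<lambda>\<xi> n. x + (\<Sum>k<n. \<xi> k))"

text \<open>In \<^typ>\<open>enat\<close> the infimum of the empty set is \<open>\<infinity>\<close>.\<close>

definition return_time :: "(int ^ 'd) set \<Rightarrow> (nat \<Rightarrow> int ^ 'd) \<Rightarrow> enat" where
  "return_time A s = (INF n \<in> {n. 1 \<le> n \<and> s n \<in> A}. enat n)"

definition capacity :: "(int ^ 'd) set \<Rightarrow> ennreal" where
  "capacity A = (\<Sum>\<^sub>\<infinity>x\<in>A. emeasure (walk_law x) {s. return_time A s = \<infinity>})"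

definition walk_range :: "(nat \<Rightarrow> 'a \<Rightarrow> int ^ 'd) \<Rightarrow> nat \<Rightarrow> 'a \<Rightarrow> (int ^ 'd) set" where
  "walk_range S n \<omega> = (\<lambda>k. S k \<omega>) ` {..n}"

definition range_capacity :: "(nat \<Rightarrow> 'a \<Rightarrow> int ^ 'd) \<Rightarrow> nat \<Rightarrow> 'a \<Rightarrow> real" where
  "range_capacity S n \<omega> = enn2real (capacity (walk_range S n \<omega>))"


section \<open>The Skorohod space with the \<open>J\<^sub>1\<close> topology\<close>

text \<open>A path indexed by \<open>[0, \<infinity>)\<close> is a function on \<^typ>\<open>real\<close> that is \<^const>\<open>undefined\<close> at
  negative times.\<close>

definition cadlag_paths :: "(real \<Rightarrow> real) set" where
  "cadlag_paths = {x \<in> extensional {0..}.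
     (\<forall>t\<ge>0. (x \<longlongrightarrow> x t) (at_right t)) \<and> (\<forall>t>0. \<exists>l. (x \<longlongrightarrow> l) (at_left t))}"

definition time_changes :: "(real \<Rightarrow> real) set" where
  "time_changes = {\<tau>. continuous_on {0..} \<tau> \<and> strict_mono_on {0..} \<tau> \<and> \<tau> ` {0..} = {0..}}"

definition J1_converges :: "(nat \<Rightarrow> real \<Rightarrow> real) \<Rightarrow> (real \<Rightarrow> real) \<Rightarrow> bool" where
  "J1_converges y x \<longleftrightarrow>
     (\<exists>\<tau>. (\<forall>n. \<tau> n \<in> time_changes) \<and>
          uniform_limit {0..} \<tau> (\<lambda>t. t) sequentially \<and>
          (\<forall>N. uniform_limit {0..N} (\<lambda>n t. y n (\<tau> n t)) x sequentially))"

text \<open>The \<open>J\<^sub>1\<close> topology is metrizable, and its convergent sequences are those of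
  \<open>J1_converges\<close> (Jacod and Shiryaev, Limit Theorems for Stochastic Processes, VI.1.14).
  Its open sets are therefore exactly the sequentially open ones.\<close>

definition skorohod_J1 :: "(real \<Rightarrow> real) topology" where
  "skorohod_J1 = topology (\<lambda>U. U \<subseteq> cadlag_paths \<and>
     (\<forall>x\<in>U. \<forall>y. (\<forall>n. y n \<in> cadlag_paths) \<and> J1_converges y x \<longrightarrow>
        (\<forall>\<^sub>F n in sequentially. y n \<in> U)))"

lemma openin_skorohod_J1:
  "openin skorohod_J1 U \<longleftrightarrow> U \<subseteq> cadlag_paths \<and>
     (\<forall>x\<in>U. \<forall>y. (\<forall>n. y n \<in> cadlag_paths) \<and> J1_converges y x \<longrightarrow>
        (\<forall>\<^sub>F n in sequentially. y n \<in> U))"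
proof -
  let ?P = "\<lambda>U. U \<subseteq> cadlag_paths \<and>
     (\<forall>x\<in>U. \<forall>y. (\<forall>n. y n \<in> cadlag_paths) \<and> J1_converges y x \<longrightarrow>
        (\<forall>\<^sub>F n in sequentially. y n \<in> U))"
  have "istopology ?P"
    unfolding istopology_def
  proof (rule conjI; intro allI impI)
    fix S T assume S: "?P S" and T: "?P T"
    show "?P (S \<inter> T)"
    proof (intro conjI ballI allI impI)
      show "S \<inter> T \<subseteq> cadlag_paths" using S by blast
      fix x y assume x: "x \<in> S \<inter> T" and y: "(\<forall>n. y n \<in> cadlag_paths) \<and> J1_converges y x"
      have "\<forall>\<^sub>F n in sequentially. y n \<in> S" "\<forall>\<^sub>F n in sequentially. y n \<in> T"
        using S T x y by blast+
      then show "\<forall>\<^sub>F n in sequentially. y n \<in> S \<inter> T"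
        by eventually_elim simp
    qed
  next
    fix K assume K: "\<forall>U\<in>K. ?P U"
    show "?P (\<Union>K)"
    proof (intro conjI ballI allI impI)
      show "\<Union>K \<subseteq> cadlag_paths" using K by blast
      fix x y assume "x \<in> \<Union>K" and y: "(\<forall>n. y n \<in> cadlag_paths) \<and> J1_converges y x"
      then obtain U where U: "U \<in> K" "x \<in> U" by blast
      then have "\<forall>\<^sub>F n in sequentially. y n \<in> U" using K y by blast
      then show "\<forall>\<^sub>F n in sequentially. y n \<in> \<Union>K"
        by eventually_elim (use U in blast)
    qed
  qed
  then show ?thesis
    unfolding skorohod_J1_def by (simp only: topology_inverse')
qed

lemma topspace_skorohod_J1: "topspace skorohod_J1 = cadlag_paths"
proof
  show "topspace skorohod_J1 \<subseteq> cadlag_paths"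
    using openin_topspace[of skorohod_J1] unfolding openin_skorohod_J1 by blast
  have "openin skorohod_J1 cadlag_paths"
    unfolding openin_skorohod_J1 by simp
  then show "cadlag_paths \<subseteq> topspace skorohod_J1"
    by (rule openin_subset)
qed


section \<open>Weak convergence of processes\<close>

definition borel_of :: "'a topology \<Rightarrow> 'a measure" where
  "borel_of T = sigma (topspace T) {U. openin T U}"

definition weakly_converges ::
  "'a topology \<Rightarrow> (nat \<Rightarrow> 'a measure) \<Rightarrow> 'a measure \<Rightarrow> bool" where
  "weakly_converges T \<mu> \<nu> \<longleftrightarrow>
     (\<forall>n. prob_space (\<mu> n) \<and> sets (\<mu> n) = sets (borel_of T)) \<and>
     prob_space \<nu> \<and> sets \<nu> = sets (borel_of T) \<and>
     (\<forall>f. continuous_map T euclideanreal f \<and> bounded (f ` topspace T) \<longrightarrow>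
        (\<lambda>n. \<integral>x. f x \<partial>\<mu> n) \<longlonglongrightarrow> (\<integral>x. f x \<partial>\<nu>))"

text \<open>For a probability measure \<open>M\<close>, the following is again a probability measure only if the
  path map is a random element of the Skorohod space, that is, Borel measurable.\<close>

definition path_law :: "'a measure \<Rightarrow> (real \<Rightarrow> 'a \<Rightarrow> real) \<Rightarrow> (real \<Rightarrow> real) measure" where
  "path_law M X = distr M (borel_of skorohod_J1) (\<lambda>\<omega>. restrict (\<lambda>t. X t \<omega>) {0..})"

definition standard_brownian_motion :: "'b measure \<Rightarrow> (real \<Rightarrow> 'b \<Rightarrow> real) \<Rightarrow> bool" where
  "standard_brownian_motion N B \<longleftrightarrow>
     prob_space N \<and>
     (\<forall>t\<ge>0. B t \<in> borel_measurable N) \<and>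
     (AE \<omega> in N. B 0 \<omega> = 0) \<and>
     (\<forall>k t. 0 \<le> t 0 \<and> (\<forall>i<k. t i \<le> t (Suc i)) \<longrightarrow>
        prob_space.indep_vars N (\<lambda>_. borel)
          (\<lambda>(i::nat) \<omega>. B (t (Suc i)) \<omega> - B (t i) \<omega>) {..<k}) \<and>
     (\<forall>s t. 0 \<le> s \<and> s < t \<longrightarrow>
        distributed N lborel (\<lambda>\<omega>. B t \<omega> - B s \<omega>) (normal_density 0 (sqrt (t - s)))) \<and>
     (\<forall>\<omega>\<in>space N. continuous_on {0..} (\<lambda>t. B t \<omega>))"

end

theory Submission
  imports Defs "HOL-Real_Asymp.Real_Asymp"
begin

text \<open>The capacity \<open>c(a, b)\<close> of the segment \<open>{S\<^sub>a, \<dots>, S\<^sub>b}\<close> is subadditive, and a union bound over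
  hitting times shows that \<open>c(a, b) + c(b, e) - c(a, e)\<close> is at most three times the sum of Green's
  function over the pairs of times in \<open>[a, b] \<times> [b, e]\<close>. For \<open>d \<ge> 6\<close> the bound \<open>C n\<^sup>-\<^sup>3\<close> on the
  \<open>n\<close>-step transition probabilities, read off from the characteristic function, makes its expectation
  \<open>O(log n)\<close>.

  Hence the centred capacity is, up to \<open>o(\<surd>n)\<close> in probability, a sum over independent blocks of length
  about \<open>n\<^sup>5\<^sup>/\<^sup>8\<close>: the error is monotone in the number of blocks, so that one expectation controls it
  uniformly. Inside a block subadditivity and Hoeffding's inequality for still shorter blocks bound the
  upper tail; applied to the end pieces of blocks, upper bounds also yield the lower ones. The
  oscillation of the sum of blocks is bounded by Ottaviani's inequality and the assumed central limit
  theorem, and the skeleton at times \<open>j/k\<close> converges because its increments are exactly independent.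

  Since the limit is continuous, it suffices to work with a metric for locally uniform convergence,
  and to test convergence in law on Lipschitz functions.\<close>

section \<open>A metric for locally uniform convergence\<close>

text \<open>Two obstacles fix the scales. The logarithmic defect is paid once per block, so a total
  of o(\<surd>n) needs blocks much longer than \<surd>n. On such a block the trivial bound c \<le>
  length + 1 is useless, and the fluctuation inside blocks must be small for polynomially many
  segments at once. No variance estimate is at hand, and the central limit theorem at a single time
  gives no rate; hence an exponential inequality obtained through a second, shorter scale.

  The skeleton consists of intervals of exactly equal length, k of which fit into [0, n] with a
  remainder, instead of the times j n / k. Its increments are then i.i.d. for every n, at the price
  of a time lag that the oscillation bound absorbs. There are about k T oscillation events, and the
  fourth moment of the Gaussian limit gives each of them probability O(1/k^2), so that their union
  becomes negligible as k grows.\<close>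

definition path_dist :: "(real \<Rightarrow> real) \<Rightarrow> (real \<Rightarrow> real) \<Rightarrow> real" where
  "path_dist x y = (SUP t\<in>{0..}. min \<bar>x t - y t\<bar> (1 / (1 + t)))"

lemma path_dist_ge:
  assumes "0 \<le> t"
  shows "min \<bar>x t - y t\<bar> (1 / (1 + t)) \<le> path_dist x y"
  unfolding path_dist_def
proof (rule cSUP_upper)
  show "bdd_above ((\<lambda>t. min \<bar>x t - y t\<bar> (1 / (1 + t))) ` {0..})"
    by (rule bdd_aboveI[of _ 1]) (auto simp: min_le_iff_disj)
qed (use assms in auto)

lemma path_dist_least:
  assumes "\<And>t. 0 \<le> t \<Longrightarrow> min \<bar>x t - y t\<bar> (1 / (1 + t)) \<le> c"
  shows "path_dist x y \<le> c"
  unfolding path_dist_def by (rule cSUP_least) (use assms in auto)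

lemma path_dist_nonneg: "0 \<le> path_dist x y"
  using path_dist_ge[of 0 x y] by simp

lemma path_dist_commute: "path_dist x y = path_dist y x"
  by (simp add: path_dist_def abs_minus_commute)

lemma path_dist_self [simp]: "path_dist x x = 0"
  by (rule antisym[OF path_dist_least path_dist_nonneg]) auto

text \<open>Truncation at a fixed weight is subadditive on nonnegative numbers, so the inequality
  holds at each time before the supremum is taken.\<close>

lemma path_dist_triangle: "path_dist x z \<le> path_dist x y + path_dist y z"
proof (rule path_dist_least)
  fix t :: real assume t: "0 \<le> t"
  have "min \<bar>x t - z t\<bar> (1 / (1 + t))
      \<le> min \<bar>x t - y t\<bar> (1 / (1 + t)) + min \<bar>y t - z t\<bar> (1 / (1 + t))"
  proof -
    have "min c w \<le> min a w + min b w" if "c \<le> a + b" "0 \<le> a" "0 \<le> b" "0 \<le> w" for a b c w :: real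
      using that by linarith
    then show ?thesis using t by simp
  qed
  also have "\<dots> \<le> path_dist x y + path_dist y z"
    by (intro add_mono path_dist_ge t)
  finally show "min \<bar>x t - z t\<bar> (1 / (1 + t)) \<le> path_dist x y + path_dist y z" .
qed

text \<open>Past K the weight alone is at most 1/(1 + K), whatever the paths do. Later estimates
  therefore concern a bounded window of time only.\<close>

lemma path_dist_le_max:
  assumes "0 \<le> K" and "\<And>t. 0 \<le> t \<Longrightarrow> t < K \<Longrightarrow> \<bar>x t - y t\<bar> \<le> e"
  shows "path_dist x y \<le> max e (1 / (1 + K))"
proof (rule path_dist_least)
  fix t :: real assume t: "0 \<le> t"
  show "min \<bar>x t - y t\<bar> (1 / (1 + t)) \<le> max e (1 / (1 + K))"
  proof (cases "t < K")
    case True then show ?thesis using assms(2)[OF t] by auto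
  next
    case False
    then have "1 / (1 + t) \<le> 1 / (1 + K)" using assms(1) by (intro frac_le) auto
    then show ?thesis by linarith
  qed
qed

text \<open>Identity time changes are admissible, so J1 convergence is weaker than locally uniform
  convergence.\<close>

lemma path_dist_tendsto_imp_J1_converges:
  assumes "(\<lambda>n. path_dist (y n) x) \<longlonglongrightarrow> 0"
  shows "J1_converges y x"
  unfolding J1_converges_def
proof (intro exI[of _ "\<lambda>_ t. t"] conjI allI)
  show "(\<lambda>t. t) \<in> time_changes"
    by (simp add: time_changes_def strict_mono_on_def)
  show "uniform_limit {0..} (\<lambda>_ t. t) (\<lambda>t. t) sequentially"
    by (rule uniform_limit_const)
  fix N :: real
  show "uniform_limit {0..N} (\<lambda>n t. y n t) x sequentially"
  proof (rule uniform_limitI)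
    fix e :: real assume e: "0 < e"
    \<comment> \<open>On [0, N] the weight is at least 1/(1 + |N|); a truncated difference below
      \<open>d\<close> is then the difference itself. N may be negative, hence the modulus.\<close>
    define d where "d = min e (1 / (1 + \<bar>N\<bar>))"
    have "0 < d" using e by (simp add: d_def add_pos_nonneg)
    then have "\<forall>\<^sub>F n in sequentially. path_dist (y n) x < d"
      using assms by (rule order_tendstoD(2)[rotated])
    then show "\<forall>\<^sub>F n in sequentially. \<forall>t\<in>{0..N}. dist (y n t) (x t) < e"
    proof eventually_elim
      case (elim n)
      show ?case
      proof
        fix t assume t: "t \<in> {0..N}"
        then have "1 / (1 + \<bar>N\<bar>) \<le> 1 / (1 + t)" by (intro frac_le) auto
        moreover have "min \<bar>y n t - x t\<bar> (1 / (1 + t)) < d"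
          using path_dist_ge[of t "y n" x] elim t by auto
        ultimately show "dist (y n t) (x t) < e"
          unfolding dist_real_def d_def by linarith
      qed
    qed
  qed
qed

text \<open>Imposed on all functions, so that no membership in \<open>cadlag_paths\<close> has to be
  carried along. Such an h depends on a path only through its values at nonnegative times.\<close>

definition path_lipschitz :: "real \<Rightarrow> ((real \<Rightarrow> real) \<Rightarrow> real) \<Rightarrow> bool" where
  "path_lipschitz L h \<longleftrightarrow> 0 \<le> L \<and> (\<forall>x y. \<bar>h x - h y\<bar> \<le> L * path_dist x y)"

lemma path_lipschitzD: "path_lipschitz L h \<Longrightarrow> \<bar>h x - h y\<bar> \<le> L * path_dist x y"
  by (simp add: path_lipschitz_def)

lemma path_lipschitz_tendsto:
  assumes "path_lipschitz L h" "((\<lambda>n. path_dist (y n) x) \<longlongrightarrow> 0) F"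
  shows "((\<lambda>n. h (y n)) \<longlongrightarrow> h x) F"
proof (rule LIM_zero_cancel, rule Lim_null_comparison)
  show "\<forall>\<^sub>F n in F. norm (h (y n) - h x) \<le> L * path_dist (y n) x"
    unfolding real_norm_def by (rule always_eventually, rule allI, rule path_lipschitzD[OF assms(1)])
  show "((\<lambda>n. L * path_dist (y n) x) \<longlongrightarrow> 0) F"
    using tendsto_mult_left[OF assms(2), of L] by simp
qed

section \<open>Step paths and sampled continuous paths\<close>

definition step_path :: "nat \<Rightarrow> (nat \<Rightarrow> real) \<Rightarrow> real \<Rightarrow> real" where
  "step_path k c = restrict (\<lambda>t. c (nat \<lfloor>real k * t\<rfloor>)) {0..}"

lemma step_path_dist_le:
  assumes "\<And>j. real j \<le> real k * K \<Longrightarrow> \<bar>a j - b j\<bar> \<le> e" and "0 \<le> K"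
  shows "path_dist (step_path k a) (step_path k b) \<le> max e (1 / (1 + K))"
proof (rule path_dist_le_max)
  fix t :: real assume t: "0 \<le> t" "t < K"
  have "real (nat \<lfloor>real k * t\<rfloor>) \<le> real k * t" using t by simp
  also have "\<dots> \<le> real k * K" using t by (intro mult_left_mono) auto
  finally show "\<bar>step_path k a t - step_path k b t\<bar> \<le> e"
    using assms(1) t by (simp add: step_path_def)
qed (use assms in auto)

text \<open>Up to an error given by the weight, a step path reads only finitely many coordinates, so
  continuity holds for the product topology on sequences. Coordinatewise limits of block sums
  thereby pass to Lipschitz functionals.\<close>

lemma path_lipschitz_step_path_continuous:
  assumes "path_lipschitz L h"
  shows "continuous_on UNIV (\<lambda>c. h (step_path k c))"
  unfolding continuous_on_eq_continuous_at[OF open_UNIV]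
proof (rule ballI)
  fix c :: "nat \<Rightarrow> real"
  have "((\<lambda>a. path_dist (step_path k a) (step_path k c)) \<longlongrightarrow> 0) (at c)"
  proof (rule tendstoI)
    fix e :: real assume e: "0 < e"
    \<comment> \<open>The weight past K is e/(1 + e) < e, and e/2 below leaves strict room in the
      other part of the maximum.\<close>
    define K where "K = 1 / e"
    have K: "0 \<le> K" "1 / (1 + K) < e" using e by (auto simp: K_def field_simps)
    have "\<forall>\<^sub>F a in at c. \<forall>j\<in>{..nat \<lfloor>real k * K\<rfloor>}. \<bar>a j - c j\<bar> < e/2"
    proof (rule eventually_ball_finite)
      show "\<forall>j\<in>{..nat \<lfloor>real k * K\<rfloor>}. \<forall>\<^sub>F a in at c. \<bar>a j - c j\<bar> < e / 2"
      proof
        fix j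
        have "isCont (\<lambda>a::nat \<Rightarrow> real. a j) c"
          using continuous_on_product_coordinates[of j, where 'b = real]
          unfolding continuous_on_eq_continuous_at[OF open_UNIV] by blast
        then have "((\<lambda>a. a j) \<longlongrightarrow> c j) (at c)" by (simp add: isCont_def)
        from tendstoD[OF this, of "e/2"] e show "\<forall>\<^sub>F a in at c. \<bar>a j - c j\<bar> < e / 2"
          by (simp add: dist_real_def)
      qed
    qed simp
    then show "\<forall>\<^sub>F a in at c. dist (path_dist (step_path k a) (step_path k c)) 0 < e"
    proof eventually_elim
      case (elim a)
      have "path_dist (step_path k a) (step_path k c) \<le> max (e/2) (1 / (1 + K))"
      proof (rule step_path_dist_le)
        fix j assume "real j \<le> real k * K"
        then have "j \<le> nat \<lfloor>real k * K\<rfloor>" by (simp add: le_nat_floor)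
        then show "\<bar>a j - c j\<bar> \<le> e/2" using elim by (auto intro: less_imp_le)
      qed (rule K)
      also have "\<dots> < e" using K e by auto
      finally show ?case by (simp add: path_dist_nonneg)
    qed
  qed
  then show "isCont (\<lambda>c. h (step_path k c)) c"
    unfolding isCont_def by (rule path_lipschitz_tendsto[OF assms])
qed

text \<open>With countably many coordinates the Borel sets of the product topology are the product
  ones, so coordinatewise measurability is enough.\<close>

lemma path_lipschitz_step_path_measurable:
  assumes "path_lipschitz L h" and "\<And>j. (\<lambda>\<omega>. c \<omega> j) \<in> borel_measurable M"
  shows "(\<lambda>\<omega>. h (step_path k (c \<omega>))) \<in> borel_measurable M"
proof -
  have "c \<in> borel_measurable M"
    by (rule measurable_coordinatewise_then_product) (rule assms(2))
  moreover have "(\<lambda>a. h (step_path k a)) \<in> borel_measurable borel"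
    by (rule borel_measurable_continuous_onI[OF path_lipschitz_step_path_continuous[OF assms(1)]])
  ultimately show ?thesis by (rule measurable_compose)
qed

lemma step_path_cadlag: "step_path k c \<in> cadlag_paths"
  unfolding cadlag_paths_def
proof (intro CollectI conjI allI impI)
  show "step_path k c \<in> extensional {0..}" by (simp add: step_path_def)
next
  fix t :: real assume t: "0 \<le> t"
  have "\<forall>\<^sub>F s in at_right t. \<lfloor>real k * s\<rfloor> = \<lfloor>real k * t\<rfloor> \<and> 0 \<le> s"
  proof (cases "k = 0")
    case True
    show ?thesis by (rule eventually_at_rightI[of t "t+1"]) (use t True in auto)
  next
    case False
    \<comment> \<open>The next jump time after t; the index is constant on [t, b).\<close>
    define b where "b = (of_int \<lfloor>real k * t\<rfloor> + 1) / real k"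
    have "t < b" using False real_of_int_floor_add_one_gt[of "t * real k"] by (simp add: b_def field_simps)
    then show ?thesis
    proof (rule eventually_at_rightI[rotated])
      fix s assume s: "s \<in> {t<..<b}"
      have "real k * t \<le> real k * s" using s by (intro mult_left_mono) auto
      moreover have "real k * s < of_int \<lfloor>real k * t\<rfloor> + 1" using s False by (simp add: b_def field_simps)
      ultimately show "\<lfloor>real k * s\<rfloor> = \<lfloor>real k * t\<rfloor> \<and> 0 \<le> s"
        using s t by (auto simp: floor_eq_iff) linarith
    qed
  qed
  then have "\<forall>\<^sub>F s in at_right t. step_path k c t = step_path k c s"
    by eventually_elim (use t in \<open>simp add: step_path_def\<close>)
  then show "(step_path k c \<longlongrightarrow> step_path k c t) (at_right t)"
    by (rule Lim_transform_eventually[OF tendsto_const])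
next
  fix t :: real assume t: "0 < t"
  \<comment> \<open>The index just left of t, one less than the floor at a jump time. For k = 0 the
    truncation in \<open>nat\<close> turns -1 into 0.\<close>
  define b where "b = nat (\<lceil>real k * t\<rceil> - 1)"
  have "\<forall>\<^sub>F s in at_left t. nat \<lfloor>real k * s\<rfloor> = b \<and> 0 \<le> s"
  proof (cases "k = 0")
    case True
    show ?thesis by (rule eventually_at_leftI[of 0 t]) (use t True in \<open>auto simp: b_def\<close>)
  next
    case False
    define a where "a = max 0 ((of_int \<lceil>real k * t\<rceil> - 1) / real k)"
    have "(of_int \<lceil>real k * t\<rceil> - 1) / real k < t" using False by (simp add: field_simps) linarith
    then have "a < t" using t by (simp add: a_def)
    then show ?thesis
    proof (rule eventually_at_leftI[rotated])
      fix s assume s: "s \<in> {a<..<t}"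
      have "real k * s < real k * t" using s False by auto
      moreover have "of_int \<lceil>real k * t\<rceil> - 1 < real k * s" using s False by (simp add: a_def field_simps)
      ultimately have "\<lfloor>real k * s\<rfloor> = \<lceil>real k * t\<rceil> - 1" by (simp add: floor_eq_iff) linarith
      then show "nat \<lfloor>real k * s\<rfloor> = b \<and> 0 \<le> s" using s by (simp add: b_def a_def)
    qed
  qed
  then have "\<forall>\<^sub>F s in at_left t. c b = step_path k c s"
    by eventually_elim (auto simp: step_path_def)
  then show "\<exists>l. (step_path k c \<longlongrightarrow> l) (at_left t)"
    by (intro exI) (rule Lim_transform_eventually[OF tendsto_const])
qed

lemma continuous_path_cadlag:
  assumes "continuous_on {0..} x"
  shows "restrict x {0..} \<in> cadlag_paths"
proof -
  have c: "continuous_on {0..} (restrict x {0..})"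
    using assms by (subst continuous_on_cong[OF refl, of _ _ x]) auto
  show ?thesis
    unfolding cadlag_paths_def
  proof (intro CollectI conjI allI impI)
    fix t :: real assume t: "0 \<le> t"
    then have "(restrict x {0..} \<longlongrightarrow> restrict x {0..} t) (at t within {0..})"
      using c unfolding continuous_on by blast
    then show "(restrict x {0..} \<longlongrightarrow> restrict x {0..} t) (at_right t)"
      by (rule tendsto_within_subset) (use t in auto)
  next
    fix t :: real assume t: "0 < t"
    then have "at t within {0..} = at t" by (intro at_within_interior) auto
    then have "(restrict x {0..} \<longlongrightarrow> restrict x {0..} t) (at t)"
      using c[unfolded continuous_on, THEN bspec, of t] t by simp
    then show "\<exists>l. (restrict x {0..} \<longlongrightarrow> l) (at_left t)"
      by (auto simp: filterlim_at_split simp del: restrict_apply)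
  qed simp
qed

text \<open>Uniform continuity on [0, K] does the work. The lemma serves both the discretisation of
  Brownian motion and its measurability, as a pointwise limit of functions of countably many
  coordinates.\<close>

lemma continuous_path_step_approx:
  assumes "continuous_on {0..} x"
  shows "(\<lambda>k. path_dist (step_path k (\<lambda>j. x (real j / real k))) (restrict x {0..})) \<longlonglongrightarrow> 0"
proof (rule tendstoI)
  fix e :: real assume e: "0 < e"
  define K where "K = 1 / e"
  have K: "0 \<le> K" "1 / (1 + K) < e" using e by (auto simp: K_def field_simps)
  have "uniformly_continuous_on {0..K} x"
    by (rule compact_uniformly_continuous) (use continuous_on_subset[OF assms, of "{0..K}"] in auto)
  then obtain d where d: "0 < d" "\<And>s t. s \<in> {0..K} \<Longrightarrow> t \<in> {0..K} \<Longrightarrow> dist t s < d \<Longrightarrow> dist (x t) (x s) < e/2"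
    using e unfolding uniformly_continuous_on_def by (metis half_gt_zero)
  have "\<forall>\<^sub>F k in sequentially. 1 / d < real k"
    using filterlim_real_sequentially by (simp add: filterlim_at_top_dense)
  then show "\<forall>\<^sub>F k in sequentially.
     dist (path_dist (step_path k (\<lambda>j. x (real j / real k))) (restrict x {0..})) 0 < e"
  proof eventually_elim
    case (elim k)
    have "0 < 1 / d" using d by simp
    then have k: "0 < real k" using elim by linarith
    have "path_dist (step_path k (\<lambda>j. x (real j / real k))) (restrict x {0..}) \<le> max (e/2) (1 / (1 + K))"
    proof (rule path_dist_le_max[OF K(1)])
      fix t :: real assume t: "0 \<le> t" "t < K"
      define s where "s = real (nat \<lfloor>real k * t\<rfloor>) / real k"
      have "real (nat \<lfloor>real k * t\<rfloor>) \<le> real k * t" "real k * t < real (nat \<lfloor>real k * t\<rfloor>) + 1"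
        using t k by (auto simp: )
      then have s: "s \<le> t" "t < s + 1 / real k" "0 \<le> s"
        using k by (auto simp: s_def field_simps)
      have "1 / real k < d" using elim d k by (simp add: field_simps)
      then have "dist (x s) (x t) < e/2" using s t by (intro d) (auto simp: dist_real_def)
      then show "\<bar>step_path k (\<lambda>j. x (real j / real k)) t - restrict x {0..} t\<bar> \<le> e/2"
        using t by (simp add: step_path_def s_def dist_real_def)
    qed
    also have "\<dots> < e" using K e by auto
    finally show ?case by (simp add: path_dist_nonneg)
  qed
qed

section \<open>Lipschitz test functions and weak convergence in the Skorohod space\<close>

lemma path_dist_le_1: "path_dist x y \<le> 1"
  using path_dist_le_max[of 0 x y 0] by simp

text \<open>Each function under the infimum is L-Lipschitz, and the lower bound b keeps the infimum
  of reals meaningful. With f = 0 and L = 1 this is the distance to F; with a test function f it is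
  an envelope of f.\<close>

lemma path_lipschitz_INF:
  assumes "F \<noteq> {}" "0 \<le> L" "\<And>y. y \<in> F \<Longrightarrow> b \<le> f y"
  shows "path_lipschitz L (\<lambda>x. INF y\<in>F. f y + L * path_dist x y)"
proof -
  let ?h = "\<lambda>x. INF y\<in>F. f y + L * path_dist x y"
  have bdd: "bdd_below ((\<lambda>y. f y + L * path_dist x y) ` F)" for x
    using assms by (intro bdd_belowI[of _ b]) (auto intro!: add_increasing2 simp: path_dist_nonneg)
  have le: "?h x \<le> ?h z + L * path_dist x z" for x z
  proof -
    have "?h x - L * path_dist x z \<le> ?h z"
    proof (rule cINF_greatest[OF assms(1)])
      fix y assume y: "y \<in> F"
      have "?h x \<le> f y + L * path_dist x y"
        by (rule cINF_lower[OF bdd y])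
      also have "\<dots> \<le> f y + L * (path_dist x z + path_dist z y)"
        using assms(2) by (intro add_left_mono mult_left_mono path_dist_triangle)
      finally show "?h x - L * path_dist x z \<le> f y + L * path_dist z y"
        by (simp add: algebra_simps)
    qed
    then show ?thesis by simp
  qed
  show ?thesis
    unfolding path_lipschitz_def
  proof (intro conjI allI)
    show "\<bar>?h x - ?h y\<bar> \<le> L * path_dist x y" for x y
      using le[of x y] le[of y x] by (simp add: path_dist_commute abs_le_iff)
  qed (rule assms)
qed

text \<open>If every radius 1/(n + 1) failed, the counterexamples would converge to x, against
  sequential openness. Open sets of J1 are thus open for \<open>path_dist\<close>, which metrizes a
  finer topology on the cadlag paths.\<close>

lemma openin_skorohod_J1_ball:
  assumes "openin skorohod_J1 U" "x \<in> U"
  shows "\<exists>r>0. \<forall>y\<in>cadlag_paths. path_dist y x < r \<longrightarrow> y \<in> U"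
proof (rule ccontr)
  assume "\<not> ?thesis"
  then have "\<exists>y\<in>cadlag_paths. path_dist y x < 1 / real (Suc n) \<and> y \<notin> U" for n
    by (metis of_nat_0_less_iff zero_less_Suc zero_less_divide_1_iff)
  then obtain y where y: "y n \<in> cadlag_paths" "path_dist (y n) x < 1 / real (Suc n)" "y n \<notin> U" for n
    by metis
  have "(\<lambda>n. path_dist (y n) x) \<longlonglongrightarrow> 0"
  proof (rule tendsto_sandwich[where f = "\<lambda>_. 0"])
    show "\<forall>\<^sub>F n in sequentially. path_dist (y n) x \<le> 1 / real (Suc n)"
      using y(2) by (simp add: less_imp_le)
    show "(\<lambda>n. 1 / real (Suc n)) \<longlonglongrightarrow> 0"
      using LIMSEQ_inverse_real_of_nat by (simp add: inverse_eq_divide)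
  qed (simp_all add: path_dist_nonneg)
  then have "J1_converges y x" by (rule path_dist_tendsto_imp_J1_converges)
  then have "\<forall>\<^sub>F n in sequentially. y n \<in> U"
    using assms y(1) by (auto simp: openin_skorohod_J1)
  then show False using y(3) by (simp add: eventually_sequentially)
qed

text \<open>Among cadlag paths, an open U is the set where the distance to its complement is
  positive, and that distance is Lipschitz. This reduces Borel measurability for J1 to that of
  Lipschitz functionals.\<close>

lemma measurable_skorohod_J1:
  assumes X: "\<And>\<omega>. \<omega> \<in> space M \<Longrightarrow> X \<omega> \<in> cadlag_paths"
    and h: "\<And>L h. path_lipschitz L h \<Longrightarrow> (\<lambda>\<omega>. h (X \<omega>)) \<in> borel_measurable M"
  shows "X \<in> measurable M (borel_of skorohod_J1)"
  unfolding borel_of_def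
proof (rule measurable_measure_of)
  show "{U. openin skorohod_J1 U} \<subseteq> Pow (topspace skorohod_J1)"
    using openin_subset by blast
  show "X \<in> space M \<rightarrow> topspace skorohod_J1"
    using X by (auto simp: topspace_skorohod_J1)
  fix U assume "U \<in> {U. openin skorohod_J1 U}"
  then have U: "openin skorohod_J1 U" by simp
  show "X -` U \<inter> space M \<in> sets M"
  \<comment> \<open>The distance to an empty complement would be an infimum over the empty
    set.\<close>
  proof (cases "cadlag_paths - U = {}")
    case True
    then have "X -` U \<inter> space M = space M" using X by auto
    then show ?thesis by simp
  next
    case False
    define d where "d x = (INF y\<in>cadlag_paths - U. 0 + 1 * path_dist x y)" for x
    have "path_lipschitz 1 d"
      unfolding d_def by (rule path_lipschitz_INF[OF False, of _ 0]) simp_all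
    then have [measurable]: "(\<lambda>\<omega>. d (X \<omega>)) \<in> borel_measurable M" by (rule h)
    have "X \<omega> \<in> U \<longleftrightarrow> 0 < d (X \<omega>)" if \<omega>: "\<omega> \<in> space M" for \<omega>
    proof
      assume "X \<omega> \<in> U"
      from openin_skorohod_J1_ball[OF U this] obtain r where
        r: "0 < r" "\<And>y. y \<in> cadlag_paths \<Longrightarrow> path_dist y (X \<omega>) < r \<Longrightarrow> y \<in> U" by auto
      have "r \<le> d (X \<omega>)" unfolding d_def
        by (rule cINF_greatest[OF False]) (use r(2) in \<open>force simp: path_dist_commute\<close>)
      with r(1) show "0 < d (X \<omega>)" by simp
    next
      assume "0 < d (X \<omega>)"
      show "X \<omega> \<in> U"
      proof (rule ccontr)
        assume "X \<omega> \<notin> U"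
        then have "X \<omega> \<in> cadlag_paths - U" using X \<omega> by auto
        then have "d (X \<omega>) \<le> 0 + 1 * path_dist (X \<omega>) (X \<omega>)"
          unfolding d_def
          by (intro cINF_lower bdd_belowI[of _ 0]) (auto simp: path_dist_nonneg)
        then show False using \<open>0 < d (X \<omega>)\<close> by simp
      qed
    qed
    then have "X -` U \<inter> space M = {\<omega>\<in>space M. 0 < d (X \<omega>)}" by auto
    then show ?thesis by simp
  qed
qed

text \<open>Bounded continuous functions are increasing limits of their Lipschitz envelopes
  \<open>f\<^sub>k x = inf\<^sub>y (f y + k d(x, y))\<close>, so that Lipschitz functions suffice.\<close>

lemma skorohod_J1_Lipschitz_envelope:
  fixes b :: real
  assumes f: "continuous_map skorohod_J1 euclideanreal f"
    and b: "\<And>x. x \<in> cadlag_paths \<Longrightarrow> \<bar>f x\<bar> \<le> b"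
    and x: "x \<in> cadlag_paths"
  shows "(\<lambda>k. INF y\<in>cadlag_paths. f y + real k * path_dist x y) \<longlonglongrightarrow> f x"
proof (rule LIMSEQ_I)
  fix e :: real assume e: "0 < e"
  let ?env = "\<lambda>k. INF y\<in>cadlag_paths. f y + real k * path_dist x y"
  have "openin skorohod_J1 {y \<in> topspace skorohod_J1. f y \<in> {f x - e/2<..}}"
    by (rule openin_continuous_map_preimage[OF f]) simp
  moreover have "x \<in> {y \<in> topspace skorohod_J1. f y \<in> {f x - e/2<..}}"
    using x e by (simp add: topspace_skorohod_J1)
  ultimately obtain r where r: "0 < r"
    "\<And>y. y \<in> cadlag_paths \<Longrightarrow> path_dist y x < r \<Longrightarrow> f x - e/2 < f y"
    using openin_skorohod_J1_ball by fastforce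
  \<comment> \<open>From \<open>k0\<close> on, a point at distance at least r pays a penalty k r
    \<ge> 2 b, more than f can vary. Only the ball, where f > f x - e/2, can lower the
    infimum.\<close>
  obtain k0 where k0: "2 * b / r \<le> real k0" using real_arch_simple by blast
  show "\<exists>no. \<forall>k\<ge>no. norm (?env k - f x) < e"
  proof (intro exI allI impI)
    fix k assume k: "k0 \<le> k"
    have "?env k \<le> f x + real k * path_dist x x"
    proof (rule cINF_lower[OF _ x])
      have "- b \<le> f y + real k * path_dist x y" if "y \<in> cadlag_paths" for y
        using b[OF that] mult_nonneg_nonneg[of "real k" "path_dist x y"] path_dist_nonneg[of x y]
        by linarith
      then show "bdd_below ((\<lambda>y. f y + real k * path_dist x y) ` cadlag_paths)"
        by (intro bdd_belowI[of _ "- b"]) auto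
    qed
    moreover have "f x - e/2 \<le> ?env k"
    proof (rule cINF_greatest)
      fix y assume y: "y \<in> cadlag_paths"
      show "f x - e/2 \<le> f y + real k * path_dist x y"
      proof (cases "path_dist y x < r")
        case True
        then have "f x - e/2 < f y" by (rule r(2)[OF y])
        then show ?thesis using mult_nonneg_nonneg[of "real k" "path_dist x y"] path_dist_nonneg[of x y]
          by linarith
      next
        case False
        have "2 * b \<le> real k0 * r" using k0 r(1) by (simp add: field_simps)
        also have "\<dots> \<le> real k * path_dist x y"
          using False k r(1) by (intro mult_mono) (auto simp: path_dist_commute)
        finally show ?thesis using b[OF x] b[OF y] e by linarith
      qed
    qed (use x in auto)
    ultimately show "norm (?env k - f x) < e" using e by (simp add: abs_less_iff)
  qed
qed

text \<open>One half of a portmanteau argument: every envelope lies below f, so its limiting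
  expectation bounds the lower limit for f, and the envelopes converge to f under the law of Y by
  dominated convergence. Applied to f and to -f it gives both halves.\<close>

lemma skorohod_J1_integral_lower_bound:
  fixes M :: "'a measure" and N :: "'b measure" and f :: "(real \<Rightarrow> real) \<Rightarrow> real"
  assumes M: "prob_space M" and N: "prob_space N"
    and X: "\<And>n \<omega>. \<omega> \<in> space M \<Longrightarrow> X n \<omega> \<in> cadlag_paths"
    and Y: "\<And>\<omega>. \<omega> \<in> space N \<Longrightarrow> Y \<omega> \<in> cadlag_paths"
    and hX: "\<And>n L h. path_lipschitz L h \<Longrightarrow> (\<lambda>\<omega>. h (X n \<omega>)) \<in> borel_measurable M"
    and hY: "\<And>L h. path_lipschitz L h \<Longrightarrow> (\<lambda>\<omega>. h (Y \<omega>)) \<in> borel_measurable N"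
    and conv: "\<And>L h b. path_lipschitz L h \<Longrightarrow> (\<And>x. \<bar>h x\<bar> \<le> b) \<Longrightarrow>
      (\<lambda>n. \<integral>\<omega>. h (X n \<omega>) \<partial>M) \<longlonglongrightarrow> (\<integral>\<omega>. h (Y \<omega>) \<partial>N)"
    and f: "continuous_map skorohod_J1 euclideanreal f"
    and b: "\<And>x. x \<in> cadlag_paths \<Longrightarrow> \<bar>f x\<bar> \<le> b"
    and mX: "\<And>n. (\<lambda>\<omega>. f (X n \<omega>)) \<in> borel_measurable M"
    and mY: "(\<lambda>\<omega>. f (Y \<omega>)) \<in> borel_measurable N"
    and c: "c < (\<integral>\<omega>. f (Y \<omega>) \<partial>N)"
  shows "\<forall>\<^sub>F n in sequentially. c < (\<integral>\<omega>. f (X n \<omega>) \<partial>M)"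
proof -
  interpret M: prob_space M by fact
  interpret N: prob_space N by fact
  define env where "env k x = (INF y\<in>cadlag_paths. f y + real k * path_dist x y)" for k x
  have ne: "cadlag_paths \<noteq> {}" using step_path_cadlag by blast
  have lip: "path_lipschitz (real k) (env k)" for k
    unfolding env_def by (rule path_lipschitz_INF[OF ne, of _ "- b"]) (use b in \<open>simp_all add: abs_le_iff minus_le_iff\<close>)
  have bdd: "bdd_below ((\<lambda>y. f y + real k * path_dist x y) ` cadlag_paths)" for k x
  proof -
    have "- b \<le> f y + real k * path_dist x y" if "y \<in> cadlag_paths" for y
      using b[OF that] mult_nonneg_nonneg[of "real k" "path_dist x y"] path_dist_nonneg[of x y]
      by linarith
    then show ?thesis by (intro bdd_belowI[of _ "- b"]) auto
  qed
  have lower: "- b \<le> env k x" for k x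
    unfolding env_def
  proof (rule cINF_greatest[OF ne])
    fix y assume y: "y \<in> cadlag_paths"
    show "- b \<le> f y + real k * path_dist x y"
      using b[OF y] mult_nonneg_nonneg[of "real k" "path_dist x y"] path_dist_nonneg[of x y]
      by linarith
  qed
  have upper: "env k x \<le> f x" if "x \<in> cadlag_paths" for k x
    using cINF_lower[OF bdd that, of k x] by (simp add: env_def)
  \<comment> \<open>\<open>conv\<close> asks for a bound at all functions, while f is bounded on
    cadlag paths only; since the metric is at most 1, the envelope stays below b + k
    everywhere.\<close>
  have upper': "env k x \<le> b + real k" for k x
  proof -
    obtain y where y: "y \<in> cadlag_paths" using ne by auto
    have "env k x \<le> f y + real k * path_dist x y"
      unfolding env_def by (rule cINF_lower[OF bdd y])
    also have "\<dots> \<le> b + real k * 1"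
      using b[OF y] path_dist_le_1 by (intro add_mono mult_left_mono) (auto simp: abs_le_iff)
    finally show ?thesis by simp
  qed
  have mXk: "(\<lambda>\<omega>. env k (X n \<omega>)) \<in> borel_measurable M" for k n by (rule hX[OF lip])
  have mYk: "(\<lambda>\<omega>. env k (Y \<omega>)) \<in> borel_measurable N" for k by (rule hY[OF lip])
  have "(\<lambda>k. \<integral>\<omega>. env k (Y \<omega>) \<partial>N) \<longlonglongrightarrow> (\<integral>\<omega>. f (Y \<omega>) \<partial>N)"
  proof (rule integral_dominated_convergence[where w = "\<lambda>_. b"])
    show "AE \<omega> in N. (\<lambda>k. env k (Y \<omega>)) \<longlonglongrightarrow> f (Y \<omega>)"
      using skorohod_J1_Lipschitz_envelope[OF f b Y] by (intro AE_I2) (simp add: env_def)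
    show "AE \<omega> in N. norm (env k (Y \<omega>)) \<le> b" for k
    proof (rule AE_I2)
      fix \<omega> assume "\<omega> \<in> space N"
      then have "env k (Y \<omega>) \<le> b" using upper[OF Y, of \<omega> k] b[OF Y, of \<omega>] by linarith
      then show "norm (env k (Y \<omega>)) \<le> b" using lower[of k "Y \<omega>"] by (simp add: abs_le_iff)
    qed
  qed (use mY mYk in auto)
  then have "\<forall>\<^sub>F k in sequentially. c < (\<integral>\<omega>. env k (Y \<omega>) \<partial>N)"
    using c by (rule order_tendstoD(1))
  then obtain k where k: "c < (\<integral>\<omega>. env k (Y \<omega>) \<partial>N)"
    by (auto simp: eventually_sequentially)
  have "(\<lambda>n. \<integral>\<omega>. env k (X n \<omega>) \<partial>M) \<longlonglongrightarrow> (\<integral>\<omega>. env k (Y \<omega>) \<partial>N)"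
  proof (rule conv[OF lip])
    show "\<bar>env k x\<bar> \<le> b + real k" for x using lower[of k x] upper'[of k x] by (auto simp: abs_le_iff)
  qed
  then have "\<forall>\<^sub>F n in sequentially. c < (\<integral>\<omega>. env k (X n \<omega>) \<partial>M)"
    using k by (rule order_tendstoD(1))
  then show ?thesis
  proof eventually_elim
    case (elim n)
    also have "(\<integral>\<omega>. env k (X n \<omega>) \<partial>M) \<le> (\<integral>\<omega>. f (X n \<omega>) \<partial>M)"
    proof (rule integral_mono)
      show "integrable M (\<lambda>\<omega>. env k (X n \<omega>))"
      proof (rule M.integrable_const_bound[where B = "b + real k"])
        show "AE \<omega> in M. norm (env k (X n \<omega>)) \<le> b + real k"
        proof (rule AE_I2)
          show "norm (env k (X n \<omega>)) \<le> b + real k" for \<omega>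
            using lower[of k "X n \<omega>"] upper'[of k "X n \<omega>"] by (simp add: abs_le_iff)
        qed
      qed (rule mXk)
      show "integrable M (\<lambda>\<omega>. f (X n \<omega>))"
        using b X by (intro M.integrable_const_bound[where B = b] AE_I2) (auto intro: mX)
    qed (use upper X in auto)
    finally show ?case .
  qed
qed

lemma weakly_converges_skorohod_J1I:
  fixes M :: "'a measure" and N :: "'b measure"
  assumes M: "prob_space M" and N: "prob_space N"
    and X: "\<And>n \<omega>. \<omega> \<in> space M \<Longrightarrow> X n \<omega> \<in> cadlag_paths"
    and Y: "\<And>\<omega>. \<omega> \<in> space N \<Longrightarrow> Y \<omega> \<in> cadlag_paths"
    and hX: "\<And>n L h. path_lipschitz L h \<Longrightarrow> (\<lambda>\<omega>. h (X n \<omega>)) \<in> borel_measurable M"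
    and hY: "\<And>L h. path_lipschitz L h \<Longrightarrow> (\<lambda>\<omega>. h (Y \<omega>)) \<in> borel_measurable N"
    and conv: "\<And>L h b. path_lipschitz L h \<Longrightarrow> (\<And>x. \<bar>h x\<bar> \<le> b) \<Longrightarrow>
      (\<lambda>n. \<integral>\<omega>. h (X n \<omega>) \<partial>M) \<longlonglongrightarrow> (\<integral>\<omega>. h (Y \<omega>) \<partial>N)"
  shows "weakly_converges skorohod_J1
    (\<lambda>n. distr M (borel_of skorohod_J1) (X n)) (distr N (borel_of skorohod_J1) Y)"
proof -
  have mX: "X n \<in> measurable M (borel_of skorohod_J1)" for n
    by (rule measurable_skorohod_J1, erule X, erule hX)
  have mY: "Y \<in> measurable N (borel_of skorohod_J1)"
    by (rule measurable_skorohod_J1, erule Y, erule hY)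
  show ?thesis
    unfolding weakly_converges_def
  proof (intro conjI allI impI; (elim conjE)?)
    fix f :: "(real \<Rightarrow> real) \<Rightarrow> real"
    assume f: "continuous_map skorohod_J1 euclideanreal f"
      and "bounded (f ` topspace skorohod_J1)"
    then obtain b where b: "\<And>x. x \<in> cadlag_paths \<Longrightarrow> \<bar>f x\<bar> \<le> b"
      by (auto simp: bounded_iff topspace_skorohod_J1)
    have mf: "f \<in> borel_measurable (borel_of skorohod_J1)"
    proof (rule borel_measurableI)
      fix S :: "real set" assume "open S"
      then have "openin skorohod_J1 {x \<in> topspace skorohod_J1. f x \<in> S}"
        by (intro openin_continuous_map_preimage[OF f]) simp
      moreover have "{x \<in> topspace skorohod_J1. f x \<in> S} = f -` S \<inter> space (borel_of skorohod_J1)"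
        by (auto simp: borel_of_def space_measure_of_conv)
      moreover have "{U. openin skorohod_J1 U} \<subseteq> Pow (topspace skorohod_J1)"
        using openin_subset by blast
      ultimately show "f -` S \<inter> space (borel_of skorohod_J1) \<in> sets (borel_of skorohod_J1)"
        by (auto simp: borel_of_def sets_measure_of intro!: sigma_sets.Basic)
    qed
    note mfX = measurable_compose[OF mX mf] and mfY = measurable_compose[OF mY mf]
    have "(\<lambda>n. \<integral>\<omega>. f (X n \<omega>) \<partial>M) \<longlonglongrightarrow> (\<integral>\<omega>. f (Y \<omega>) \<partial>N)"
    proof (rule order_tendstoI)
      fix c assume "c < (\<integral>\<omega>. f (Y \<omega>) \<partial>N)"
      then show "\<forall>\<^sub>F n in sequentially. c < (\<integral>\<omega>. f (X n \<omega>) \<partial>M)"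
        by (intro skorohod_J1_integral_lower_bound[OF M N X Y hX hY conv f b mfX mfY])
    next
      fix c assume "(\<integral>\<omega>. f (Y \<omega>) \<partial>N) < c"
      then have "- c < (\<integral>\<omega>. - f (Y \<omega>) \<partial>N)" by simp
      then have "\<forall>\<^sub>F n in sequentially. - c < (\<integral>\<omega>. - f (X n \<omega>) \<partial>M)"
        by (intro skorohod_J1_integral_lower_bound[where f = "\<lambda>x. - f x" and b = b, OF M N X Y hX hY conv])
           (use f b mfX mfY in \<open>auto intro: continuous_map_minus\<close>)
      then show "\<forall>\<^sub>F n in sequentially. (\<integral>\<omega>. f (X n \<omega>) \<partial>M) < c" by simp
    qed
    then show "(\<lambda>n. \<integral>x. f x \<partial>distr M (borel_of skorohod_J1) (X n))
        \<longlonglongrightarrow> (\<integral>x. f x \<partial>distr N (borel_of skorohod_J1) Y)"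
      by (simp add: integral_distr[OF mX mf] integral_distr[OF mY mf])
  qed (use M N mX mY in \<open>auto intro: prob_space.prob_space_distr\<close>)
qed

section \<open>Transition probabilities of the walk\<close>

text \<open>The uniform law on [-pi, pi], carried by the whole line so that its space is
  \<open>UNIV\<close> and products need no domain conditions.\<close>

definition torus :: "real measure" where
  "torus = density lborel (\<lambda>x. ennreal (indicator {-pi..pi} x / (2 * pi)))"

lemma sets_torus [simp, measurable_cong]: "sets torus = sets borel"
  by (simp add: torus_def)

lemma space_torus [simp]: "space torus = UNIV"
  by (simp add: torus_def)

lemma integral_torus:
  fixes f :: "real \<Rightarrow> 'b::{banach, second_countable_topology}"
  assumes "f \<in> borel_measurable borel"
  shows "(\<integral>x. f x \<partial>torus) = (1 / (2 * pi)) *\<^sub>R (\<integral>x. indicator {-pi..pi} x *\<^sub>R f x \<partial>lborel)"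
proof -
  have "(\<integral>x. f x \<partial>torus) = (\<integral>x. (indicator {-pi..pi} x / (2 * pi)) *\<^sub>R f x \<partial>lborel)"
    unfolding torus_def using assms by (intro integral_density) auto
  also have "\<dots> = (\<integral>x. (1 / (2 * pi)) *\<^sub>R (indicator {-pi..pi} x *\<^sub>R f x) \<partial>lborel)"
    by (intro Bochner_Integration.integral_cong) auto
  also have "\<dots> = (1 / (2 * pi)) *\<^sub>R (\<integral>x. indicator {-pi..pi} x *\<^sub>R f x \<partial>lborel)"
    by (rule integral_scaleR_right)
  finally show ?thesis .
qed

lemma prob_space_torus: "prob_space torus"
proof
  have "emeasure torus (space torus) = (\<integral>\<^sup>+x. ennreal (1 / (2 * pi)) * indicator {-pi..pi} x \<partial>lborel)"
    unfolding torus_def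
    by (subst emeasure_density) (auto intro!: nn_integral_cong simp: indicator_def)
  also have "\<dots> = 1"
    by (simp add: nn_integral_cmult_indicator ennreal_mult[symmetric])
  finally show "emeasure torus (space torus) = 1" .
qed

lemma integral_torus_cis: "(\<integral>x. cis (x * of_int k) \<partial>torus) = (if k = 0 then 1 else 0)"
proof (cases "k = 0")
  case True
  interpret prob_space torus by (rule prob_space_torus)
  show ?thesis using True by (simp add: prob_space[unfolded space_torus])
next
  case False
  \<comment> \<open>The antiderivative is differentiated as a complex function and then restricted
    to the real line.\<close>
  define G where "G z = exp (\<i> * of_int k * z) / (\<i> * of_int k)" for z
  define F where "F x = cis (x * of_int k) / (\<i> * of_int k)" for x
  have F: "F x = G (of_real x)" for x
    by (simp add: F_def G_def cis_conv_exp mult_ac)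
  have "(\<integral>x. indicator {-pi..pi} x *\<^sub>R cis (x * of_int k) \<partial>lborel) = F pi - F (-pi)"
  proof (rule integral_FTC_Icc)
    fix x :: real
    have "(G has_field_derivative exp (\<i> * of_int k * of_real x)) (at (of_real x))"
      unfolding G_def using False by (auto intro!: derivative_eq_intros)
    from has_vector_derivative_real_field[OF this]
    show "(F has_vector_derivative cis (x * of_int k)) (at x within {-pi..pi})"
      by (simp add: F[abs_def] cis_conv_exp mult_ac)
  qed (auto intro!: continuous_intros)
  also have "\<dots> = 0"
  proof -
    have "sin (pi * real_of_int k) = 0" by (simp add: sin_zero_iff_int2)
    then have "cis (pi * of_int k) = cis (- pi * of_int k)" by (simp add: cis_conv_exp complex_eq_iff Re_exp Im_exp)
    then show ?thesis by (simp add: F_def)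
  qed
  finally show ?thesis
    using False by (subst integral_torus) (auto intro!: borel_measurable_continuous_onI continuous_intros)
qed

text \<open>For |x| \<le> 2 the quartic Taylor bound gives even x^2/3. On [2, pi] the cosine is at
  most cos 2 \<le> -1/3, while x^2/12 \<le> 16/12 = 4/3 because pi < 4; this range dictates the
  constant 12.\<close>

lemma one_minus_cos_ge:
  assumes "\<bar>x\<bar> \<le> pi"
  shows "x\<^sup>2 / 12 \<le> 1 - cos x"
proof -
  have quartic: "cos y \<le> 1 - y\<^sup>2 / 2 + y ^ 4 / 24" for y :: real
  proof -
    obtain t where t: "cos y = (\<Sum>m<4. cos_coeff m * y ^ m) + (cos (t + 1/2 * real 4 * pi) / fact 4) * y ^ 4"
      using Maclaurin_cos_expansion[of y 4] by auto
    have "{..<4} = {0, 1, 2, 3::nat}" by auto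
    then have "(\<Sum>m<4. cos_coeff m * y ^ m) = 1 - y\<^sup>2 / 2"
      by (simp add: cos_coeff_def)
    moreover have "(cos (t + 1/2 * real 4 * pi) / fact 4) * y ^ 4 \<le> (1 / fact 4) * y ^ 4"
      by (intro mult_right_mono divide_right_mono) auto
    ultimately show ?thesis
      using t by (simp add: fact_numeral)
  qed
  have main: "y\<^sup>2 / 12 \<le> 1 - cos y" if y: "0 \<le> y" "y \<le> pi" for y
  proof (cases "y \<le> 2")
    case True
    have "y ^ 4 \<le> 4 * y\<^sup>2"
    proof -
      have "y ^ 2 * y ^ 2 \<le> 4 * y ^ 2"
        using True y power_mono[of y 2 2] by (intro mult_right_mono) auto
      then show ?thesis by (simp flip: power_add)
    qed
    then show ?thesis using quartic[of y] zero_le_power2[of y] by linarith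
  next
    case False
    have "y\<^sup>2 \<le> 16" using power_mono[of y 4 2] y pi_less_4 by simp
    moreover have "cos y \<le> cos 2" using False y by (intro cos_monotone_0_pi_le) auto
    moreover have "cos (2::real) \<le> - 1 / 3" using quartic[of 2] by simp
    ultimately show ?thesis by linarith
  qed
  show ?thesis
    using main[of "\<bar>x\<bar>"] assms by simp
qed

text \<open>The walk has period two, so its characteristic function has modulus one also at (pi,
  ..., pi). There 1 + cos x is 1 - cos of x - pi or of x + pi, whichever lies in [-pi, pi]; adding
  both Gaussians avoids recording which.\<close>

lemma exp_cos_le_gaussians:
  assumes "\<bar>x\<bar> \<le> pi" "0 \<le> s"
  shows "exp (- (s * (1 - cos x))) \<le> exp (- (s * x\<^sup>2 / 12))"
    and "exp (- (s * (1 + cos x))) \<le> exp (- (s * (x - pi)\<^sup>2 / 12)) + exp (- (s * (x + pi)\<^sup>2 / 12))"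
proof -
  show "exp (- (s * (1 - cos x))) \<le> exp (- (s * x\<^sup>2 / 12))"
    using mult_left_mono[OF one_minus_cos_ge[OF assms(1)] assms(2)] by simp
  show "exp (- (s * (1 + cos x))) \<le> exp (- (s * (x - pi)\<^sup>2 / 12)) + exp (- (s * (x + pi)\<^sup>2 / 12))"
  proof (cases "0 \<le> x")
    case True
    then have "exp (- (s * (1 + cos x))) \<le> exp (- (s * (x - pi)\<^sup>2 / 12))"
      using mult_left_mono[OF one_minus_cos_ge[of "x - pi"] assms(2)] assms by simp
    then show ?thesis by (rule add_increasing2[rotated]) simp
  next
    case False
    then have "exp (- (s * (1 + cos x))) \<le> exp (- (s * (x + pi)\<^sup>2 / 12))"
      using mult_left_mono[OF one_minus_cos_ge[of "x + pi"] assms(2)] assms by simp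
    then show ?thesis by (rule add_increasing[rotated]) simp
  qed
qed

lemma gaussian_integral:
  assumes "0 < s"
  shows "integrable lborel (\<lambda>x. exp (- (s * (x - m)\<^sup>2 / 12)))"
    and "(\<integral>x. exp (- (s * (x - m)\<^sup>2 / 12)) \<partial>lborel) = sqrt (12 * pi / s)"
proof -
  \<comment> \<open>Variance 6/s, because the exponent is (x - m)^2 / (2 * 6/s).\<close>
  define c where "c = sqrt (6 / s)"
  have c: "0 < c" "c\<^sup>2 = 6 / s" using assms by (auto simp: c_def)
  have eq: "exp (- (s * (x - m)\<^sup>2 / 12)) = sqrt (12 * pi / s) * normal_density m c x" for x
    using assms by (simp add: normal_density_def c(2) field_simps)
  show "integrable lborel (\<lambda>x. exp (- (s * (x - m)\<^sup>2 / 12)))"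
    unfolding eq using c by (intro integrable_mult_right integrable_normal_density)
  show "(\<integral>x. exp (- (s * (x - m)\<^sup>2 / 12)) \<partial>lborel) = sqrt (12 * pi / s)"
    unfolding eq using c by simp
qed

lemma integral_torus_exp_cos_le:
  assumes s: "0 < s"
  shows "(\<integral>x. exp (- (s * (1 - cos x))) \<partial>torus) \<le> 4 / sqrt s"
    and "(\<integral>x. exp (- (s * (1 + cos x))) \<partial>torus) \<le> 4 / sqrt s"
proof -
  \<comment> \<open>Two Gaussians of mass sqrt (12 pi / s) each, against the density 1/(2
    pi).\<close>
  have num: "1 / (2 * pi) * (2 * sqrt (12 * pi / s)) \<le> 4 / sqrt s"
  proof -
    have "sqrt (12 * pi) \<le> sqrt (16 * pi\<^sup>2)"
      using pi_ge_two by (intro real_sqrt_le_mono) (auto simp: power2_eq_square)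
    also have "\<dots> = 4 * pi" by (simp add: real_sqrt_mult)
    finally have "sqrt (12 * pi) / pi \<le> 4" by (simp add: field_simps)
    then have "sqrt (12 * pi) / pi / sqrt s \<le> 4 / sqrt s" using s by (intro divide_right_mono) auto
    then show ?thesis by (simp add: real_sqrt_divide field_simps)
  qed
  have *: "(\<integral>x. f x \<partial>torus) \<le> 4 / sqrt s"
    if f: "f \<in> borel_measurable borel" "\<And>x. 0 \<le> f x"
      "\<And>x. \<bar>x\<bar> \<le> pi \<Longrightarrow> f x \<le> exp (- (s * (x - m)\<^sup>2 / 12)) + exp (- (s * (x - m')\<^sup>2 / 12))"
    for f m m'
  proof -
    have "(\<integral>x. indicator {-pi..pi} x *\<^sub>R f x \<partial>lborel)
        \<le> (\<integral>x. exp (- (s * (x - m)\<^sup>2 / 12)) + exp (- (s * (x - m')\<^sup>2 / 12)) \<partial>lborel)"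
    proof (rule integral_mono_AE')
      show "AE x in lborel. indicator {-pi..pi} x *\<^sub>R f x
          \<le> exp (- (s * (x - m)\<^sup>2 / 12)) + exp (- (s * (x - m')\<^sup>2 / 12))"
        using f by (intro AE_I2) (auto simp: indicator_def add_nonneg_nonneg)
    qed (use gaussian_integral(1)[OF s] f in \<open>auto simp: indicator_def add_nonneg_nonneg\<close>)
    also have "\<dots> = 2 * sqrt (12 * pi / s)"
      using gaussian_integral[OF s] by simp
    finally have "(\<integral>x. f x \<partial>torus) \<le> 1 / (2 * pi) * (2 * sqrt (12 * pi / s))"
      unfolding integral_torus[OF f(1)] real_scaleR_def by (intro mult_left_mono) auto
    with num show ?thesis by linarith
  qed
  show "(\<integral>x. exp (- (s * (1 - cos x))) \<partial>torus) \<le> 4 / sqrt s"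
  proof (rule *[where m = 0 and m' = 0])
    fix x :: real assume "\<bar>x\<bar> \<le> pi"
    from exp_cos_le_gaussians(1)[OF this less_imp_le[OF s]]
    show "exp (- (s * (1 - cos x))) \<le> exp (- (s * (x - 0)\<^sup>2 / 12)) + exp (- (s * (x - 0)\<^sup>2 / 12))"
      by (intro add_increasing2) simp_all
  qed auto
  show "(\<integral>x. exp (- (s * (1 + cos x))) \<partial>torus) \<le> 4 / sqrt s"
  proof (rule *[where m = pi and m' = "- pi"])
    fix x :: real assume "\<bar>x\<bar> \<le> pi"
    from exp_cos_le_gaussians(2)[OF this less_imp_le[OF s]]
    show "exp (- (s * (1 + cos x))) \<le> exp (- (s * (x - pi)\<^sup>2 / 12)) + exp (- (s * (x - - pi)\<^sup>2 / 12))"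
      by simp
  qed auto
qed

text \<open>The characteristic function of one step; opposite unit vectors pair up to cosines, so it
  is real. Angles are functions on the index type to match \<open>PiM\<close>.\<close>

definition step_char :: "('d::finite \<Rightarrow> real) \<Rightarrow> real" where
  "step_char \<theta> = (\<Sum>i\<in>UNIV. cos (\<theta> i)) / real CARD('d)"

abbreviation torus_pow :: "('d::finite \<Rightarrow> real) measure" where
  "torus_pow \<equiv> PiM UNIV (\<lambda>_. torus)"

lemma prob_space_torus_pow: "prob_space torus_pow"
  by (intro prob_space_PiM prob_space_torus)

lemma step_char_measurable [measurable]: "step_char \<in> borel_measurable torus_pow"
  unfolding step_char_def[abs_def] by measurable

lemma abs_step_char_le: "\<bar>step_char (\<theta> :: 'd::finite \<Rightarrow> real)\<bar> \<le> 1"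
proof -
  have "\<bar>\<Sum>i\<in>UNIV. cos (\<theta> i)\<bar> \<le> (\<Sum>i\<in>(UNIV::'d set). 1)"
    by (rule order_trans[OF sum_abs sum_mono]) simp
  then show ?thesis by (simp add: step_char_def abs_divide field_simps)
qed

text \<open>The inequality \<open>\<bar>x\<bar> \<le> exp (\<bar>x\<bar> - 1)\<close> turns the power into products over the coordinates.\<close>

lemma abs_step_char_power_le:
  fixes \<theta> :: "'d::finite \<Rightarrow> real" and n :: nat
  defines "s \<equiv> real n / real CARD('d)"
  shows "\<bar>step_char \<theta>\<bar> ^ n \<le> (\<Prod>i\<in>UNIV. exp (- (s * (1 - cos (\<theta> i))))) + (\<Prod>i\<in>UNIV. exp (- (s * (1 + cos (\<theta> i)))))"
proof -
  have p1: "(\<Prod>i\<in>UNIV. exp (- (s * (1 - cos (\<theta> i))))) = exp (real n * (step_char \<theta> - 1))"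
    by (simp add: exp_sum[symmetric] s_def step_char_def sum_negf sum_distrib_left[symmetric]
        sum_subtractf field_simps flip: sum_divide_distrib)
  have p2: "(\<Prod>i\<in>UNIV. exp (- (s * (1 + cos (\<theta> i))))) = exp (real n * (- step_char \<theta> - 1))"
    by (simp add: exp_sum[symmetric] s_def step_char_def sum_negf sum_distrib_left[symmetric]
        sum.distrib field_simps flip: sum_divide_distrib)
  have "\<bar>step_char \<theta>\<bar> \<le> exp (\<bar>step_char \<theta>\<bar> - 1)"
    using exp_ge_add_one_self[of "\<bar>step_char \<theta>\<bar> - 1"] by simp
  then have "\<bar>step_char \<theta>\<bar> ^ n \<le> exp (\<bar>step_char \<theta>\<bar> - 1) ^ n"
    by (rule power_mono) simp
  also have "\<dots> = exp (real n * (\<bar>step_char \<theta>\<bar> - 1))"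
    by (simp flip: exp_of_nat_mult)
  also have "\<dots> \<le> exp (real n * (step_char \<theta> - 1)) + exp (real n * (- step_char \<theta> - 1))"
    by (cases "0 \<le> step_char \<theta>") (auto simp: add_increasing add_increasing2)
  finally show ?thesis unfolding p1 p2 .
qed

text \<open>Both products factorise over the coordinates. Each one-dimensional integral is at most 1
  and at most 4 / sqrt s, so with d \<ge> 6 factors the sixth power of 4 / sqrt s remains, which is
  of order n^-3. The dimension enters here.\<close>

lemma integral_abs_step_char_power_le:
  assumes d: "6 \<le> CARD('d::finite)"
  shows "\<exists>C\<ge>0. \<forall>n. (\<integral>\<theta>. \<bar>step_char (\<theta> :: 'd \<Rightarrow> real)\<bar> ^ n \<partial>torus_pow) \<le> C / real (n + 1) ^ 3"
proof -
  interpret T: prob_space torus by (rule prob_space_torus)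
  interpret P: product_prob_space "\<lambda>_::'d. torus" UNIV by unfold_locales
  define D where "D = real CARD('d)"
  have D: "0 < D" by (simp add: D_def)
  \<comment> \<open>Two products with s = n / D give 2 * 4^6 * D^3, and (n + 1)^3 \<le> (2 n)^3
    gives a factor 8. For n = 0 the integral is 1, which only needs C \<ge> 1.\<close>
  define C where "C = 16 * 4 ^ 6 * D ^ 3"
  have bound: "(\<integral>\<theta>. \<bar>step_char (\<theta> :: 'd \<Rightarrow> real)\<bar> ^ n \<partial>torus_pow) \<le> C / real (n + 1) ^ 3" if n: "0 < n" for n
  proof -
    define s where "s = real n / D"
    have s: "0 < s" using n D by (simp add: s_def)
    let ?f = "\<lambda>x. exp (- (s * (1 - cos x)))" and ?g = "\<lambda>x. exp (- (s * (1 + cos x)))"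
    have le1: "?f x \<le> 1" "?g x \<le> 1" for x
      using s cos_le_one[of x] cos_ge_minus_one[of x] by (auto intro!: mult_nonneg_nonneg simp del: cos_le_one cos_ge_minus_one)
    have int: "integrable torus ?f" "integrable torus ?g"
      using le1 by (auto intro!: T.integrable_const_bound[where B = 1])
    have pow: "(\<integral>x. h x \<partial>torus) ^ CARD('d) \<le> 4 ^ 6 / s ^ 3"
      if h: "integrable torus h" "\<And>x. 0 \<le> h x" "\<And>x. h x \<le> 1" "(\<integral>x. h x \<partial>torus) \<le> 4 / sqrt s" for h
    proof -
      have h0: "0 \<le> (\<integral>x. h x \<partial>torus)" using h by simp
      have "(\<integral>x. h x \<partial>torus) \<le> (\<integral>x. 1 \<partial>torus)" using h by (intro integral_mono) auto
      then have "(\<integral>x. h x \<partial>torus) \<le> 1" by (simp add: T.prob_space[unfolded space_torus])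
      then have "(\<integral>x. h x \<partial>torus) ^ CARD('d) \<le> (\<integral>x. h x \<partial>torus) ^ 6"
        using d h0 by (intro power_decreasing) auto
      also have "\<dots> \<le> (4 / sqrt s) ^ 6" using h h0 by (intro power_mono) auto
      also have "\<dots> = 4 ^ 6 / s ^ 3"
      proof -
        have "sqrt s ^ 6 = (sqrt s ^ 2) ^ 3" by (simp flip: power_mult)
        then show ?thesis using s by (simp add: power_divide)
      qed
      finally show ?thesis .
    qed
    have "(\<integral>\<theta>. \<bar>step_char (\<theta> :: 'd \<Rightarrow> real)\<bar> ^ n \<partial>torus_pow)
      \<le> (\<integral>\<theta>. (\<Prod>i\<in>(UNIV::'d set). ?f (\<theta> i)) + (\<Prod>i\<in>UNIV. ?g (\<theta> i)) \<partial>torus_pow)"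
    proof (rule integral_mono)
      show "integrable torus_pow (\<lambda>\<theta>. \<bar>step_char (\<theta> :: 'd \<Rightarrow> real)\<bar> ^ n)"
        by (rule P.integrable_const_bound[where B = 1]) (auto simp: abs_step_char_le power_le_one)
      show "integrable torus_pow (\<lambda>\<theta>. (\<Prod>i\<in>(UNIV::'d set). ?f (\<theta> i)) + (\<Prod>i\<in>UNIV. ?g (\<theta> i)))"
        using int by (intro Bochner_Integration.integrable_add P.product_integrable_prod) auto
    qed (use abs_step_char_power_le in \<open>auto simp: s_def D_def\<close>)
    also have "\<dots> = (\<integral>\<theta>. (\<Prod>i\<in>(UNIV::'d set). ?f (\<theta> i)) \<partial>torus_pow) + (\<integral>\<theta>. (\<Prod>i\<in>(UNIV::'d set). ?g (\<theta> i)) \<partial>torus_pow)"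
      using int by (intro Bochner_Integration.integral_add P.product_integrable_prod) auto
    also have "\<dots> = (\<integral>x. ?f x \<partial>torus) ^ CARD('d) + (\<integral>x. ?g x \<partial>torus) ^ CARD('d)"
      using P.product_integral_prod[of UNIV "\<lambda>_. ?f"] P.product_integral_prod[of UNIV "\<lambda>_. ?g"] int by simp
    also have "\<dots> \<le> 4 ^ 6 / s ^ 3 + 4 ^ 6 / s ^ 3"
      using int le1 integral_torus_exp_cos_le[OF s] by (intro add_mono pow) auto
    also have "\<dots> = 2 * 4 ^ 6 * D ^ 3 / real n ^ 3"
      using D n by (simp add: s_def power_divide field_simps)
    also have "\<dots> \<le> C / real (n + 1) ^ 3"
    proof -
      have "real (n + 1) ^ 3 \<le> (2 * real n) ^ 3" using n by (intro power_mono) auto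
      then have "real (n + 1) ^ 3 \<le> 8 * real n ^ 3" by (simp add: power_mult_distrib)
      moreover have "0 \<le> 2 * 4 ^ 6 * D ^ 3" using D by simp
      ultimately have "2 * 4 ^ 6 * D ^ 3 * real (n + 1) ^ 3 \<le> 2 * 4 ^ 6 * D ^ 3 * (8 * real n ^ 3)"
        by (rule mult_left_mono)
      then show ?thesis using n by (simp add: C_def divide_simps mult_ac)
    qed
    finally show ?thesis .
  qed
  have "1 \<le> C"
  proof -
    have "1 ^ 3 \<le> D ^ 3" using d by (intro power_mono) (auto simp: D_def)
    then show ?thesis by (simp add: C_def)
  qed
  then show ?thesis
  proof (intro exI[of _ C] conjI allI)
    show "(\<integral>\<theta>. \<bar>step_char (\<theta> :: 'd \<Rightarrow> real)\<bar> ^ n \<partial>torus_pow) \<le> C / real (n + 1) ^ 3" for n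
      using bound[of n] \<open>1 \<le> C\<close> by (cases "n = 0") (auto simp: prob_space.prob_space[OF prob_space_torus_pow])
  qed simp
qed

section \<open>Characters of the lattice and Fourier inversion\<close>

definition lattice_char :: "('d::finite \<Rightarrow> real) \<Rightarrow> int ^ 'd \<Rightarrow> complex" where
  "lattice_char \<theta> z = (\<Prod>i\<in>UNIV. cis (\<theta> i * of_int (z $ i)))"

lemma norm_lattice_char [simp]: "norm (lattice_char \<theta> z) = 1"
  by (simp add: lattice_char_def prod_norm[symmetric])

lemma lattice_char_0 [simp]: "lattice_char \<theta> 0 = 1"
  by (simp add: lattice_char_def)

lemma lattice_char_add: "lattice_char \<theta> (x + y) = lattice_char \<theta> x * lattice_char \<theta> y"
  by (simp add: lattice_char_def prod.distrib[symmetric] distrib_left cis_mult)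

lemma lattice_char_minus: "lattice_char \<theta> (- x) = lattice_char (\<lambda>i. - \<theta> i) x"
  by (simp add: lattice_char_def)

lemma lattice_char_sum: "lattice_char \<theta> (\<Sum>k\<in>A. f k) = (\<Prod>k\<in>A. lattice_char \<theta> (f k))"
  by (induction A rule: infinite_finite_induct) (simp_all add: lattice_char_add)

lemma lattice_char_axis: "lattice_char \<theta> (axis i k) = cis (\<theta> i * of_int k)"
proof -
  have "lattice_char \<theta> (axis i k) = (\<Prod>j\<in>UNIV. if j = i then cis (\<theta> i * of_int k) else 1)"
    unfolding lattice_char_def by (intro prod.cong) (auto simp: axis_def)
  then show ?thesis by (simp add: prod.delta)
qed

lemma step_char_uminus: "step_char (\<lambda>i. - \<theta> i) = step_char \<theta>"
  by (simp add: step_char_def)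

lemma finite_unit_steps [simp]: "finite unit_steps"
  by (simp add: unit_steps_def)

lemma unit_steps_nonempty [simp]: "unit_steps \<noteq> {}"
  by (auto simp: unit_steps_def)

lemma sum_unit_steps:
  fixes f :: "int ^ 'd \<Rightarrow> 'b::comm_monoid_add"
  shows "(\<Sum>u\<in>unit_steps. f u) = (\<Sum>i\<in>UNIV. f (axis i 1) + f (- axis i 1))"
proof -
  have "(\<Sum>u\<in>unit_steps. f u) = (\<Sum>i\<in>UNIV. \<Sum>u\<in>{axis i 1, - axis i 1}. f u)"
    unfolding unit_steps_def
  proof (rule sum.UNION_disjoint)
    show "\<forall>i\<in>UNIV. \<forall>j\<in>UNIV. i \<noteq> j \<longrightarrow>
        {axis i 1, - axis i 1 :: int ^ 'd} \<inter> {axis j 1, - axis j 1} = {}"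
      by (auto simp: vec_eq_iff axis_def)
  qed auto
  also have "\<dots> = (\<Sum>i\<in>UNIV. f (axis i 1) + f (- axis i 1))"
  proof (rule sum.cong[OF refl])
    fix i :: 'd
    have "axis i 1 \<noteq> (- axis i 1 :: int ^ 'd)"
      by (auto simp: vec_eq_iff axis_def intro!: exI[of _ i])
    then show "(\<Sum>u\<in>{axis i 1, - axis i 1}. f u) = f (axis i 1) + f (- axis i 1)" by simp
  qed
  finally show ?thesis .
qed

lemma expectation_lattice_char_step:
  "(\<integral>u. lattice_char \<theta> u \<partial>measure_pmf (pmf_of_set (unit_steps :: (int ^ 'd) set))) = of_real (step_char \<theta>)"
proof -
  have card: "card (unit_steps :: (int ^ 'd) set) = 2 * CARD('d)"
    using sum_unit_steps[of "\<lambda>_::int ^ 'd. 1::nat"] by simp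
  have "(\<integral>u. lattice_char \<theta> u \<partial>measure_pmf (pmf_of_set (unit_steps :: (int ^ 'd) set)))
      = (\<Sum>u\<in>unit_steps. lattice_char \<theta> u) / of_nat (card (unit_steps :: (int ^ 'd) set))"
    by (subst integral_measure_pmf[of unit_steps])
       (auto simp: sum_divide_distrib scaleR_conv_of_real intro!: sum.cong)
  also have "(\<Sum>u\<in>unit_steps. lattice_char \<theta> u) = (\<Sum>i\<in>UNIV. of_real (2 * cos (\<theta> i)))"
    unfolding sum_unit_steps
    by (intro sum.cong refl) (simp add: lattice_char_minus lattice_char_axis complex_eq_iff)
  finally show ?thesis
    by (simp add: card step_char_def sum_distrib_left[symmetric])
qed

lemma (in prob_space) expectation_lattice_char_sum:
  fixes \<xi> :: "nat \<Rightarrow> 'a \<Rightarrow> int ^ 'd"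
  assumes indep: "indep_vars (\<lambda>_. count_space UNIV) \<xi> I" and "finite I"
    and law: "\<And>i. i \<in> I \<Longrightarrow> distr M (count_space UNIV) (\<xi> i) = measure_pmf (pmf_of_set unit_steps)"
  shows "expectation (\<lambda>\<omega>. lattice_char \<theta> (\<Sum>i\<in>I. \<xi> i \<omega>)) = of_real (step_char \<theta> ^ card I)"
proof -
  have rv: "random_variable (count_space UNIV) (\<xi> i)" if "i \<in> I" for i
    using indep that by (auto simp: indep_vars_def)
  have "expectation (\<lambda>\<omega>. lattice_char \<theta> (\<Sum>i\<in>I. \<xi> i \<omega>)) = expectation (\<lambda>\<omega>. \<Prod>i\<in>I. lattice_char \<theta> (\<xi> i \<omega>))"
    by (simp add: lattice_char_sum)
  also have "\<dots> = (\<Prod>i\<in>I. expectation (\<lambda>\<omega>. lattice_char \<theta> (\<xi> i \<omega>)))"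
  proof (rule indep_vars_lebesgue_integral)
    show "indep_vars (\<lambda>_. borel) (\<lambda>i \<omega>. lattice_char \<theta> (\<xi> i \<omega>)) I"
      by (rule indep_vars_compose2[OF indep]) simp
    fix i assume "i \<in> I"
    then show "integrable M (\<lambda>\<omega>. lattice_char \<theta> (\<xi> i \<omega>))"
      using rv by (intro integrable_const_bound[where B = 1]) auto
  qed fact
  also have "\<dots> = (\<Prod>i\<in>I. of_real (step_char \<theta>))"
  proof (rule prod.cong[OF refl])
    fix i assume i: "i \<in> I"
    have "expectation (\<lambda>\<omega>. lattice_char \<theta> (\<xi> i \<omega>)) = (\<integral>u. lattice_char \<theta> u \<partial>distr M (count_space UNIV) (\<xi> i))"
      by (rule integral_distr[symmetric]) (use rv i in auto)
    then show "expectation (\<lambda>\<omega>. lattice_char \<theta> (\<xi> i \<omega>)) = of_real (step_char \<theta>)"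
      using law[OF i] expectation_lattice_char_step by metis
  qed
  finally show ?thesis by simp
qed

text \<open>Orthogonality, coordinate by coordinate. After a shift it writes the indicator of a
  lattice point as an average of characters.\<close>

lemma integral_torus_pow_lattice_char:
  "(\<integral>\<theta>. lattice_char \<theta> (z :: int ^ 'd) \<partial>torus_pow) = (if z = 0 then 1 else 0)"
proof -
  interpret T: prob_space torus by (rule prob_space_torus)
  interpret P: product_prob_space "\<lambda>_::'d. torus" UNIV by unfold_locales
  have [measurable]: "cis \<in> borel_measurable borel"
    by (intro borel_measurable_continuous_onI continuous_intros)
  have "integrable torus (\<lambda>x. cis (x * of_int k))" for k
    by (rule T.integrable_const_bound[where B = 1]) (simp, measurable)
  then have "(\<integral>\<theta>. lattice_char \<theta> z \<partial>torus_pow) = (\<Prod>i\<in>UNIV. \<integral>x. cis (x * of_int (z $ i)) \<partial>torus)"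
    unfolding lattice_char_def by (intro P.product_integral_prod) auto
  also have "\<dots> = (if z = 0 then 1 else 0)"
    by (auto simp: integral_torus_cis vec_eq_iff)
  finally show ?thesis .
qed

lemma lattice_char_measurable [measurable]:
  assumes [measurable]: "X \<in> measurable M (count_space UNIV)"
  shows "(\<lambda>(\<omega>, \<theta>). lattice_char \<theta> (X \<omega>)) \<in> borel_measurable (M \<Otimes>\<^sub>M torus_pow)"
proof -
  have [measurable]: "cis \<in> borel_measurable borel"
    by (intro borel_measurable_continuous_onI continuous_intros)
  have [measurable]: "(\<lambda>z::int ^ 'd. real_of_int (z $ i)) \<in> borel_measurable (count_space UNIV)" for i
    by simp
  show ?thesis unfolding lattice_char_def by measurable
qed

lemma lattice_char_measurable_left [measurable]:
  "(\<lambda>\<theta>. lattice_char \<theta> z) \<in> borel_measurable torus_pow"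
proof -
  have [measurable]: "cis \<in> borel_measurable borel"
    by (intro borel_measurable_continuous_onI continuous_intros)
  show ?thesis unfolding lattice_char_def by measurable
qed

lemma (in prob_space) lattice_char_Fubini:
  fixes X :: "'a \<Rightarrow> int ^ 'd" and g :: "('d \<Rightarrow> real) \<Rightarrow> complex"
  assumes X: "X \<in> measurable M (count_space UNIV)"
    and g [measurable]: "g \<in> borel_measurable torus_pow" and b: "\<And>\<theta>. norm (g \<theta>) \<le> 1"
  shows "expectation (\<lambda>\<omega>. \<integral>\<theta>. g \<theta> * lattice_char \<theta> (X \<omega>) \<partial>torus_pow)
    = (\<integral>\<theta>. g \<theta> * expectation (\<lambda>\<omega>. lattice_char \<theta> (X \<omega>)) \<partial>torus_pow)"
proof -
  interpret T: prob_space "torus_pow :: ('d \<Rightarrow> real) measure" by (rule prob_space_torus_pow)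
  interpret P: pair_prob_space M "torus_pow :: ('d \<Rightarrow> real) measure" by unfold_locales
  note [measurable] = lattice_char_measurable[OF X]
  have "integrable (M \<Otimes>\<^sub>M torus_pow) (\<lambda>(\<omega>, \<theta>). g \<theta> * lattice_char \<theta> (X \<omega>))"
  proof (rule P.P.integrable_const_bound[where B = 1])
    show "AE x in M \<Otimes>\<^sub>M torus_pow. norm (case x of (\<omega>, \<theta>) \<Rightarrow> g \<theta> * lattice_char \<theta> (X \<omega>)) \<le> 1"
      using b by (intro AE_I2) (auto simp: norm_mult)
    show "(\<lambda>(\<omega>, \<theta>). g \<theta> * lattice_char \<theta> (X \<omega>)) \<in> borel_measurable (M \<Otimes>\<^sub>M torus_pow)"
      using lattice_char_measurable[OF X] by (simp add: case_prod_beta')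
  qed
  from P.Fubini_integral[OF this] show ?thesis by simp
qed

text \<open>The indicator of X = z is the torus average of the character at X - z; Fubini moves the
  expectation onto the character.\<close>

lemma (in prob_space) prob_eq_Fourier:
  fixes X :: "'a \<Rightarrow> int ^ 'd"
  assumes X: "X \<in> measurable M (count_space UNIV)"
    and ch: "\<And>\<theta>. expectation (\<lambda>\<omega>. lattice_char \<theta> (X \<omega>)) = of_real (step_char \<theta> ^ n)"
  shows "of_real (prob {\<omega>\<in>space M. X \<omega> = z}) = (\<integral>\<theta>. of_real (step_char \<theta> ^ n) * lattice_char \<theta> (- z) \<partial>torus_pow)"
proof -
  have [measurable]: "{\<omega>\<in>space M. X \<omega> = z} \<in> events"
    using measurable_sets[OF X, of "{z}"] by (simp add: vimage_def Int_def conj_commute)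
  have "of_real (prob {\<omega>\<in>space M. X \<omega> = z}) = expectation (\<lambda>\<omega>. of_real (indicator {\<omega>\<in>space M. X \<omega> = z} \<omega>) :: complex)"
    by (simp add: integral_of_real)
  also have "\<dots> = expectation (\<lambda>\<omega>. \<integral>\<theta>. lattice_char \<theta> (- z) * lattice_char \<theta> (X \<omega>) \<partial>torus_pow)"
    by (intro Bochner_Integration.integral_cong)
       (auto simp: lattice_char_add[symmetric] integral_torus_pow_lattice_char indicator_def)
  also have "\<dots> = (\<integral>\<theta>. lattice_char \<theta> (- z) * expectation (\<lambda>\<omega>. lattice_char \<theta> (X \<omega>)) \<partial>torus_pow)"
    by (rule lattice_char_Fubini[OF X]) auto
  finally show ?thesis by (simp add: ch mult.commute)
qed

text \<open>If p is the m-step transition probability and X a displacement over n steps, the left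
  side is a return probability at time n + m: the powers of \<open>step_char\<close> multiply. The
  reflection of X is harmless, as \<open>step_char\<close> is even.\<close>

lemma (in prob_space) expectation_Fourier_coeff_le:
  fixes X :: "'a \<Rightarrow> int ^ 'd" and p :: "int ^ 'd \<Rightarrow> real"
  assumes X: "X \<in> measurable M (count_space UNIV)"
    and ch: "\<And>\<theta>. expectation (\<lambda>\<omega>. lattice_char \<theta> (X \<omega>)) = of_real (step_char \<theta> ^ n)"
    and p: "\<And>z. of_real (p z) = (\<integral>\<theta>. of_real (step_char \<theta> ^ m) * lattice_char \<theta> (- z) \<partial>torus_pow)"
  shows "expectation (\<lambda>\<omega>. p (X \<omega>)) \<le> (\<integral>\<theta>. \<bar>step_char (\<theta> :: 'd \<Rightarrow> real)\<bar> ^ (n + m) \<partial>torus_pow)"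
proof -
  have X': "(\<lambda>\<omega>. - X \<omega>) \<in> measurable M (count_space UNIV)"
    by (rule measurable_compose[OF X]) simp
  have "complex_of_real (expectation (\<lambda>\<omega>. p (X \<omega>)))
      = expectation (\<lambda>\<omega>. \<integral>\<theta>. of_real (step_char \<theta> ^ m) * lattice_char \<theta> (- X \<omega>) \<partial>torus_pow)"
    unfolding p[symmetric] by simp
  also have "\<dots> = (\<integral>\<theta>. of_real (step_char \<theta> ^ m) * expectation (\<lambda>\<omega>. lattice_char \<theta> (- X \<omega>)) \<partial>torus_pow)"
    by (rule lattice_char_Fubini[OF X']) (auto simp: norm_power abs_step_char_le power_le_one)
  also have "\<dots> = (\<integral>\<theta>. of_real (step_char (\<theta> :: 'd \<Rightarrow> real) ^ (n + m)) \<partial>torus_pow)"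
    by (simp add: lattice_char_minus ch step_char_uminus power_add mult.commute)
  finally have "expectation (\<lambda>\<omega>. p (X \<omega>)) = (\<integral>\<theta>. step_char (\<theta> :: 'd \<Rightarrow> real) ^ (n + m) \<partial>torus_pow)"
    by (simp del: of_real_power)
  also have "\<dots> \<le> (\<integral>\<theta>. \<bar>step_char (\<theta> :: 'd \<Rightarrow> real)\<bar> ^ (n + m) \<partial>torus_pow)"
  proof (rule integral_mono)
    interpret T: prob_space "torus_pow :: ('d \<Rightarrow> real) measure" by (rule prob_space_torus_pow)
    show "integrable torus_pow (\<lambda>\<theta>. step_char (\<theta> :: 'd \<Rightarrow> real) ^ (n + m))"
      "integrable torus_pow (\<lambda>\<theta>. \<bar>step_char (\<theta> :: 'd \<Rightarrow> real)\<bar> ^ (n + m))"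
      by (auto intro!: T.integrable_const_bound[where B = 1] AE_I2 simp: power_abs abs_step_char_le power_le_one)
  qed (simp add: power_abs[symmetric])
  finally show ?thesis .
qed

section \<open>Capacities of segments of the walk\<close>

abbreviation steps_pow :: "(nat \<Rightarrow> int ^ 'd) measure" where
  "steps_pow \<equiv> PiM UNIV (\<lambda>_. measure_pmf (pmf_of_set unit_steps))"

abbreviation path_space :: "(nat \<Rightarrow> int ^ 'd) measure" where
  "path_space \<equiv> PiM UNIV (\<lambda>_. count_space UNIV)"

lemma prob_space_steps_pow: "prob_space steps_pow"
  by (intro prob_space_PiM measure_pmf.prob_space_axioms)

lemma walk_law_measurable [measurable]:
  "(\<lambda>\<xi> n. x + (\<Sum>k<n. \<xi> k)) \<in> steps_pow \<rightarrow>\<^sub>M path_space"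
proof (rule measurable_PiM_single')
  fix n :: nat
  have "(\<lambda>\<xi>. \<Sum>k<n. \<xi> k) \<in> steps_pow \<rightarrow>\<^sub>M count_space (UNIV :: (int ^ 'd) set)"
  proof (induction n)
    case (Suc n)
    have "(\<lambda>\<xi>. (\<lambda>a \<xi>. a + \<xi> n) (\<Sum>k<n. \<xi> k) \<xi>) \<in> steps_pow \<rightarrow>\<^sub>M count_space (UNIV :: (int ^ 'd) set)"
      by (rule measurable_compose_countable[OF _ Suc])
         (rule measurable_compose[OF measurable_component_singleton], auto)
    then show ?case by simp
  qed simp
  then show "(\<lambda>\<xi>. x + (\<Sum>k<n. \<xi> k)) \<in> steps_pow \<rightarrow>\<^sub>M count_space UNIV"
    by (rule measurable_compose) simp
qed auto

lemma prob_space_walk_law: "prob_space (walk_law x)"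
  unfolding walk_law_def by (rule prob_space.prob_space_distr[OF prob_space_steps_pow walk_law_measurable])

lemma sets_walk_law [simp, measurable_cong]:
  "sets (walk_law x) = sets path_space"
  by (simp add: walk_law_def)

lemma space_walk_law [simp]: "space (walk_law x) = UNIV"
  by (simp add: walk_law_def space_PiM)

lemma avoid_measurable [measurable]:
  fixes A :: "(int ^ 'd) set"
  shows "{s. \<forall>n>0. s n \<notin> A} \<in> sets path_space"
proof -
  have "{s\<in>space path_space. \<forall>n>0. s n \<notin> A} \<in> sets path_space"
    by measurable
  then show ?thesis by (simp add: space_PiM)
qed

lemma visit_measurable [measurable]:
  fixes A :: "(int ^ 'd) set"
  shows "{s. s n \<in> A} \<in> sets path_space"
proof -
  have "{s\<in>space path_space. s n \<in> A} \<in> sets path_space"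
    by measurable
  then show ?thesis by (simp add: space_PiM)
qed

lemma walk_law_translate:
  fixes v x :: "int ^ 'd"
  shows "walk_law (v + x) = distr (walk_law x) path_space (\<lambda>s n. v + s n)"
proof -
  have "(\<lambda>s n. v + s n) \<in> path_space \<rightarrow>\<^sub>M path_space"
    by (rule measurable_PiM_single') (auto intro: measurable_compose[OF measurable_component_singleton])
  from distr_distr[OF this walk_law_measurable] show ?thesis
    unfolding walk_law_def by (simp add: o_def add.assoc)
qed

lemma measure_walk_law_translate:
  fixes v x :: "int ^ 'd"
  assumes "A \<in> sets path_space"
  shows "measure (walk_law (v + x)) A = measure (walk_law x) {s. (\<lambda>n. v + s n) \<in> A}"
proof -
  have "(\<lambda>s n. v + s n) \<in> walk_law x \<rightarrow>\<^sub>M path_space"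
    by (rule measurable_PiM_single')
       (auto intro: measurable_compose[OF measurable_component_singleton] simp: measurable_cong_sets[OF sets_walk_law refl])
  from measure_distr[OF this assms] show ?thesis
    by (simp add: walk_law_translate vimage_def)
qed

section \<open>Escape probabilities and Green's function\<close>

definition escape_prob :: "(int ^ 'd) set \<Rightarrow> int ^ 'd \<Rightarrow> real" where
  "escape_prob A x = measure (walk_law x) {s. \<forall>n>0. s n \<notin> A}"

definition walk_prob :: "nat \<Rightarrow> int ^ 'd \<Rightarrow> real" where
  "walk_prob n z = measure (walk_law 0) {s. s n = z}"

text \<open>Valued in \<open>ennreal\<close>, so that union bounds and exchanges of sums need no
  prior proof of convergence.\<close>

definition green :: "int ^ 'd \<Rightarrow> ennreal" where
  "green z = (\<Sum>n. ennreal (walk_prob n z))"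

lemma return_time_infinite_iff: "return_time A s = \<infinity> \<longleftrightarrow> (\<forall>n>0. s n \<notin> A)"
proof
  assume inf: "return_time A s = \<infinity>"
  show "\<forall>n>0. s n \<notin> A"
  proof (intro allI impI notI)
    fix n :: nat assume "0 < n" "s n \<in> A"
    then have "return_time A s \<le> enat n"
      unfolding return_time_def by (intro INF_lower) auto
    then show False using inf by simp
  qed
next
  assume "\<forall>n>0. s n \<notin> A"
  then have "{n. 1 \<le> n \<and> s n \<in> A} = {}" by auto
  then show "return_time A s = \<infinity>"
    unfolding return_time_def by (simp add: Inf_enat_def)
qed

lemma capacity_eq_sum_escape_prob:
  assumes "finite A"
  shows "enn2real (capacity A) = (\<Sum>x\<in>A. escape_prob A x)"
proof -
  interpret W: prob_space "walk_law x" for x :: "int ^ 'd" by (rule prob_space_walk_law)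
  have "capacity A = (\<Sum>x\<in>A. ennreal (escape_prob A x))"
    unfolding capacity_def using assms
    by (simp add: return_time_infinite_iff escape_prob_def W.emeasure_eq_measure)
  also have "\<dots> = ennreal (\<Sum>x\<in>A. escape_prob A x)"
    by (rule sum_ennreal) (simp add: escape_prob_def)
  finally show ?thesis by (simp add: sum_nonneg escape_prob_def)
qed

lemma escape_prob_nonneg: "0 \<le> escape_prob A x"
  by (simp add: escape_prob_def)

lemma escape_prob_le_1: "escape_prob A x \<le> 1"
  unfolding escape_prob_def by (rule prob_space.prob_le_1[OF prob_space_walk_law])

lemma escape_prob_antimono:
  assumes "A \<subseteq> B" shows "escape_prob B x \<le> escape_prob A x"
proof -
  interpret W: prob_space "walk_law x" by (rule prob_space_walk_law)
  show ?thesis unfolding escape_prob_def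
    by (rule W.finite_measure_mono) (use assms in auto)
qed

lemma capacity_le_card: "finite A \<Longrightarrow> enn2real (capacity A) \<le> real (card A)"
  using sum_bounded_above[of A "escape_prob A" 1]
  by (simp add: capacity_eq_sum_escape_prob escape_prob_le_1)

lemma capacity_translate:
  assumes "finite A"
  shows "enn2real (capacity ((+) v ` A)) = enn2real (capacity A)"
proof -
  have "escape_prob ((+) v ` A) (v + x) = escape_prob A x" for x
    unfolding escape_prob_def
    by (subst measure_walk_law_translate[OF avoid_measurable])
       (auto simp: image_iff intro!: arg_cong[of _ _ "measure (walk_law x)"])
  then show ?thesis
    using assms by (simp add: capacity_eq_sum_escape_prob sum.reindex)
qed

text \<open>Enlarging a set lowers its escape probabilities, and summing over A and B separately
  counts the intersection twice.\<close>

lemma capacity_Un_le: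
  assumes "finite A" "finite B"
  shows "enn2real (capacity (A \<union> B)) \<le> enn2real (capacity A) + enn2real (capacity B)"
proof -
  have "(\<Sum>x\<in>A \<union> B. escape_prob (A \<union> B) x) \<le> (\<Sum>x\<in>A. escape_prob (A \<union> B) x) + (\<Sum>x\<in>B. escape_prob (A \<union> B) x)"
    using sum.union_inter[OF assms, of "escape_prob (A \<union> B)"]
      sum_nonneg[of "A \<inter> B" "escape_prob (A \<union> B)"] escape_prob_nonneg by (smt (verit))
  also have "\<dots> \<le> (\<Sum>x\<in>A. escape_prob A x) + (\<Sum>x\<in>B. escape_prob B x)"
    by (intro add_mono sum_mono escape_prob_antimono) auto
  finally show ?thesis using assms by (simp add: capacity_eq_sum_escape_prob)
qed

lemma walk_prob_walk_law: "measure (walk_law x) {s. s n = y} = walk_prob n (y - x)"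
  using measure_walk_law_translate[of "{s. s n \<in> {y}}" x 0] visit_measurable[of n "{y}"]
  by (simp add: walk_prob_def eq_diff_eq add.commute)

lemma walk_prob_nonneg: "0 \<le> walk_prob n z"
  by (simp add: walk_prob_def)

lemma green_0_ge_1: "1 \<le> green (0 :: int ^ 'd)"
proof -
  interpret W: prob_space "walk_law 0 :: (nat \<Rightarrow> int ^ 'd) measure" by (rule prob_space_walk_law)
  have "AE s in walk_law (0 :: int ^ 'd). s 0 = 0"
    unfolding walk_law_def
    by (subst AE_distr_iff[OF walk_law_measurable]) (use visit_measurable[of 0 "{0}"] in \<open>auto simp: space_PiM\<close>)
  then have "walk_prob 0 (0 :: int ^ 'd) = 1"
    unfolding walk_prob_def using visit_measurable[of 0 "{0}"] by (subst W.prob_eq_1) auto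
  then have "1 = (\<Sum>n<1. ennreal (walk_prob n (0 :: int ^ 'd)))" by simp
  also have "\<dots> \<le> green (0 :: int ^ 'd)" unfolding green_def suminf_eq_SUP by (rule SUP_upper) simp
  finally show ?thesis .
qed

text \<open>A path that avoids A but not the union meets some y in B at some time; the expected
  number of visits to y bounds that probability.\<close>

lemma escape_prob_Un:
  assumes "finite B"
  shows "ennreal (escape_prob A x) \<le> ennreal (escape_prob (A \<union> B) x) + (\<Sum>y\<in>B. green (y - x))"
proof -
  interpret W: prob_space "walk_law x" by (rule prob_space_walk_law)
  have vis: "{s. s n = y} \<in> sets (walk_law x)" for n y
    using visit_measurable[of n "{y}"] by simp
  have "emeasure (walk_law x) {s. \<forall>n>0. s n \<notin> A}
      \<le> emeasure (walk_law x) ({s. \<forall>n>0. s n \<notin> A \<union> B} \<union> (\<Union>y\<in>B. \<Union>n. {s. s n = y}))"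
  proof (rule emeasure_mono)
    show "{s. \<forall>n>0. s n \<notin> A} \<subseteq> {s. \<forall>n>0. s n \<notin> A \<union> B} \<union> (\<Union>y\<in>B. \<Union>n. {s. s n = y})" by blast
    show "{s. \<forall>n>0. s n \<notin> A \<union> B} \<union> (\<Union>y\<in>B. \<Union>n. {s. s n = y}) \<in> sets (walk_law x)"
      using vis assms avoid_measurable[of "A \<union> B"]
      by (intro sets.Un sets.finite_UN sets.countable_UN) auto
  qed
  also have "\<dots> \<le> emeasure (walk_law x) {s. \<forall>n>0. s n \<notin> A \<union> B} + emeasure (walk_law x) (\<Union>y\<in>B. \<Union>n. {s. s n = y})"
    by (rule emeasure_subadditive) (use vis assms avoid_measurable[of "A \<union> B"] in \<open>simp_all add: sets.finite_UN sets.countable_UN image_subset_iff\<close>)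
  also have "emeasure (walk_law x) (\<Union>y\<in>B. \<Union>n. {s. s n = y}) \<le> (\<Sum>y\<in>B. emeasure (walk_law x) (\<Union>n. {s. s n = y}))"
    by (rule emeasure_subadditive_finite[OF assms]) (use vis in \<open>auto intro!: sets.countable_UN\<close>)
  also have "\<dots> \<le> (\<Sum>y\<in>B. green (y - x))"
  proof (rule sum_mono)
    fix y
    have "emeasure (walk_law x) (\<Union>n. {s. s n = y}) \<le> (\<Sum>n. emeasure (walk_law x) {s. s n = y})"
      by (rule emeasure_subadditive_countably) (use vis in auto)
    then show "emeasure (walk_law x) (\<Union>n. {s. s n = y}) \<le> green (y - x)"
      by (simp add: green_def W.emeasure_eq_measure walk_prob_walk_law)
  qed
  finally show ?thesis
    by (simp add: escape_prob_def W.emeasure_eq_measure)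
qed

text \<open>Passing to the union costs green (y - x) for the points x of A and green (x - y) for the
  points y of B. The second copy of green (y - x) pays for the intersection, which is counted twice:
  an escape probability is at most 1 \<le> green 0, a diagonal term.\<close>

lemma capacity_Un_ge:
  assumes A: "finite A" and B: "finite B"
  shows "ennreal (enn2real (capacity A) + enn2real (capacity B)) \<le> ennreal (enn2real (capacity (A \<union> B)))
    + (\<Sum>x\<in>A. \<Sum>y\<in>B. 2 * green (y - x) + green (x - y))"
proof -
  have "ennreal (enn2real (capacity A) + enn2real (capacity B))
      = (\<Sum>x\<in>A. ennreal (escape_prob A x)) + (\<Sum>x\<in>B. ennreal (escape_prob B x))"
    using A B by (simp add: capacity_eq_sum_escape_prob sum_ennreal escape_prob_nonneg sum_nonneg)
  also have "\<dots> \<le> (\<Sum>x\<in>A. ennreal (escape_prob (A \<union> B) x) + (\<Sum>y\<in>B. green (y - x)))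
      + (\<Sum>x\<in>B. ennreal (escape_prob (B \<union> A) x) + (\<Sum>y\<in>A. green (y - x)))"
    by (intro add_mono sum_mono escape_prob_Un A B)
  also have "\<dots> = (\<Sum>x\<in>A. ennreal (escape_prob (A \<union> B) x)) + (\<Sum>x\<in>B. ennreal (escape_prob (A \<union> B) x))
      + (\<Sum>x\<in>A. \<Sum>y\<in>B. green (y - x) + green (x - y))"
    using sum.swap[of "\<lambda>x y. green (y - x)" A B]
    by (simp add: sum.distrib Un_commute[of B A] add_ac)
  also have "(\<Sum>x\<in>A. ennreal (escape_prob (A \<union> B) x)) + (\<Sum>x\<in>B. ennreal (escape_prob (A \<union> B) x))
      = (\<Sum>x\<in>A \<union> B. ennreal (escape_prob (A \<union> B) x)) + (\<Sum>x\<in>A \<inter> B. ennreal (escape_prob (A \<union> B) x))"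
    by (rule sum.union_inter[OF A B, symmetric])
  also have "(\<Sum>x\<in>A \<inter> B. ennreal (escape_prob (A \<union> B) x)) \<le> (\<Sum>x\<in>A. \<Sum>y\<in>B. green (y - x))"
  proof -
    have "(\<Sum>x\<in>A \<inter> B. ennreal (escape_prob (A \<union> B) x)) \<le> (\<Sum>x\<in>A \<inter> B. \<Sum>y\<in>B. green (y - x))"
    proof (rule sum_mono)
      fix x assume x: "x \<in> A \<inter> B"
      have "ennreal (escape_prob (A \<union> B) x) \<le> 1"
        using escape_prob_le_1[of "A \<union> B" x] by (simp add: ennreal_le_1)
      also have "\<dots> \<le> green (x - x)" by (simp add: green_0_ge_1)
      also have "\<dots> \<le> (\<Sum>y\<in>B. green (y - x))" using x B by (intro member_le_sum) auto
      finally show "ennreal (escape_prob (A \<union> B) x) \<le> (\<Sum>y\<in>B. green (y - x))" .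
    qed
    also have "\<dots> \<le> (\<Sum>x\<in>A. \<Sum>y\<in>B. green (y - x))" using A by (intro sum_mono2) auto
    finally show ?thesis .
  qed
  finally have *: "ennreal (enn2real (capacity A) + enn2real (capacity B))
      \<le> (\<Sum>x\<in>A \<union> B. ennreal (escape_prob (A \<union> B) x)) + (\<Sum>x\<in>A. \<Sum>y\<in>B. green (y - x))
        + (\<Sum>x\<in>A. \<Sum>y\<in>B. green (y - x) + green (x - y))"
    by (simp add: add_mono)
  have "(\<Sum>x\<in>A. \<Sum>y\<in>B. 2 * green (y - x) + green (x - y))
      = (\<Sum>x\<in>A. \<Sum>y\<in>B. green (y - x)) + (\<Sum>x\<in>A. \<Sum>y\<in>B. green (y - x) + green (x - y))"
    by (simp add: sum.distrib[symmetric] mult_2 add.assoc)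
  moreover have "ennreal (enn2real (capacity (A \<union> B))) = (\<Sum>x\<in>A \<union> B. ennreal (escape_prob (A \<union> B) x))"
    using A B by (simp add: capacity_eq_sum_escape_prob sum_ennreal escape_prob_nonneg)
  ultimately show ?thesis using * by (simp add: add.assoc)
qed

section \<open>Green's function along the walk\<close>

lemma indep_vars_PiM_coordinates:
  fixes \<Omega> :: "'i \<Rightarrow> 'b measure"
  assumes \<Omega>: "\<And>i. prob_space (\<Omega> i)"
  shows "prob_space.indep_vars (PiM UNIV \<Omega>) \<Omega> (\<lambda>i x. x i) UNIV"
proof -
  interpret P: prob_space "PiM UNIV \<Omega>" by (rule prob_space_PiM[OF \<Omega>])
  have d: "distr (PiM UNIV \<Omega>) (\<Omega> i) (\<lambda>x. x i) = \<Omega> i" for i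
    by (rule distr_PiM_component) (auto intro: \<Omega>)
  show ?thesis
    by (subst P.indep_vars_iff_distr_eq_PiM) (auto simp: d restrict_UNIV)
qed

lemma indep_vars_steps_pow:
  "prob_space.indep_vars steps_pow (\<lambda>_. count_space (UNIV :: (int ^ 'd) set)) (\<lambda>i \<xi>. \<xi> i) UNIV"
proof -
  interpret P: prob_space "steps_pow :: (nat \<Rightarrow> int ^ 'd) measure" by (rule prob_space_steps_pow)
  show ?thesis
    by (rule P.indep_vars_compose2[OF indep_vars_PiM_coordinates[OF measure_pmf.prob_space_axioms]]) simp
qed

lemma distr_steps_pow:
  "distr steps_pow (count_space (UNIV :: (int ^ 'd) set)) (\<lambda>\<xi>. \<xi> i) = measure_pmf (pmf_of_set unit_steps)"
proof -
  have "distr steps_pow (count_space (UNIV :: (int ^ 'd) set)) (\<lambda>\<xi>. \<xi> i)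
      = distr steps_pow (measure_pmf (pmf_of_set unit_steps)) (\<lambda>\<xi>. \<xi> i)"
    by (intro distr_cong) auto
  also have "\<dots> = measure_pmf (pmf_of_set unit_steps)"
    by (rule distr_PiM_component) (auto intro: measure_pmf.prob_space_axioms)
  finally show ?thesis .
qed

lemma walk_prob_Fourier:
  "of_real (walk_prob n (z :: int ^ 'd)) = (\<integral>\<theta>. of_real (step_char \<theta> ^ n) * lattice_char \<theta> (- z) \<partial>torus_pow)"
proof -
  interpret P: prob_space "steps_pow :: (nat \<Rightarrow> int ^ 'd) measure" by (rule prob_space_steps_pow)
  have X: "(\<lambda>\<xi>. \<Sum>k<n. \<xi> k) \<in> steps_pow \<rightarrow>\<^sub>M count_space (UNIV :: (int ^ 'd) set)"
    using measurable_compose[OF walk_law_measurable[of 0] measurable_component_singleton[of n]] by simp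
  have "P.expectation (\<lambda>\<xi>. lattice_char \<theta> (\<Sum>k<n. \<xi> k)) = of_real (step_char \<theta> ^ n)" for \<theta> :: "'d \<Rightarrow> real"
    using P.expectation_lattice_char_sum[OF P.indep_vars_subset[OF indep_vars_steps_pow subset_UNIV] _ distr_steps_pow,
        of "{..<n}" \<theta>] by simp
  from P.prob_eq_Fourier[OF X this, of z]
  have "of_real (P.prob {\<xi>\<in>space steps_pow. (\<Sum>k<n. \<xi> k) = z}) = (\<integral>\<theta>. of_real (step_char \<theta> ^ n) * lattice_char \<theta> (- z) \<partial>torus_pow)" .
  moreover have "walk_prob n z = P.prob {\<xi>\<in>space steps_pow. (\<Sum>k<n. \<xi> k) = z}"
    unfolding walk_prob_def walk_law_def using visit_measurable[of n "{z}"]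
    by (subst measure_distr[OF walk_law_measurable]) (auto intro!: arg_cong[of _ _ P.prob])
  ultimately show ?thesis by simp
qed

text \<open>Telescoping; the comparison of 1/x^3 with a difference of inverse squares reduces to 1
  \<le> 3 x^2.\<close>

lemma suminf_inverse_cube_le:
  assumes "0 \<le> C"
  shows "(\<Sum>k. ennreal (C / real (m + k + 1) ^ 3)) \<le> ennreal (2 * C / real (m + 1) ^ 2)"
proof (rule suminf_le_const)
  fix n
  have step: "1 / x ^ 3 \<le> 2 * (1 / x\<^sup>2 - 1 / (x + 1)\<^sup>2)" if "1 \<le> x" for x :: real
  proof -
    have "x\<^sup>2 * 1 \<le> x\<^sup>2 * (3 * x\<^sup>2)"
      using one_le_power[OF that, of 2] by (intro mult_left_mono) linarith+
    then show ?thesis using that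
      by (simp add: divide_simps) (simp add: power2_eq_square power3_eq_cube algebra_simps)
  qed
  have "(\<Sum>k<n. C / real (m + k + 1) ^ 3) \<le> 2 * C * (1 / real (m + 1) ^ 2 - 1 / real (m + n + 1) ^ 2)"
  proof (induction n)
    case (Suc n)
    have "C * (1 / real (m + n + 1) ^ 3) \<le> C * (2 * (1 / real (m + n + 1) ^ 2 - 1 / (real (m + n + 1) + 1) ^ 2))"
      by (intro mult_left_mono step assms) simp
    then show ?case using Suc by (simp add: algebra_simps)
  qed simp
  also have "\<dots> \<le> 2 * C * (1 / real (m + 1) ^ 2)"
    using assms by (intro mult_left_mono) auto
  finally have "(\<Sum>k<n. C / real (m + k + 1) ^ 3) \<le> 2 * C / real (m + 1) ^ 2" by simp
  then show "(\<Sum>k<n. ennreal (C / real (m + k + 1) ^ 3)) \<le> ennreal (2 * C / real (m + 1) ^ 2)"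
    using assms by (subst sum_ennreal) (auto intro!: ennreal_leI)
qed simp

lemma sum_inverse_square_le: "(\<Sum>v<n. 1 / real (u + v + 1) ^ 2) \<le> 2 / real (u + 1)"
proof -
  have step: "1 / x\<^sup>2 \<le> 2 * (1 / x - 1 / (x + 1))" if "1 \<le> x" for x :: real
    using that by (simp add: divide_simps power2_eq_square)
  have "(\<Sum>v<n. 1 / real (u + v + 1) ^ 2) \<le> 2 * (1 / real (u + 1) - 1 / real (u + n + 1))"
  proof (induction n)
    case (Suc n)
    show ?case using Suc step[of "real (u + n + 1)"] by (simp add: add_ac)
  qed simp
  also have "\<dots> \<le> 2 * (1 / real (u + 1))" by (intro mult_left_mono) auto
  finally show ?thesis by simp
qed

lemma sum_inverse_le_ln: "(\<Sum>u<Suc n. 1 / real (u + 1)) \<le> 1 + ln (real n + 1)"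
proof (induction n)
  case (Suc n)
  have "ln ((real n + 1) / (real n + 2)) \<le> (real n + 1) / (real n + 2) - 1"
    by (rule ln_le_minus_one) simp
  then have "1 / (real n + 2) \<le> ln (real n + 2) - ln (real n + 1)"
    by (simp add: ln_div field_simps)
  then show ?case using Suc by (simp add: add_ac)
qed simp

text \<open>For a displacement over m steps, the k-th term of the Green sum obeys the Fourier bound
  at time m + k; summation over k turns order (m + k)^-3 into order m^-2.\<close>

lemma (in prob_space) expectation_green_le:
  fixes X :: "'a \<Rightarrow> int ^ 'd"
  assumes X: "X \<in> measurable M (count_space UNIV)"
    and ch: "\<And>\<theta>. expectation (\<lambda>\<omega>. lattice_char \<theta> (X \<omega>)) = of_real (step_char \<theta> ^ m)"
    and C: "0 \<le> C" "\<And>n. (\<integral>\<theta>. \<bar>step_char (\<theta> :: 'd \<Rightarrow> real)\<bar> ^ n \<partial>torus_pow) \<le> C / real (n + 1) ^ 3"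
  shows "(\<integral>\<^sup>+\<omega>. green (X \<omega>) \<partial>M) \<le> ennreal (2 * C / real (m + 1) ^ 2)"
proof -
  have mw: "(\<lambda>\<omega>. walk_prob k (X \<omega>)) \<in> borel_measurable M" for k
    by (rule measurable_compose[OF X]) simp
  have le1: "walk_prob k z \<le> 1" for k and z :: "int ^ 'd"
    unfolding walk_prob_def by (rule prob_space.prob_le_1[OF prob_space_walk_law])
  have "(\<integral>\<^sup>+\<omega>. green (X \<omega>) \<partial>M) = (\<Sum>k. \<integral>\<^sup>+\<omega>. ennreal (walk_prob k (X \<omega>)) \<partial>M)"
    unfolding green_def using mw by (intro nn_integral_suminf) auto
  also have "\<dots> \<le> (\<Sum>k. ennreal (C / real (m + k + 1) ^ 3))"
  proof (rule suminf_le)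
    fix k
    have int: "integrable M (\<lambda>\<omega>. walk_prob k (X \<omega>))"
      by (rule integrable_const_bound[where B = 1, OF AE_I2 mw]) (simp add: le1 walk_prob_nonneg)
    have "(\<integral>\<^sup>+\<omega>. ennreal (walk_prob k (X \<omega>)) \<partial>M) = ennreal (expectation (\<lambda>\<omega>. walk_prob k (X \<omega>)))"
      by (rule nn_integral_eq_integral[OF int]) (simp add: walk_prob_nonneg)
    also have "\<dots> \<le> ennreal (C / real (m + k + 1) ^ 3)"
      using expectation_Fourier_coeff_le[OF X ch walk_prob_Fourier, of k] C(2)[of "m + k"]
      by (intro ennreal_leI) linarith
    finally show "(\<integral>\<^sup>+\<omega>. ennreal (walk_prob k (X \<omega>)) \<partial>M) \<le> ennreal (C / real (m + k + 1) ^ 3)" .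
  qed simp_all
  also have "\<dots> \<le> ennreal (2 * C / real (m + 1) ^ 2)" by (rule suminf_inverse_cube_le[OF C(1)])
  finally show ?thesis .
qed

section \<open>Capacities of time segments\<close>

definition segment_capacity :: "(nat \<Rightarrow> 'a \<Rightarrow> int ^ 'd) \<Rightarrow> nat \<Rightarrow> nat \<Rightarrow> 'a \<Rightarrow> real" where
  "segment_capacity S a b \<omega> = enn2real (capacity ((\<lambda>k. S k \<omega>) ` {a..b}))"

lemma range_capacity_eq_segment: "range_capacity S n = segment_capacity S 0 n"
  by (simp add: range_capacity_def segment_capacity_def walk_range_def fun_eq_iff atLeast0AtMost)

lemma segment_capacity_nonneg: "0 \<le> segment_capacity S a b \<omega>"
  by (simp add: segment_capacity_def)

lemma segment_capacity_le:
  assumes "a \<le> b" shows "segment_capacity S a b \<omega> \<le> real (b - a) + 1"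
proof -
  have "segment_capacity S a b \<omega> \<le> real (card ((\<lambda>k. S k \<omega>) ` {a..b}))"
    unfolding segment_capacity_def by (rule capacity_le_card) simp
  also have "\<dots> \<le> real (card {a..b})" by (intro of_nat_mono card_image_le) simp
  finally show ?thesis using assms by (simp add: Suc_diff_le)
qed

text \<open>Adjacent segments share their end time, so that lengths in time add exactly and a
  segment of length L depends on L increments.\<close>

lemma segment_capacity_Un:
  fixes S :: "nat \<Rightarrow> 'a \<Rightarrow> int ^ 'd"
  assumes "a \<le> b" "b \<le> e"
  shows "(\<lambda>k. S k \<omega>) ` {a..e} = (\<lambda>k. S k \<omega>) ` {a..b} \<union> (\<lambda>k. S k \<omega>) ` {b..e}"
  using ivl_disj_un_two_touch(4)[OF assms] by (metis image_Un)

lemma segment_capacity_subadditive: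
  assumes "a \<le> b" "b \<le> e"
  shows "segment_capacity S a e \<omega> \<le> segment_capacity S a b \<omega> + segment_capacity S b e \<omega>"
  unfolding segment_capacity_def segment_capacity_Un[OF assms] by (rule capacity_Un_le) auto

text \<open>Several times may visit the same point, and counting each of them only increases the
  sum. This passes from points of the range to times.\<close>

lemma sum_image_le_ennreal:
  fixes f :: "'b \<Rightarrow> ennreal"
  assumes "finite A"
  shows "(\<Sum>y\<in>g ` A. f y) \<le> (\<Sum>x\<in>A. f (g x))"
  using assms
proof (induction A rule: finite_induct)
  case (insert x A)
  have "(\<Sum>y\<in>insert (g x) (g ` A). f y) \<le> f (g x) + (\<Sum>y\<in>g ` A. f y)"
    using insert(1) by (cases "g x \<in> g ` A") (auto simp: insert_absorb add_increasing)
  also have "\<dots> \<le> f (g x) + (\<Sum>x\<in>A. f (g x))" using insert by (intro add_left_mono)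
  finally show ?case using insert by simp
qed simp

lemma segment_capacity_defect:
  assumes "a \<le> b" "b \<le> e"
  shows "ennreal (segment_capacity S a b \<omega> + segment_capacity S b e \<omega> - segment_capacity S a e \<omega>)
    \<le> (\<Sum>i\<in>{a..b}. \<Sum>j\<in>{b..e}. 2 * green (S j \<omega> - S i \<omega>) + green (S i \<omega> - S j \<omega>))"
proof -
  let ?A = "(\<lambda>k. S k \<omega>) ` {a..b}" and ?B = "(\<lambda>k. S k \<omega>) ` {b..e}"
  have "ennreal (segment_capacity S a b \<omega> + segment_capacity S b e \<omega>)
      \<le> ennreal (segment_capacity S a e \<omega>) + (\<Sum>x\<in>?A. \<Sum>y\<in>?B. 2 * green (y - x) + green (x - y))"
    unfolding segment_capacity_def segment_capacity_Un[OF assms] by (rule capacity_Un_ge) auto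
  also have "(\<Sum>x\<in>?A. \<Sum>y\<in>?B. 2 * green (y - x) + green (x - y))
      \<le> (\<Sum>i\<in>{a..b}. \<Sum>y\<in>?B. 2 * green (y - S i \<omega>) + green (S i \<omega> - y))"
    by (rule sum_image_le_ennreal) simp
  also have "\<dots> \<le> (\<Sum>i\<in>{a..b}. \<Sum>j\<in>{b..e}. 2 * green (S j \<omega> - S i \<omega>) + green (S i \<omega> - S j \<omega>))"
    by (intro sum_mono sum_image_le_ennreal) simp
  finally have "ennreal (segment_capacity S a b \<omega> + segment_capacity S b e \<omega>) \<le> ennreal (segment_capacity S a e \<omega>) +
     (\<Sum>i\<in>{a..b}. \<Sum>j\<in>{b..e}. 2 * green (S j \<omega> - S i \<omega>) + green (S i \<omega> - S j \<omega>))" by (simp add: add_left_mono)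
  then show ?thesis
    by (subst ennreal_minus[symmetric]) (auto simp: segment_capacity_nonneg ennreal_minus_le_iff)
qed

section \<open>Subadditive functionals of independent blocks\<close>

text \<open>Besides the central limit theorem, all that the limit argument uses about the walk.
  Independence and stationarity hold exactly because capacity is translation invariant, which makes
  a segment a function of its own increments.\<close>

locale subadditive_blocks = prob_space M for M :: "'a measure" +
  fixes c :: "nat \<Rightarrow> nat \<Rightarrow> 'a \<Rightarrow> real" and K :: real
  assumes c_measurable [measurable]: "c a b \<in> borel_measurable M"
    and c_nonneg: "0 \<le> c a b \<omega>"
    and c_le: "a \<le> b \<Longrightarrow> c a b \<omega> \<le> real (b - a) + 1"
    and c_subadditive: "a \<le> b \<Longrightarrow> b \<le> e \<Longrightarrow> c a e \<omega> \<le> c a b \<omega> + c b e \<omega>"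
    and c_defect: "a \<le> b \<Longrightarrow> b \<le> e \<Longrightarrow>
      expectation (\<lambda>\<omega>. c a b \<omega> + c b e \<omega> - c a e \<omega>) \<le> K * (1 + ln (real (e - a) + 1))"
    and c_indep: "indep_vars (\<lambda>_. borel) (\<lambda>i. c (i * L) (Suc i * L)) UNIV"
    and c_stationary: "distr M borel (c a (a + m)) = distr M borel (c 0 m)"

section \<open>The walk satisfies the block assumptions\<close>

definition increment_capacity :: "nat \<Rightarrow> (nat \<Rightarrow> int ^ 'd) \<Rightarrow> real" where
  "increment_capacity m \<xi> = enn2real (capacity ((\<lambda>k. \<Sum>i<k. \<xi> i) ` {..m}))"

lemma increment_capacity_cong:
  assumes "\<And>i. i < m \<Longrightarrow> \<xi> i = \<eta> i"
  shows "increment_capacity m \<xi> = increment_capacity m \<eta>"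
proof -
  have "(\<lambda>k. \<Sum>i<k. \<xi> i) ` {..m} = (\<lambda>k. \<Sum>i<k. \<eta> i) ` {..m}"
    using assms by (intro image_cong sum.cong) auto
  then show ?thesis by (simp add: increment_capacity_def)
qed

lemma segment_capacity_eq_increment_capacity:
  "segment_capacity S a (a + m) \<omega> = increment_capacity m (\<lambda>i. S (Suc (a + i)) \<omega> - S (a + i) \<omega>)"
proof -
  have *: "S (a + k) \<omega> = S a \<omega> + (\<Sum>i<k. S (Suc (a + i)) \<omega> - S (a + i) \<omega>)" for k
    by (induction k) (simp_all add: add.assoc)
  have "{a..a + m} = (+) a ` {..m}"
    unfolding atMost_atLeast0 image_add_atLeastAtMost by (simp add: add.commute)
  then have "(\<lambda>k. S k \<omega>) ` {a..a + m} = (\<lambda>k. S (a + k) \<omega>) ` {..m}"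
    by (simp add: image_image)
  also have "\<dots> = (\<lambda>k. S a \<omega> + (\<Sum>i<k. S (Suc (a + i)) \<omega> - S (a + i) \<omega>)) ` {..m}"
    by (rule image_cong[OF refl *])
  also have "\<dots> = (+) (S a \<omega>) ` ((\<lambda>k. \<Sum>i<k. S (Suc (a + i)) \<omega> - S (a + i) \<omega>) ` {..m})"
    by (simp add: image_image)
  finally have "(\<lambda>k. S k \<omega>) ` {a..a + m}
      = (+) (S a \<omega>) ` ((\<lambda>k. \<Sum>i<k. S (Suc (a + i)) \<omega> - S (a + i) \<omega>) ` {..m})" .
  then show ?thesis
    by (simp add: segment_capacity_def increment_capacity_def capacity_translate)
qed

text \<open>A finite product of countable discrete spaces is discrete, so every function of finitely
  many increments is measurable, the capacity included.\<close>

lemma count_space_PiM_lessThan: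
  "PiM {..<m::nat} (\<lambda>_. count_space (UNIV :: (int ^ 'd) set)) = count_space (PiE {..<m} (\<lambda>_. UNIV))"
  by (rule count_space_PiM_finite) auto

lemma subadditive_blocks_segment_capacity:
  fixes S :: "nat \<Rightarrow> 'a \<Rightarrow> int ^ 'd"
  assumes dim: "6 \<le> CARD('d)" and walk: "simple_random_walk M S x0"
  shows "\<exists>K. subadditive_blocks M (segment_capacity S) K"
proof -
  interpret prob_space M using walk by (simp add: simple_random_walk_def)
  let ?N = "\<lambda>_::nat. count_space (UNIV :: (int ^ 'd) set)"
  define \<xi> where "\<xi> i \<omega> = S (Suc i) \<omega> - S i \<omega>" for i \<omega>
  have S: "S n \<in> M \<rightarrow>\<^sub>M count_space UNIV" for n
    using walk by (simp add: simple_random_walk_def)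
  have indep: "indep_vars ?N \<xi> UNIV"
    and law: "distr M (count_space UNIV) (\<xi> i) = measure_pmf (pmf_of_set unit_steps)" for i
    using walk by (simp_all add: simple_random_walk_def \<xi>_def[abs_def])
  have \<xi>: "\<xi> i \<in> M \<rightarrow>\<^sub>M count_space UNIV" for i
    using indep by (auto simp: indep_vars_def)

  have char_diff: "expectation (\<lambda>\<omega>. lattice_char \<theta> (S j \<omega> - S i \<omega>)) = of_real (step_char \<theta> ^ (j - i))"
    if "i \<le> j" for i j \<theta>
  proof -
    have "S j \<omega> - S i \<omega> = (\<Sum>k\<in>{i..<j}. \<xi> k \<omega>)" for \<omega>
      unfolding \<xi>_def using sum_Suc_diff'[OF that, of "\<lambda>k. S k \<omega>"] by simp
    then show ?thesis
      using expectation_lattice_char_sum[OF indep_vars_subset[OF indep subset_UNIV] _ law, of "{i..<j}" \<theta>]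
      by simp
  qed
  have diff_meas: "(\<lambda>\<omega>. S j \<omega> - S i \<omega>) \<in> M \<rightarrow>\<^sub>M count_space UNIV" for i j
    by (rule measurable_compose_countable[OF _ S[of i], of "\<lambda>z \<omega>. S j \<omega> - z"])
       (rule measurable_compose[OF S], simp)
  obtain C where C: "0 \<le> C" "\<And>n. (\<integral>\<theta>. \<bar>step_char (\<theta> :: 'd \<Rightarrow> real)\<bar> ^ n \<partial>torus_pow) \<le> C / real (n + 1) ^ 3"
    using integral_abs_step_char_power_le[OF dim] by blast
  have green_le: "(\<integral>\<^sup>+\<omega>. green (S j \<omega> - S i \<omega>) \<partial>M) \<le> ennreal (2 * C / real (j - i + 1) ^ 2)"
    "(\<integral>\<^sup>+\<omega>. green (S i \<omega> - S j \<omega>) \<partial>M) \<le> ennreal (2 * C / real (j - i + 1) ^ 2)" if "i \<le> j" for i j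
  proof -
    show "(\<integral>\<^sup>+\<omega>. green (S j \<omega> - S i \<omega>) \<partial>M) \<le> ennreal (2 * C / real (j - i + 1) ^ 2)"
      by (rule expectation_green_le[OF diff_meas char_diff[OF that] C])
    \<comment> \<open>Reflection changes the sign of the angles, which leaves the even function
      \<open>step_char\<close> unchanged.\<close>
    have "expectation (\<lambda>\<omega>. lattice_char \<theta> (S i \<omega> - S j \<omega>)) = of_real (step_char \<theta> ^ (j - i))" for \<theta>
      using char_diff[OF that, of "\<lambda>i. - \<theta> i"] by (simp add: lattice_char_minus[symmetric] step_char_uminus)
    then show "(\<integral>\<^sup>+\<omega>. green (S i \<omega> - S j \<omega>) \<partial>M) \<le> ennreal (2 * C / real (j - i + 1) ^ 2)"
      by (rule expectation_green_le[OF diff_meas _ C])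
  qed

  have seg_eq: "segment_capacity S a (a + m) \<omega> = increment_capacity m (\<lambda>i\<in>{..<m}. \<xi> (a + i) \<omega>)" for a m \<omega>
    unfolding segment_capacity_eq_increment_capacity
    by (rule increment_capacity_cong) (simp add: \<xi>_def)
  have incr_meas: "increment_capacity m \<in> borel_measurable (PiM {..<m} ?N)" for m
    unfolding count_space_PiM_lessThan by simp
  have vec_meas: "(\<lambda>\<omega>. \<lambda>i\<in>{..<m}. \<xi> (a + i) \<omega>) \<in> M \<rightarrow>\<^sub>M PiM {..<m} ?N" for a m
    by (rule measurable_restrict) (rule \<xi>)
  have seg_meas: "segment_capacity S a b \<in> borel_measurable M" for a b
  proof (cases "a \<le> b")
    case True
    then obtain m where "b = a + m" by (auto simp: le_iff_add)
    then show ?thesis using measurable_compose[OF vec_meas incr_meas, of m a] seg_eq[of a m]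
      by (simp cong: measurable_cong)
  next
    case False
    then have "segment_capacity S a b = (\<lambda>_. enn2real (capacity ({} :: (int ^ 'd) set)))"
      by (simp add: segment_capacity_def fun_eq_iff)
    then show ?thesis by simp
  qed

  have indep_shift: "indep_vars ?N (\<lambda>i. \<xi> (a + i)) UNIV" for a
  proof -
    have "indep_vars ?N (\<lambda>i \<omega>. (\<lambda>v. v (a + i)) (\<lambda>k\<in>{a + i}. \<xi> k \<omega>)) UNIV"
    proof (rule indep_vars_compose2[OF indep_vars_restrict[OF indep]])
      show "disjoint_family_on (\<lambda>i. {a + i}) UNIV" by (simp add: disjoint_family_on_def)
      show "(\<lambda>v. v (a + i)) \<in> PiM {a + i} ?N \<rightarrow>\<^sub>M count_space UNIV" for i
        by (rule measurable_component_singleton) simp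
    qed simp
    then show ?thesis by simp
  qed
  have vec_law: "distr M (PiM {..<m} ?N) (\<lambda>\<omega>. \<lambda>i\<in>{..<m}. \<xi> (a + i) \<omega>)
      = distr M (PiM {..<m} ?N) (\<lambda>\<omega>. \<lambda>i\<in>{..<m}. \<xi> (0 + i) \<omega>)" for a m
  \<comment> \<open>The characterisation of independence by a product law is applied to nonempty
    index sets.\<close>
  proof (cases "m = 0")
    case False
    have vl: "distr M (PiM {..<m} ?N) (\<lambda>\<omega>. \<lambda>i\<in>{..<m}. \<xi> (b + i) \<omega>)
      = PiM {..<m} (\<lambda>_. measure_pmf (pmf_of_set unit_steps))" for b
      using indep_vars_iff_distr_eq_PiM'[of "{..<m}" "\<lambda>i. \<xi> (b + i)" ?N] False
        indep_vars_subset[OF indep_shift[of b] subset_UNIV, of "{..<m}"] \<xi>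
      by (simp add: law lessThan_empty_iff)
    show ?thesis by (simp only: vl)
  qed (simp add: restrict_def)

  have stat: "distr M borel (segment_capacity S a (a + m)) = distr M borel (segment_capacity S 0 m)" for a m
  proof -
    have "distr M borel (segment_capacity S b (b + m))
        = distr (distr M (PiM {..<m} ?N) (\<lambda>\<omega>. \<lambda>i\<in>{..<m}. \<xi> (b + i) \<omega>)) borel (increment_capacity m)" for b
      by (simp add: distr_distr[OF incr_meas vec_meas] o_def seg_eq[symmetric])
    from this[of a] this[of 0] vec_law[of m a] show ?thesis by simp
  qed

  have seg_indep: "indep_vars (\<lambda>_. borel) (\<lambda>i. segment_capacity S (i * L) (Suc i * L)) UNIV" for L
  proof -
    \<comment> \<open>The half-open sets of increments are disjoint, although neighbouring segments
      share an end time.\<close>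
    define KK where "KK i = {i * L..<Suc i * L}" for i
    have dis: "disjoint_family_on KK UNIV"
      unfolding disjoint_family_on_def
    proof (intro ballI impI)
      fix i j :: nat assume "i \<noteq> j"
      then have "Suc i \<le> j \<or> Suc j \<le> i" by linarith
      then have "Suc i * L \<le> j * L \<or> Suc j * L \<le> i * L" using mult_le_mono1 by blast
      then show "KK i \<inter> KK j = {}" by (auto simp: KK_def)
    qed
    have "indep_vars (\<lambda>_. borel) (\<lambda>i \<omega>. (\<lambda>v. increment_capacity L (\<lambda>k\<in>{..<L}. v (i * L + k))) (\<lambda>k\<in>KK i. \<xi> k \<omega>)) UNIV"
    proof (rule indep_vars_compose2[OF indep_vars_restrict[OF indep _ dis]])
      fix i
      have "(\<lambda>v. \<lambda>k\<in>{..<L}. v (i * L + k)) \<in> PiM (KK i) ?N \<rightarrow>\<^sub>M PiM {..<L} ?N"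
        by (rule measurable_restrict) (auto simp: KK_def intro!: measurable_component_singleton)
      from measurable_compose[OF this incr_meas]
      show "(\<lambda>v. increment_capacity L (\<lambda>k\<in>{..<L}. v (i * L + k))) \<in> borel_measurable (PiM (KK i) ?N)" .
    qed simp
    moreover have "increment_capacity L (\<lambda>k\<in>{..<L}. (\<lambda>k\<in>KK i. \<xi> k \<omega>) (i * L + k)) = segment_capacity S (i * L) (Suc i * L) \<omega>" for i \<omega>
    proof -
      have "increment_capacity L (\<lambda>k\<in>{..<L}. (\<lambda>k\<in>KK i. \<xi> k \<omega>) (i * L + k)) = increment_capacity L (\<lambda>k\<in>{..<L}. \<xi> (i * L + k) \<omega>)"
        by (rule increment_capacity_cong) (simp add: KK_def)
      then show ?thesis using seg_eq[of "i * L" L \<omega>] by (simp add: add.commute)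
    qed
    ultimately show ?thesis by simp
  qed

  \<comment> \<open>Three Green terms of size 2 C give 6 C; the inner sum contributes a factor 2 and
    the harmonic outer sum the logarithm, whence 12 C.\<close>
  have defect: "expectation (\<lambda>\<omega>. segment_capacity S a b \<omega> + segment_capacity S b e \<omega> - segment_capacity S a e \<omega>)
      \<le> (12 * C) * (1 + ln (real (e - a) + 1))" if ab: "a \<le> b" and be: "b \<le> e" for a b e
  proof -
    let ?D = "\<lambda>\<omega>. segment_capacity S a b \<omega> + segment_capacity S b e \<omega> - segment_capacity S a e \<omega>"
    have D0: "0 \<le> ?D \<omega>" for \<omega> using segment_capacity_subadditive[OF ab be, of S \<omega>] by simp
    have gm: "(\<lambda>\<omega>. green (S j \<omega> - S i \<omega>)) \<in> borel_measurable M" for i j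
      by (rule measurable_compose[OF diff_meas]) simp
    have "(\<integral>\<^sup>+\<omega>. ennreal (?D \<omega>) \<partial>M)
        \<le> (\<integral>\<^sup>+\<omega>. (\<Sum>i\<in>{a..b}. \<Sum>j\<in>{b..e}. 2 * green (S j \<omega> - S i \<omega>) + green (S i \<omega> - S j \<omega>)) \<partial>M)"
      by (intro nn_integral_mono segment_capacity_defect ab be)
    also have "\<dots> = (\<Sum>i\<in>{a..b}. \<Sum>j\<in>{b..e}. 2 * (\<integral>\<^sup>+\<omega>. green (S j \<omega> - S i \<omega>) \<partial>M) + (\<integral>\<^sup>+\<omega>. green (S i \<omega> - S j \<omega>) \<partial>M))"
      using gm by (simp add: nn_integral_sum nn_integral_add nn_integral_cmult)
    also have "\<dots> \<le> (\<Sum>i\<in>{a..b}. \<Sum>j\<in>{b..e}. ennreal (6 * C * (1 / real (j - i + 1) ^ 2)))"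
    proof (intro sum_mono)
      fix i j assume "i \<in> {a..b}" "j \<in> {b..e}"
      then have ij: "i \<le> j" by simp
      have "2 * (\<integral>\<^sup>+\<omega>. green (S j \<omega> - S i \<omega>) \<partial>M) + (\<integral>\<^sup>+\<omega>. green (S i \<omega> - S j \<omega>) \<partial>M)
          \<le> 2 * ennreal (2 * C / real (j - i + 1) ^ 2) + ennreal (2 * C / real (j - i + 1) ^ 2)"
        by (intro add_mono mult_left_mono green_le[OF ij]) simp
      also have "\<dots> = ennreal (3 * (2 * C / real (j - i + 1) ^ 2))"
      proof -
        have "2 * ennreal x + ennreal x = ennreal (3 * x)" if "0 \<le> x" for x
        proof -
          have "ennreal (3 * x) = ennreal (x + x + x)" by (rule arg_cong[of _ _ ennreal]) simp
          then show ?thesis using that by (simp only: ennreal_plus add_nonneg_nonneg mult_2)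
        qed
        then show ?thesis using C(1) by simp
      qed
      finally show "2 * (\<integral>\<^sup>+\<omega>. green (S j \<omega> - S i \<omega>) \<partial>M) + (\<integral>\<^sup>+\<omega>. green (S i \<omega> - S j \<omega>) \<partial>M)
          \<le> ennreal (6 * C * (1 / real (j - i + 1) ^ 2))"
        by (simp add: field_simps)
    qed
    also have "\<dots> = ennreal (6 * C * (\<Sum>i\<in>{a..b}. \<Sum>j\<in>{b..e}. 1 / real (j - i + 1) ^ 2))"
      using C(1) by (simp add: sum_ennreal sum_nonneg sum_distrib_left)
    finally have nn: "(\<integral>\<^sup>+\<omega>. ennreal (?D \<omega>) \<partial>M) \<le> ennreal (6 * C * (\<Sum>i\<in>{a..b}. \<Sum>j\<in>{b..e}. 1 / real (j - i + 1) ^ 2))" .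
    have "(\<Sum>i\<in>{a..b}. \<Sum>j\<in>{b..e}. 1 / real (j - i + 1) ^ 2) \<le> (\<Sum>i\<in>{a..b}. 2 / real (b - i + 1))"
    proof (rule sum_mono)
      fix i assume i: "i \<in> {a..b}"
      have "(\<Sum>j\<in>{b..e}. 1 / real (j - i + 1) ^ 2) = (\<Sum>v<Suc (e - b). 1 / real ((b - i) + v + 1) ^ 2)"
        using i be by (intro sum.reindex_bij_witness[of _ "\<lambda>v. b + v" "\<lambda>j. j - b"]) auto
      also have "\<dots> \<le> 2 / real (b - i + 1)" by (rule sum_inverse_square_le)
      finally show "(\<Sum>j\<in>{b..e}. 1 / real (j - i + 1) ^ 2) \<le> 2 / real (b - i + 1)" .
    qed
    also have "\<dots> = 2 * (\<Sum>u<Suc (b - a). 1 / real (u + 1))"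
      unfolding sum_distrib_left
      using ab by (intro sum.reindex_bij_witness[of _ "\<lambda>u. b - u" "\<lambda>i. b - i"]) auto
    also have "\<dots> \<le> 2 * (1 + ln (real (b - a) + 1))"
      by (intro mult_left_mono sum_inverse_le_ln) simp
    also have "\<dots> \<le> 2 * (1 + ln (real (e - a) + 1))"
      using ab be by (intro mult_left_mono add_left_mono iffD2[OF ln_le_cancel_iff]) auto
    finally have "6 * C * (\<Sum>i\<in>{a..b}. \<Sum>j\<in>{b..e}. 1 / real (j - i + 1) ^ 2) \<le> 6 * C * (2 * (1 + ln (real (e - a) + 1)))"
      using C(1) by (intro mult_left_mono) auto
    then have "(\<integral>\<^sup>+\<omega>. ennreal (?D \<omega>) \<partial>M) \<le> ennreal ((12 * C) * (1 + ln (real (e - a) + 1)))"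
      by (intro order_trans[OF nn ennreal_leI]) (simp add: algebra_simps)
    then show ?thesis
      using D0 C(1) seg_meas by (subst integral_eq_nn_integral) (auto intro!: enn2real_leI)
  qed
  show ?thesis
    by (intro exI[of _ "12 * C"], unfold_locales)
       (use seg_meas segment_capacity_nonneg segment_capacity_le segment_capacity_subadditive defect seg_indep stat in auto)
qed

section \<open>Centred blocks and block sums\<close>

context subadditive_blocks
begin

definition mean :: "nat \<Rightarrow> real" where
  "mean m = expectation (c 0 m)"

definition cbar :: "nat \<Rightarrow> nat \<Rightarrow> 'a \<Rightarrow> real" where
  "cbar a b \<omega> = c a b \<omega> - mean (b - a)"

definition defect :: "nat \<Rightarrow> real" where
  "defect n = K * (1 + ln (real n + 1))"

lemma cbar_measurable [measurable]: "cbar a b \<in> borel_measurable M"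
  unfolding cbar_def[abs_def] by measurable

lemma c_integrable [simp]:
  assumes "a \<le> b" shows "integrable M (c a b)"
  using c_le[OF assms] c_nonneg[of a b]
  by (intro integrable_const_bound[where B = "real (b - a) + 1"] AE_I2) auto

lemma expectation_c:
  assumes "a \<le> b" shows "expectation (c a b) = mean (b - a)"
proof -
  have "expectation (c a b) = (\<integral>x. x \<partial>distr M borel (c a (a + (b - a))))"
    using assms by (subst integral_distr) auto
  also have "\<dots> = mean (b - a)"
    unfolding c_stationary mean_def by (subst integral_distr) auto
  finally show ?thesis .
qed

lemma mean_nonneg: "0 \<le> mean m"
  unfolding mean_def by (simp add: c_nonneg)

text \<open>The defect of degenerate segments is the mean of c 0 0, and the logarithm vanishes
  there.\<close>

lemma K_nonneg: "0 \<le> K"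
  using c_defect[of 0 0 0] mean_nonneg[of 0] by (simp add: mean_def)

lemma defect_nonneg: "0 \<le> defect n"
  unfolding defect_def using K_nonneg by simp

lemma defect_mono: "m \<le> n \<Longrightarrow> defect m \<le> defect n"
  unfolding defect_def using K_nonneg by (intro mult_left_mono) auto

lemma mean_defect:
  assumes "a \<le> b" "b \<le> e"
  shows "mean (b - a) + mean (e - b) - mean (e - a) \<le> defect (e - a)"
  using c_defect[OF assms] assms expectation_c[of a b] expectation_c[of b e] expectation_c[of a e]
  by (simp add: defect_def)

text \<open>Centring spoils subadditivity only by the amount by which the means fail to add up, and
  that is at most \<open>defect\<close>.\<close>

lemma cbar_subadditive:
  assumes "a \<le> b" "b \<le> e"
  shows "cbar a e \<omega> \<le> cbar a b \<omega> + cbar b e \<omega> + defect (e - a)"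
  using c_subadditive[OF assms, of \<omega>] mean_defect[OF assms] by (simp add: cbar_def)

lemma cbar_le: "a \<le> b \<Longrightarrow> cbar a b \<omega> \<le> real (b - a) + 1"
  using c_le[of a b \<omega>] mean_nonneg[of "b - a"] by (simp add: cbar_def)

lemma cbar_stationary:
  "distr M borel (cbar a (a + m)) = distr M borel (cbar 0 m)"
proof -
  have "distr M borel (cbar b (b + m)) = distr (distr M borel (c b (b + m))) borel (\<lambda>x. x - mean m)" for b
    by (subst distr_distr) (auto simp: o_def cbar_def[abs_def])
  from this[of a] this[of 0] show ?thesis by (simp add: c_stationary)
qed

lemma prob_cbar_shift:
  assumes "A \<in> sets borel"
  shows "prob {\<omega>\<in>space M. cbar a (a + m) \<omega> \<in> A} = prob {\<omega>\<in>space M. cbar 0 m \<omega> \<in> A}"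
proof -
  have "prob {\<omega>\<in>space M. cbar b (b + m) \<omega> \<in> A} = measure (distr M borel (cbar b (b + m))) A" for b
    using assms by (subst measure_distr) (auto intro!: arg_cong[of _ _ prob])
  from this[of a] this[of 0] show ?thesis by (simp add: cbar_stationary)
qed

text \<open>By subadditivity, replacing the segment by its blocks costs an amount that is nondecreasing in
  the number of blocks; its maximum is therefore controlled by one expectation.\<close>

definition block_excess :: "nat \<Rightarrow> nat \<Rightarrow> nat \<Rightarrow> 'a \<Rightarrow> real" where
  "block_excess L u v \<omega> = (\<Sum>i\<in>{u..<v}. c (i * L) (Suc i * L) \<omega>) - c (u * L) (v * L) \<omega>"

definition block_sum :: "nat \<Rightarrow> nat \<Rightarrow> nat \<Rightarrow> 'a \<Rightarrow> real" where
  "block_sum L u v \<omega> = (\<Sum>i\<in>{u..<v}. cbar (i * L) (Suc i * L) \<omega>)"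

lemma block_sum_measurable [measurable]: "block_sum L u v \<in> borel_measurable M"
  unfolding block_sum_def[abs_def] by measurable

lemma block_excess_measurable [measurable]: "block_excess L u v \<in> borel_measurable M"
  unfolding block_excess_def[abs_def] by measurable

lemma block_excess_Suc_ge:
  assumes "u \<le> v" shows "block_excess L u v \<omega> \<le> block_excess L u (Suc v) \<omega>"
  using c_subadditive[of "u * L" "v * L" "Suc v * L" \<omega>] assms
  by (simp add: block_excess_def)

lemma block_excess_mono:
  assumes "u \<le> v" "v \<le> w" shows "block_excess L u v \<omega> \<le> block_excess L u w \<omega>"
  using assms(2)
proof (induction w rule: dec_induct)
  case (step w)
  then show ?case using block_excess_Suc_ge[of u w L \<omega>] assms by simp
qed simp

text \<open>Monotonicity starts from the empty sum of blocks, whose excess is minus the value of a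
  degenerate segment, hence at least -1. This explains the recurring + 1, which makes excesses
  nonnegative.\<close>

lemma block_excess_ge:
  assumes "u \<le> v" shows "- 1 \<le> block_excess L u v \<omega>"
proof -
  have "- 1 \<le> block_excess L u u \<omega>" using c_le[of "u * L" "u * L" \<omega>] by (simp add: block_excess_def)
  also have "\<dots> \<le> block_excess L u v \<omega>" by (rule block_excess_mono) (use assms in auto)
  finally show ?thesis .
qed

lemma block_excess_integrable [simp]:
  "u \<le> v \<Longrightarrow> integrable M (block_excess L u v)"
  unfolding block_excess_def[abs_def]
  by (intro Bochner_Integration.integrable_diff Bochner_Integration.integrable_sum c_integrable) auto

lemma expectation_block_excess_eq:
  assumes "u \<le> v"
  shows "expectation (block_excess L u v) = real (v - u) * mean L - mean ((v - u) * L)"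
proof -
  have "expectation (block_excess L u v) = (\<Sum>i\<in>{u..<v}. expectation (c (i * L) (Suc i * L))) - expectation (c (u * L) (v * L))"
    unfolding block_excess_def using assms
    by (subst Bochner_Integration.integral_diff) (auto intro!: Bochner_Integration.integrable_sum simp: Bochner_Integration.integral_sum)
  also have "\<dots> = real (v - u) * mean L - mean ((v - u) * L)"
    using assms by (simp add: expectation_c diff_mult_distrib)
  finally show ?thesis .
qed

text \<open>Blocks are split off one at a time, each at the cost of at most the defect of the total
  length.\<close>

lemma expectation_block_excess_le:
  assumes "u \<le> v"
  shows "expectation (block_excess L u v) \<le> real (v - u) * defect ((v - u) * L)"
proof -
  have "real n * mean L - mean (n * L) \<le> real n * defect (n * L)" for n
  proof (induction n)
    case 0 then show ?case using mean_nonneg[of 0] by simp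
  next
    case (Suc n)
    have "mean (n * L) + mean L - mean (Suc n * L) \<le> defect (Suc n * L)"
      using mean_defect[of 0 "n * L" "Suc n * L"] by simp
    moreover have "real n * defect (n * L) \<le> real n * defect (Suc n * L)"
      by (intro mult_left_mono defect_mono) auto
    ultimately show ?case using Suc by (simp add: algebra_simps)
  qed
  then show ?thesis by (simp add: expectation_block_excess_eq[OF assms])
qed

lemma block_sum_minus_cbar:
  assumes "u \<le> v"
  shows "block_sum L u v \<omega> - cbar (u * L) (v * L) \<omega>
    = block_excess L u v \<omega> - expectation (block_excess L u v)"
  using assms
  by (simp add: expectation_block_excess_eq block_sum_def cbar_def block_excess_def sum_subtractf diff_mult_distrib)

lemma expectation_block_excess_ge:
  assumes "u \<le> v" shows "- 1 \<le> expectation (block_excess L u v)"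
proof -
  have "expectation (\<lambda>_. - 1) \<le> expectation (block_excess L u v)"
    by (rule integral_mono) (use assms block_excess_ge in auto)
  then show ?thesis by (simp add: prob_space)
qed

text \<open>The right side does not depend on v: the random excess and the bound for its expectation
  are both dominated by their values at R. The two 1s absorb the lower bounds -1.\<close>

lemma block_sum_approx:
  assumes "v \<le> R"
  shows "\<bar>block_sum L 0 v \<omega> - cbar 0 (v * L) \<omega>\<bar>
    \<le> (block_excess L 0 R \<omega> + 1) + (real R * defect (R * L) + 1)"
proof -
  have "expectation (block_excess L 0 v) \<le> real v * defect (v * L)"
    using expectation_block_excess_le[of 0 v L] by simp
  also have "\<dots> \<le> real R * defect (R * L)"
    using assms by (intro mult_mono defect_mono) (auto simp: defect_nonneg)
  finally show ?thesis
    using block_sum_minus_cbar[of 0 v L \<omega>] block_excess_mono[of 0 v R L \<omega>] block_excess_ge[of 0 v L \<omega>]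
      expectation_block_excess_ge[of 0 v L] assms by simp
qed

lemma prob_block_excess_gt:
  assumes "u \<le> v" "0 < t"
  shows "prob {\<omega>\<in>space M. t < block_excess L u v \<omega> + 1} \<le> (real (v - u) * defect ((v - u) * L) + 1) / t"
proof -
  have "prob {\<omega>\<in>space M. t < block_excess L u v \<omega> + 1} \<le> prob {\<omega>\<in>space M. t \<le> block_excess L u v \<omega> + 1}"
    by (rule finite_measure_mono) auto
  also have "\<dots> \<le> expectation (\<lambda>\<omega>. block_excess L u v \<omega> + 1) / t"
  proof (rule integral_Markov_inequality_measure[where A = "{}"])
    show "AE \<omega> in M. 0 \<le> block_excess L u v \<omega> + 1"
    proof (rule AE_I2)
      show "0 \<le> block_excess L u v \<omega> + 1" for \<omega>
        using block_excess_ge[OF assms(1), of L \<omega>] by simp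
    qed
  qed (use assms in auto)
  also have "\<dots> \<le> (real (v - u) * defect ((v - u) * L) + 1) / t"
    using assms expectation_block_excess_le[OF assms(1), of L]
    by (intro divide_right_mono) (auto simp: prob_space)
  finally show ?thesis .
qed

text \<open>Brings tails of block sums back to tails of one segment starting at 0, which the central
  limit theorem controls. If the error term exceeds 1 the bound is trivial.\<close>

lemma prob_block_sum_gt:
  assumes "u \<le> v" "0 < t"
  shows "prob {\<omega>\<in>space M. t < \<bar>block_sum L u v \<omega>\<bar>}
    \<le> prob {\<omega>\<in>space M. t / 2 < \<bar>cbar 0 ((v - u) * L) \<omega>\<bar>}
      + 4 * (real (v - u) * defect ((v - u) * L) + 1) / t"
proof -
  define q where "q = real (v - u) * defect ((v - u) * L) + 1"
  have q: "0 < q" unfolding q_def by (intro add_nonneg_pos mult_nonneg_nonneg defect_nonneg) auto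
  show ?thesis
  proof (cases "4 * q / t \<le> 1")
    case True
    \<comment> \<open>Off both exceptional events the block sum and the segment now differ by at
      most t/4, so the block sum is at most 3t/4.\<close>
    then have qt: "q \<le> t / 4" using assms by (simp add: field_simps)
    have "{\<omega>\<in>space M. t < \<bar>block_sum L u v \<omega>\<bar>} \<subseteq>
      {\<omega>\<in>space M. t / 2 < \<bar>cbar (u * L) (u * L + (v - u) * L) \<omega>\<bar>} \<union> {\<omega>\<in>space M. t / 4 < block_excess L u v \<omega> + 1}"
    proof (safe, rule ccontr)
      fix \<omega> assume 1: "t < \<bar>block_sum L u v \<omega>\<bar>" "\<not> t / 4 < block_excess L u v \<omega> + 1"
        "\<not> t / 2 < \<bar>cbar (u * L) (u * L + (v - u) * L) \<omega>\<bar>"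
      have "u * L + (v - u) * L = v * L" using assms by (simp add: diff_mult_distrib)
      with 1 block_sum_minus_cbar[OF assms(1), of L \<omega>] block_excess_ge[OF assms(1), of L \<omega>]
        expectation_block_excess_ge[OF assms(1), of L] expectation_block_excess_le[OF assms(1), of L] qt
      show False unfolding q_def by auto
    qed
    then have "prob {\<omega>\<in>space M. t < \<bar>block_sum L u v \<omega>\<bar>} \<le>
      prob ({\<omega>\<in>space M. t / 2 < \<bar>cbar (u * L) (u * L + (v - u) * L) \<omega>\<bar>} \<union> {\<omega>\<in>space M. t / 4 < block_excess L u v \<omega> + 1})"
      by (intro finite_measure_mono) measurable
    also have "\<dots> \<le> prob {\<omega>\<in>space M. t / 2 < \<bar>cbar (u * L) (u * L + (v - u) * L) \<omega>\<bar>} + prob {\<omega>\<in>space M. t / 4 < block_excess L u v \<omega> + 1}"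
      by (intro measure_Un_le) measurable
    also have "prob {\<omega>\<in>space M. t / 2 < \<bar>cbar (u * L) (u * L + (v - u) * L) \<omega>\<bar>} = prob {\<omega>\<in>space M. t / 2 < \<bar>cbar 0 ((v - u) * L) \<omega>\<bar>}"
      using prob_cbar_shift[of "{x. t / 2 < \<bar>x\<bar>}" "u * L" "(v - u) * L"] by simp
    also have "prob {\<omega>\<in>space M. t / 4 < block_excess L u v \<omega> + 1} \<le> 4 * q / t"
      using prob_block_excess_gt[OF assms(1), of "t / 4" L] assms by (simp add: q_def field_simps)
    finally show ?thesis by (simp add: q_def)
  next
    case False
    then show ?thesis
      using prob_le_1[of "{\<omega>\<in>space M. t < \<bar>block_sum L u v \<omega>\<bar>}"]
        measure_nonneg[of M "{\<omega>\<in>space M. t / 2 < \<bar>cbar 0 ((v - u) * L) \<omega>\<bar>}"] unfolding q_def by linarith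
  qed
qed

lemma cbar_indep: "indep_vars (\<lambda>_. borel) (\<lambda>i. cbar (i * L) (Suc i * L)) UNIV"
proof -
  have "indep_vars (\<lambda>_. borel) (\<lambda>i \<omega>. (\<lambda>x. x - mean L) (c (i * L) (Suc i * L) \<omega>)) UNIV"
    by (rule indep_vars_compose2[OF c_indep]) simp
  then show ?thesis by (simp add: cbar_def[abs_def])
qed

lemma cbar_le_block_sum:
  "cbar 0 (q * l) \<omega> \<le> 1 + block_sum l 0 q \<omega> + real q * defect (q * l)"
proof (induction q)
  case 0 then show ?case using cbar_le[of 0 0 \<omega>] by (simp add: block_sum_def)
next
  case (Suc q)
  have "real q * defect (q * l) \<le> real q * defect (Suc q * l)"
    by (intro mult_left_mono defect_mono) auto
  then show ?case
    using Suc cbar_subadditive[of 0 "q * l" "Suc q * l" \<omega>] by (simp add: block_sum_def algebra_simps)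
qed

text \<open>Only the upper tail is available here: it follows from subadditivity and Hoeffding's
  inequality for the blocks of length \<open>l\<close>.\<close>

lemma prob_cbar_gt:
  assumes m: "m \<le> L" and l: "0 < l" and t: "0 < t"
    and small: "(real L / real l + 1) * defect L + real l + 2 \<le> t"
  shows "prob {\<omega>\<in>space M. 2 * t < cbar a (a + m) \<omega>} \<le> exp (- (t\<^sup>2 / (2 * real L * real l)))"
proof -
  \<comment> \<open>The number of full short blocks in the segment; the remainder has length at most
    l and is bounded trivially by l + 1.\<close>
  define q where "q = m div l"
  have ql: "q * l \<le> m" "m - q * l \<le> l"
    unfolding q_def using l by (auto simp: minus_div_mult_eq_mod less_imp_le)
  have qL: "real q \<le> real L / real l"
  proof -
    have "real (q * l) \<le> real L" using ql m by linarith
    then show ?thesis using l by (simp add: field_simps)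
  qed
  \<comment> \<open>The deterministic errors use up one t; the other t of the threshold is left to
    the fluctuations.\<close>
  have upper: "cbar 0 m \<omega> \<le> block_sum l 0 q \<omega> + t" for \<omega>
  proof -
    have "cbar 0 m \<omega> \<le> cbar 0 (q * l) \<omega> + cbar (q * l) m \<omega> + defect m"
      using cbar_subadditive[of 0 "q * l" m \<omega>] ql by simp
    also have "\<dots> \<le> (1 + block_sum l 0 q \<omega> + real q * defect (q * l)) + (real l + 1) + defect L"
      using cbar_le[of "q * l" m \<omega>] ql m
      by (intro add_mono cbar_le_block_sum defect_mono) linarith+
    also have "real q * defect (q * l) \<le> (real L / real l) * defect L"
      using ql m qL by (intro mult_mono defect_mono) (auto simp: defect_nonneg)
    finally show ?thesis using small by (simp add: algebra_simps)
  qed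
  have "prob {\<omega>\<in>space M. 2 * t < cbar a (a + m) \<omega>} = prob {\<omega>\<in>space M. 2 * t < cbar 0 m \<omega>}"
    using prob_cbar_shift[of "{2 * t<..}" a m] by simp
  also have "\<dots> \<le> prob {\<omega>\<in>space M. (\<Sum>i\<in>{..<q}. c (i * l) (Suc i * l) \<omega>) \<ge> (\<Sum>i\<in>{..<q}. expectation (c (i * l) (Suc i * l))) + t}"
  proof (rule finite_measure_mono)
    have "block_sum l 0 q \<omega> = (\<Sum>i\<in>{..<q}. c (i * l) (Suc i * l) \<omega>) - (\<Sum>i\<in>{..<q}. expectation (c (i * l) (Suc i * l)))" for \<omega>
      by (simp add: block_sum_def cbar_def sum_subtractf expectation_c atLeast0LessThan)
    then show "{\<omega>\<in>space M. 2 * t < cbar 0 m \<omega>} \<subseteq> {\<omega>\<in>space M. (\<Sum>i\<in>{..<q}. c (i * l) (Suc i * l) \<omega>) \<ge> (\<Sum>i\<in>{..<q}. expectation (c (i * l) (Suc i * l))) + t}"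
      using upper by (auto simp: algebra_simps) (smt (verit, best))
  qed measurable
  also have "\<dots> \<le> exp (- (t\<^sup>2 / (2 * real L * real l)))"
  proof (cases "q = 0")
    case True
    then show ?thesis using t by simp
  next
    case False
    \<comment> \<open>Every short block takes values in [0, l + 1]. With l + 1 \<le> 2 l and at most
      L / l blocks the squared ranges sum to at most 4 L l, which yields the exponent t^2 / (2 L
      l).\<close>
    interpret H: Hoeffding_ineq M "{..<q}" "\<lambda>i. c (i * l) (Suc i * l)" "\<lambda>_. 0" "\<lambda>_. real l + 1"
      "\<Sum>i\<in>{..<q}. expectation (c (i * l) (Suc i * l))"
    proof unfold_locales
      show "indep_vars (\<lambda>_. borel) (\<lambda>i. c (i * l) (Suc i * l)) {..<q}"
        by (rule indep_vars_subset[OF c_indep]) simp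
      show "AE \<omega> in M. c (i * l) (Suc i * l) \<omega> \<in> {0..real l + 1}" for i
        using c_le[of "i * l" "Suc i * l"] c_nonneg by (intro AE_I2) simp
    qed simp_all
    have pos: "0 < (\<Sum>i\<in>{..<q}. (real l + 1 - 0)\<^sup>2)" using False by simp
    have "prob {\<omega>\<in>space M. (\<Sum>i\<in>{..<q}. c (i * l) (Suc i * l) \<omega>) \<ge> (\<Sum>i\<in>{..<q}. expectation (c (i * l) (Suc i * l))) + t}
      \<le> exp (-2 * t\<^sup>2 / (\<Sum>i\<in>{..<q}. (real l + 1 - 0)\<^sup>2))"
      by (rule H.Hoeffding_ineq_ge[OF _ pos]) (use t in simp)
    also have "\<dots> \<le> exp (- (t\<^sup>2 / (2 * real L * real l)))"
    proof -
      have "(\<Sum>i\<in>{..<q}. (real l + 1 - 0)\<^sup>2) = real q * (real l + 1)\<^sup>2" by simp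
      also have "\<dots> \<le> (real L / real l) * (2 * real l)\<^sup>2"
        using qL l by (intro mult_mono power_mono) auto
      also have "\<dots> = 4 * real L * real l" using l by (simp add: power2_eq_square)
      finally have "(\<Sum>i\<in>{..<q}. (real l + 1 - 0)\<^sup>2) \<le> 4 * real L * real l" .
      then have "2 * t\<^sup>2 / (4 * real L * real l) \<le> 2 * t\<^sup>2 / (\<Sum>i\<in>{..<q}. (real l + 1 - 0)\<^sup>2)"
        using pos by (intro frac_le) auto
      then show ?thesis by simp
    qed
    finally show ?thesis .
  qed
  finally show ?thesis .
qed

end

text \<open>When a partial sum first exceeds 2 t, the rest of the sum is independent of the past and
  has modulus at most t with probability at least 1 - q; the full sum then still exceeds t. Only
  tails enter, no moments.\<close>

lemma (in prob_space) Ottaviani_inequality: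
  fixes \<zeta> :: "nat \<Rightarrow> 'a \<Rightarrow> real"
  assumes indep: "indep_vars (\<lambda>_. borel) \<zeta> UNIV" and uv: "u \<le> v"
    and q: "\<And>i. i \<in> {u..v} \<Longrightarrow> prob {\<omega>\<in>space M. t < \<bar>\<Sum>b\<in>{i..<v}. \<zeta> b \<omega>\<bar>} \<le> q"
  shows "(1 - q) * prob {\<omega>\<in>space M. \<exists>i\<in>{u..v}. 2 * t < \<bar>\<Sum>b\<in>{u..<i}. \<zeta> b \<omega>\<bar>}
    \<le> prob {\<omega>\<in>space M. t < \<bar>\<Sum>b\<in>{u..<v}. \<zeta> b \<omega>\<bar>}"
proof -
  have [measurable]: "\<zeta> i \<in> borel_measurable M" for i
    using indep by (auto simp: indep_vars_def)
  define T where "T i \<omega> = (\<Sum>b\<in>{u..<i}. \<zeta> b \<omega>)" for i \<omega>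
  \<comment> \<open>First passage at i: these events are disjoint and determined by the summands
    before i.\<close>
  define A where "A i = {\<omega>\<in>space M. 2 * t < \<bar>T i \<omega>\<bar> \<and> (\<forall>j\<in>{u..<i}. \<bar>T j \<omega>\<bar> \<le> 2 * t)}" for i
  define B where "B i = {\<omega>\<in>space M. \<bar>\<Sum>b\<in>{i..<v}. \<zeta> b \<omega>\<bar> \<le> t}" for i
  have A [measurable]: "A i \<in> events" for i unfolding A_def T_def by measurable
  have B [measurable]: "B i \<in> events" for i unfolding B_def by measurable
  have dis: "disjoint_family_on A {u..v}"
    unfolding disjoint_family_on_def
  proof (intro ballI impI)
    fix i j assume ij: "i \<in> {u..v}" "j \<in> {u..v}" "i \<noteq> j"
    have False if "i \<in> {u..v}" "i < j" "\<omega> \<in> A i" "\<omega> \<in> A j" for i j \<omega>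
    proof -
      have "i \<in> {u..<j}" using that by simp
      then have "\<bar>T i \<omega>\<bar> \<le> 2 * t" using that(4) unfolding A_def by blast
      then show False using that(3) by (simp add: A_def)
    qed
    then show "A i \<inter> A j = {}" using ij by (metis disjoint_iff linorder_neqE_nat)
  qed
  have un: "{\<omega>\<in>space M. \<exists>i\<in>{u..v}. 2 * t < \<bar>\<Sum>b\<in>{u..<i}. \<zeta> b \<omega>\<bar>} = (\<Union>i\<in>{u..v}. A i)"
  proof (intro set_eqI iffI)
    fix \<omega> assume "\<omega> \<in> {\<omega>\<in>space M. \<exists>i\<in>{u..v}. 2 * t < \<bar>\<Sum>b\<in>{u..<i}. \<zeta> b \<omega>\<bar>}"
    then have \<omega>: "\<omega> \<in> space M" and ex: "\<exists>i. u \<le> i \<and> i \<le> v \<and> 2 * t < \<bar>T i \<omega>\<bar>" by (auto simp: T_def)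
    define i where "i = (LEAST i. u \<le> i \<and> i \<le> v \<and> 2 * t < \<bar>T i \<omega>\<bar>)"
    have i: "u \<le> i \<and> i \<le> v \<and> 2 * t < \<bar>T i \<omega>\<bar>" unfolding i_def by (rule LeastI_ex[OF ex])
    have "\<bar>T j \<omega>\<bar> \<le> 2 * t" if "j \<in> {u..<i}" for j
      using not_less_Least[of j "\<lambda>i. u \<le> i \<and> i \<le> v \<and> 2 * t < \<bar>T i \<omega>\<bar>"] that i unfolding i_def[symmetric] by auto
    then show "\<omega> \<in> (\<Union>i\<in>{u..v}. A i)" using i \<omega> by (auto simp: A_def)
  qed (auto simp: A_def T_def)
  have AB: "prob (A i \<inter> B i) = prob (A i) * prob (B i)" if i: "i \<in> {u..v}" for i
  proof -
    let ?P = "PiM {u..<i} (\<lambda>_. borel :: real measure)"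
    let ?X = "\<lambda>J \<omega>. \<lambda>b\<in>J. \<zeta> b \<omega>"
    let ?SA = "{f\<in>space ?P. 2 * t < \<bar>\<Sum>b\<in>{u..<i}. f b\<bar> \<and> (\<forall>j\<in>{u..<i}. \<bar>\<Sum>b\<in>{u..<j}. f b\<bar> \<le> 2 * t)}"
    let ?SB = "{f\<in>space (PiM {i..<v} (\<lambda>_. borel)). \<bar>\<Sum>b\<in>{i..<v}. f b\<bar> \<le> t}"
    have ind: "indep_var ?P (?X {u..<i}) (PiM {i..<v} (\<lambda>_. borel)) (?X {i..<v})"
      by (rule indep_var_restrict[OF indep]) auto
    have comp: "(\<lambda>f. \<Sum>b\<in>{u..<j}. f b) \<in> borel_measurable ?P" if "j \<le> i" for j
      using that by (intro borel_measurable_sum measurable_component_singleton) auto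
    have SA: "?SA \<in> sets ?P"
    proof -
      have [measurable]: "(\<lambda>f. \<Sum>b\<in>{u..<i}. f b) \<in> borel_measurable ?P"
        by (rule comp) simp
      have "{f\<in>space ?P. \<forall>j\<in>{u..<i}. \<bar>\<Sum>b\<in>{u..<j}. f b\<bar> \<le> 2 * t} \<in> sets ?P"
      proof (rule sets.sets_Collect_finite_All)
        fix j assume "j \<in> {u..<i}"
        then have [measurable]: "(\<lambda>f. \<Sum>b\<in>{u..<j}. f b) \<in> borel_measurable ?P"
          by (intro comp) simp
        show "{f\<in>space ?P. \<bar>\<Sum>b\<in>{u..<j}. f b\<bar> \<le> 2 * t} \<in> sets ?P"
          by measurable
      qed simp
      moreover have "{f\<in>space ?P. 2 * t < \<bar>\<Sum>b\<in>{u..<i}. f b\<bar>} \<in> sets ?P"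
        by measurable
      ultimately show ?thesis by (intro sets.sets_Collect_conj)
    qed
    have SB: "?SB \<in> sets (PiM {i..<v} (\<lambda>_. borel))" by measurable
    have eqA: "?X {u..<i} -` ?SA \<inter> space M = A i"
      by (auto simp: A_def T_def space_PiM intro!: sum.cong)
    have eqB: "?X {i..<v} -` ?SB \<inter> space M = B i"
      by (auto simp: B_def space_PiM)
    have "(\<lambda>\<omega>. (?X {u..<i} \<omega>, ?X {i..<v} \<omega>)) -` (?SA \<times> ?SB) \<inter> space M
        = (?X {u..<i} -` ?SA \<inter> space M) \<inter> (?X {i..<v} -` ?SB \<inter> space M)" by auto
    with indep_varD[OF ind SA SB] show ?thesis unfolding eqA eqB by simp
  qed
  have Bge: "1 - q \<le> prob (B i)" if "i \<in> {u..v}" for i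
  proof -
    have "space M - B i = {\<omega>\<in>space M. t < \<bar>\<Sum>b\<in>{i..<v}. \<zeta> b \<omega>\<bar>}" by (auto simp: B_def)
    then show ?thesis using prob_compl[OF B, of i] q[OF that] by simp
  qed
  have "(1 - q) * prob (\<Union>i\<in>{u..v}. A i) = (\<Sum>i\<in>{u..v}. prob (A i) * (1 - q))"
    using dis by (subst finite_measure_finite_Union) (auto simp: sum_distrib_left mult.commute)
  also have "\<dots> \<le> (\<Sum>i\<in>{u..v}. prob (A i \<inter> B i))"
    by (intro sum_mono) (simp add: AB Bge mult_left_mono)
  also have "\<dots> = prob (\<Union>i\<in>{u..v}. A i \<inter> B i)"
    using dis by (subst finite_measure_finite_Union) (auto simp: disjoint_family_on_def)
  also have "\<dots> \<le> prob {\<omega>\<in>space M. t < \<bar>\<Sum>b\<in>{u..<v}. \<zeta> b \<omega>\<bar>}"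
  proof (rule finite_measure_mono)
    show "(\<Union>i\<in>{u..v}. A i \<inter> B i) \<subseteq> {\<omega>\<in>space M. t < \<bar>\<Sum>b\<in>{u..<v}. \<zeta> b \<omega>\<bar>}"
    proof safe
      fix i \<omega> assume i: "i \<in> {u..v}" and \<omega>: "\<omega> \<in> A i" "\<omega> \<in> B i"
      have "(\<Sum>b\<in>{u..<v}. \<zeta> b \<omega>) = T i \<omega> + (\<Sum>b\<in>{i..<v}. \<zeta> b \<omega>)"
        unfolding T_def using i by (intro sum.atLeastLessThan_concat[symmetric]) auto
      then show "t < \<bar>\<Sum>b\<in>{u..<v}. \<zeta> b \<omega>\<bar>" using \<omega> by (auto simp: A_def B_def)
    qed (use A_def in auto)
  qed measurable
  finally show ?thesis unfolding un .
qed

context subadditive_blocks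
begin

text \<open>Ottaviani's inequality with q = 1/2: a quarter from the tail of a segment and a quarter
  from the block error. The factor 2 is 1 / (1 - q).\<close>

lemma prob_block_oscillation:
  assumes t: "0 < t"
    and tight: "\<And>m. m \<le> r * L \<Longrightarrow> prob {\<omega>\<in>space M. t / 2 < \<bar>cbar 0 m \<omega>\<bar>} \<le> 1 / 4"
    and small: "4 * (real r * defect (r * L) + 1) / t \<le> 1 / 4"
  shows "prob {\<omega>\<in>space M. \<exists>i\<in>{u..u + r}. 2 * t < \<bar>block_sum L u i \<omega>\<bar>}
    \<le> 2 * (prob {\<omega>\<in>space M. t / 2 < \<bar>cbar 0 (r * L) \<omega>\<bar>} + 4 * (real r * defect (r * L) + 1) / t)"
proof -
  have "prob {\<omega>\<in>space M. t < \<bar>block_sum L i (u + r) \<omega>\<bar>} \<le> 1 / 2" if i: "i \<in> {u..u + r}" for i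
  proof -
    have "prob {\<omega>\<in>space M. t < \<bar>block_sum L i (u + r) \<omega>\<bar>} \<le>
      prob {\<omega>\<in>space M. t / 2 < \<bar>cbar 0 ((u + r - i) * L) \<omega>\<bar>}
        + 4 * (real (u + r - i) * defect ((u + r - i) * L) + 1) / t"
      using prob_block_sum_gt[OF _ t, of i "u + r" L] i by simp
    also have "\<dots> \<le> 1 / 4 + 4 * (real r * defect (r * L) + 1) / t"
      using i t by (intro add_mono tight divide_right_mono mult_left_mono mult_mono defect_mono)
        (auto simp: defect_nonneg intro!: mult_right_mono)
    finally show ?thesis using small by linarith
  qed
  then have "(1 - 1 / 2) * prob {\<omega>\<in>space M. \<exists>i\<in>{u..u + r}. 2 * t < \<bar>block_sum L u i \<omega>\<bar>}
      \<le> prob {\<omega>\<in>space M. t < \<bar>block_sum L u (u + r) \<omega>\<bar>}"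
    unfolding block_sum_def by (intro Ottaviani_inequality[OF cbar_indep]) auto
  also have "\<dots> \<le> prob {\<omega>\<in>space M. t / 2 < \<bar>cbar 0 (r * L) \<omega>\<bar>} + 4 * (real r * defect (r * L) + 1) / t"
    using prob_block_sum_gt[OF _ t, of u "u + r" L] by simp
  finally show ?thesis by simp
qed

end

section \<open>Comparison with the skeleton\<close>

context subadditive_blocks
begin

lemma block_sum_concat:
  "u \<le> v \<Longrightarrow> v \<le> w \<Longrightarrow> block_sum L u w \<omega> = block_sum L u v \<omega> + block_sum L v w \<omega>"
  unfolding block_sum_def by (rule sum.atLeastLessThan_concat[symmetric])

text \<open>The pairs \<open>(m, j)\<close> below are those of the form \<open>(\<lfloor>nt\<rfloor>, \<lfloor>kt\<rfloor>)\<close>.\<close>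

lemma skeleton_approx:
  fixes n k T L m j :: nat and t :: real
  defines "r \<equiv> n div (k * L)"
  defines "J \<equiv> k * T + 2"
  defines "R \<equiv> J * r"
  assumes pos: "0 < L" "0 < k" and r: "J \<le> r"
    and defect: "defect (R * L) \<le> t"
    and excess: "(block_excess L 0 R \<omega> + 1) + (real R * defect (R * L) + 1) \<le> t"
      "(block_excess (r * L) 0 J \<omega> + 1) + (real J * defect (J * (r * L)) + 1) \<le> t"
    and within: "\<And>b i. b < R \<Longrightarrow> i \<le> L \<Longrightarrow> cbar (b * L) (b * L + i) \<omega> \<le> t"
      "\<And>b i. b < R \<Longrightarrow> i \<le> L \<Longrightarrow> cbar (b * L + (L - i)) (b * L + (L - i) + i) \<omega> \<le> t"
    and osc: "\<And>j i. j < J \<Longrightarrow> i \<in> {j * r..j * r + r} \<Longrightarrow> \<bar>block_sum L (j * r) i \<omega>\<bar> \<le> 2 * t"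
    and mj: "j < k * T" "j * n < k * (m + 1)" "m * k < n * (j + 1)"
  shows "\<bar>cbar 0 m \<omega> - block_sum (r * L) 0 j \<omega>\<bar> \<le> 9 * t"
proof -
  define b where "b = m div L"
  have m: "b * L \<le> m" "m < Suc b * L"
    using pos by (auto simp: b_def dividend_less_div_times add.commute)
  have kL: "0 < k * L" using pos by simp
  \<comment> \<open>The first j skeleton intervals end no later than the long block of m
    begins.\<close>
  have jb: "j * r \<le> b"
  proof -
    have "r * (k * L) \<le> n" by (simp add: r_def)
    then have "j * (r * (k * L)) \<le> j * n" by simp
    then have "j * (r * (k * L)) < k * (m + 1)" using mj(2) by (rule le_less_trans)
    also have "j * (r * (k * L)) = k * (j * r * L)" by (simp only: mult_ac)
    finally have "j * r * L < m + 1" unfolding nat_mult_less_cancel_disj by blast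
    then have "j * r * L \<le> m" by simp
    then show ?thesis using pos(1) by (simp add: b_def less_eq_div_iff_mult_less_eq)
  qed
  \<comment> \<open>Rounding r down loses less than one block per interval, hence at most j + 1
    blocks in all; as j + 1 \<le> r, one further interval covers the lag. This is the origin of the
    2 in J and of the condition J \<le> r.\<close>
  have bj: "Suc b \<le> j * r + r + r"
  proof -
    have "n < (r + 1) * (k * L)"
      using dividend_less_div_times[OF kL, of n] by (simp add: r_def)
    then have "n * (j + 1) \<le> (r + 1) * (k * L) * (j + 1)" by (intro mult_le_mono1) simp
    then have "m * k < (r + 1) * (k * L) * (j + 1)" using mj(3) by linarith
    moreover have "m * k = k * m" "(r + 1) * (k * L) * (j + 1) = k * ((r + 1) * (j + 1) * L)"
      by (simp_all only: mult_ac)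
    ultimately have "m < (r + 1) * (j + 1) * L" using nat_mult_less_cancel_disj by metis
    with m(1) have "b * L < (r + 1) * (j + 1) * L" by linarith
    then have "b < (r + 1) * (j + 1)" using mult_less_cancel2 by blast
    moreover have "j + 1 \<le> r" using mj(1) r by (simp add: J_def)
    ultimately show ?thesis by (simp add: algebra_simps)
  qed
  have jJ: "j + 2 \<le> J" using mj(1) by (simp add: J_def)
  have "(j + 2) * r \<le> J * r" using jJ by (rule mult_le_mono1)
  then have bR: "Suc b \<le> R" using bj by (simp add: R_def)
  have t0: "0 \<le> t" using defect defect_nonneg[of "R * L"] by linarith
  \<comment> \<open>The index may cross one interval boundary, so two oscillation bounds of 2 t are
    added.\<close>
  have osc2: "\<bar>block_sum L (j * r) i \<omega>\<bar> \<le> 4 * t" if i: "j * r \<le> i" "i \<le> j * r + r + r" for i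
  proof (cases "i \<le> j * r + r")
    case True
    then show ?thesis using osc[of j i] i jJ t0 by simp
  next
    case False
    have "block_sum L (j * r) i \<omega> = block_sum L (j * r) (j * r + r) \<omega> + block_sum L (j * r + r) i \<omega>"
      using False by (intro block_sum_concat) auto
    moreover have "\<bar>block_sum L (j * r) (j * r + r) \<omega>\<bar> \<le> 2 * t" using jJ by (intro osc) auto
    moreover have "\<bar>block_sum L (Suc j * r) i \<omega>\<bar> \<le> 2 * t" using jJ i False by (intro osc) auto
    ultimately show ?thesis by (simp add: add.commute)
  qed
  have appr: "\<bar>block_sum L 0 v \<omega> - cbar 0 (v * L) \<omega>\<bar> \<le> t" if "v \<le> R" for v
    using block_sum_approx[OF that, of L \<omega>] excess(1) by linarith
  have appr_r: "\<bar>block_sum (r * L) 0 j \<omega> - cbar 0 (j * r * L) \<omega>\<bar> \<le> t"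
    using block_sum_approx[of j J "r * L" \<omega>] excess(2) jJ by (simp add: mult.assoc)
  have split: "block_sum L 0 i \<omega> = block_sum L 0 (j * r) \<omega> + block_sum L (j * r) i \<omega>" if "j * r \<le> i" for i
    using that by (intro block_sum_concat) auto
  have jR: "j * r \<le> R" using jb bR by linarith
  \<comment> \<open>The budget of 9 t: one for the defect, one for the piece inside the block, three
    for exchanging segments and block sums, and four for the oscillation.\<close>
  have "cbar 0 m \<omega> \<le> cbar 0 (b * L) \<omega> + cbar (b * L) (b * L + (m - b * L)) \<omega> + defect m"
    using cbar_subadditive[of 0 "b * L" m \<omega>] m by simp
  moreover have "cbar (b * L) (b * L + (m - b * L)) \<omega> \<le> t" using m bR by (intro within) auto
  moreover have mRL: "Suc b * L \<le> R * L" using bR by (rule mult_le_mono1)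
  moreover have "defect m \<le> t"
    using defect_mono[of m "R * L"] m mRL defect by linarith
  ultimately have up: "cbar 0 m \<omega> \<le> block_sum (r * L) 0 j \<omega> + 9 * t"
    using appr[of b] bR split[OF jb] osc2[of b] jb bj appr[OF jR] appr_r by linarith
  \<comment> \<open>The right end of the block of m. Subadditivity bounds the value at e by the
    value at m plus the end piece, so the lower bound at m again uses an upper bound for a
    piece.\<close>
  define e where "e = Suc b * L"
  have "cbar 0 e \<omega> \<le> cbar 0 m \<omega> + cbar m e \<omega> + defect e"
    using cbar_subadditive[of 0 m e \<omega>] m by (simp add: e_def)
  moreover have "cbar m e \<omega> \<le> t"
  proof -
    have "cbar (b * L + (L - (e - m))) (b * L + (L - (e - m)) + (e - m)) \<omega> \<le> t"
      using m bR by (intro within) (auto simp: e_def)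
    moreover have "b * L + (L - (e - m)) = m" using m by (simp add: e_def)
    ultimately show ?thesis using m by (simp add: e_def)
  qed
  moreover have "defect e \<le> t"
    using defect_mono[OF mRL] defect by (simp add: e_def)
  moreover have "\<bar>block_sum L 0 (Suc b) \<omega> - cbar 0 e \<omega>\<bar> \<le> t"
    using appr[OF bR] by (simp add: e_def)
  moreover have "block_sum L 0 (Suc b) \<omega> = block_sum L 0 (j * r) \<omega> + block_sum L (j * r) (Suc b) \<omega>"
    using jb by (intro split) simp
  moreover have "\<bar>block_sum L (j * r) (Suc b) \<omega>\<bar> \<le> 4 * t"
    using jb bj by (intro osc2) auto
  ultimately have "block_sum (r * L) 0 j \<omega> - 9 * t \<le> cbar 0 m \<omega>"
    using appr[OF jR] appr_r by linarith
  with up show ?thesis by linarith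
qed

text \<open>One good event serves all pairs (m, j), so the estimate is uniform in time. For the
  block lengths chosen later, the term with J p is the one that does not vanish as n grows; it is
  made small through k.\<close>

lemma prob_skeleton_approx:
  fixes n k T L l :: nat and t p :: real
  defines "r \<equiv> n div (k * L)"
  defines "J \<equiv> k * T + 2"
  defines "R \<equiv> J * r"
  assumes pos: "0 < L" "0 < k" "0 < l" "0 < t" and r: "J \<le> r"
    and small: "real R * defect (R * L) + 1 \<le> t / 16"
      "(real L / real l + 1) * defect L + real l + 2 \<le> t / 2"
    and tight: "\<And>m. m \<le> r * L \<Longrightarrow> prob {\<omega>\<in>space M. t / 2 < \<bar>cbar 0 m \<omega>\<bar>} \<le> 1 / 4"
    and p: "prob {\<omega>\<in>space M. t / 2 < \<bar>cbar 0 (r * L) \<omega>\<bar>} \<le> p"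
  shows "\<exists>G\<in>events. 1 - (4 * ((real R * defect (R * L) + 1) / t)
        + 2 * real R * (real L + 1) * exp (- ((t / 2)\<^sup>2 / (2 * real L * real l)))
        + 2 * real J * (p + 4 * ((real R * defect (R * L) + 1) / t))) \<le> prob G \<and>
    (\<forall>\<omega>\<in>G. \<forall>m j. j < k * T \<longrightarrow> j * n < k * (m + 1) \<longrightarrow> m * k < n * (j + 1) \<longrightarrow>
      \<bar>cbar 0 m \<omega> - block_sum (r * L) 0 j \<omega>\<bar> \<le> 9 * t)"
proof -
  define q where "q = (real R * defect (R * L) + 1) / t"
  define e where "e = exp (- ((t / 2)\<^sup>2 / (2 * real L * real l)))"
  \<comment> \<open>The exceptional events: excess at the fine and at the coarse scale, initial
    pieces and end pieces of long blocks, oscillation over a skeleton interval. The level t/2 for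
    the excesses leaves room for the deterministic error t/16.\<close>
  define E1 where "E1 = {\<omega>\<in>space M. t / 2 < block_excess L 0 R \<omega> + 1}"
  define E2 where "E2 = {\<omega>\<in>space M. t / 2 < block_excess (r * L) 0 J \<omega> + 1}"
  define E3 where "E3 b i = {\<omega>\<in>space M. 2 * (t / 2) < cbar (b * L) (b * L + i) \<omega>}" for b i
  define E4 where "E4 b i = {\<omega>\<in>space M. 2 * (t / 2) < cbar (b * L + (L - i)) (b * L + (L - i) + i) \<omega>}" for b i
  define E5 where "E5 j = {\<omega>\<in>space M. \<exists>i\<in>{j * r..j * r + r}. 2 * t < \<bar>block_sum L (j * r) i \<omega>\<bar>}" for j
  have ev [measurable]: "E1 \<in> events" "E2 \<in> events" "E3 b i \<in> events" "E4 b i \<in> events" "E5 j \<in> events" for b i j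
    unfolding E1_def E2_def E3_def E4_def E5_def by measurable
  have J0: "0 < J" by (simp add: J_def)
  then have r0: "0 < r" using r by linarith
  have JR: "J \<le> R" "r \<le> R" using r0 J0 by (simp_all add: R_def)
  have q0: "0 \<le> q" unfolding q_def using pos by (intro divide_nonneg_pos add_nonneg_nonneg mult_nonneg_nonneg defect_nonneg) auto
  have le_q: "(real u * defect (v * L) + 1) / t \<le> q" if "u \<le> R" "v \<le> R" for u v
    unfolding q_def using that pos
    by (intro divide_right_mono add_right_mono mult_mono defect_mono) (auto simp: defect_nonneg)
  have P1: "prob E1 \<le> 2 * q"
  proof -
    have "prob E1 \<le> (real (R - 0) * defect ((R - 0) * L) + 1) / (t / 2)"
      unfolding E1_def by (rule prob_block_excess_gt) (use pos in auto)
    also have "\<dots> = 2 * q" by (simp add: q_def)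
    finally show ?thesis .
  qed
  have P2: "prob E2 \<le> 2 * q"
  proof -
    have "prob E2 \<le> (real (J - 0) * defect ((J - 0) * (r * L)) + 1) / (t / 2)"
      unfolding E2_def by (rule prob_block_excess_gt) (use pos in auto)
    also have "\<dots> = 2 * ((real J * defect (R * L) + 1) / t)" by (simp add: R_def mult.assoc)
    also have "\<dots> \<le> 2 * q" using le_q[OF JR(1), of R] by linarith
    finally show ?thesis .
  qed
  have P3: "prob (E3 b i) \<le> e" if "i \<le> L" for b i
    unfolding E3_def e_def by (rule prob_cbar_gt[OF that pos(3) _ small(2)]) (use pos in simp)
  have P4: "prob (E4 b i) \<le> e" if "i \<le> L" for b i
    unfolding E4_def e_def by (rule prob_cbar_gt[OF that pos(3) _ small(2)]) (use pos in simp)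
  have P5: "prob (E5 j) \<le> 2 * (p + 4 * q)" for j
  proof -
    have "4 * (real r * defect (r * L) + 1) / t \<le> 4 * q"
      using le_q[OF JR(2) JR(2)] unfolding times_divide_eq_right[symmetric] by linarith
    moreover have "4 * q \<le> 1 / 4" using small(1) pos by (simp add: q_def field_simps)
    ultimately have s: "4 * (real r * defect (r * L) + 1) / t \<le> 1 / 4" by linarith
    have "prob (E5 j) \<le> 2 * (prob {\<omega>\<in>space M. t / 2 < \<bar>cbar 0 (r * L) \<omega>\<bar>} + 4 * (real r * defect (r * L) + 1) / t)"
      unfolding E5_def by (rule prob_block_oscillation[OF pos(4) tight s])
    also have "\<dots> \<le> 2 * (p + 4 * q)"
      by (intro mult_left_mono add_mono p \<open>4 * (real r * defect (r * L) + 1) / t \<le> 4 * q\<close>) simp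
    finally show ?thesis .
  qed
  define B3 where "B3 = (\<Union>b\<in>{..<R}. \<Union>i\<in>{..L}. E3 b i)"
  define B4 where "B4 = (\<Union>b\<in>{..<R}. \<Union>i\<in>{..L}. E4 b i)"
  define B5 where "B5 = (\<Union>j\<in>{..<J}. E5 j)"
  have [measurable]: "B3 \<in> events" "B4 \<in> events" "B5 \<in> events"
    unfolding B3_def B4_def B5_def by (intro sets.finite_UN ev finite_lessThan finite_atMost)+
  have PB: "prob (\<Union>b\<in>{..<R}. \<Union>i\<in>{..L}. E b i) \<le> real R * (real L + 1) * e"
    if E: "\<And>b i. E b i \<in> events" "\<And>b i. i \<le> L \<Longrightarrow> prob (E b i) \<le> e" for E
  proof -
    have "prob (\<Union>b\<in>{..<R}. \<Union>i\<in>{..L}. E b i) \<le> (\<Sum>b\<in>{..<R}. prob (\<Union>i\<in>{..L}. E b i))"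
      by (rule finite_measure_subadditive_finite) (auto intro!: sets.finite_UN E)
    also have "\<dots> \<le> (\<Sum>b\<in>{..<R}. \<Sum>i\<in>{..L}. prob (E b i))"
      by (intro sum_mono finite_measure_subadditive_finite) (auto intro!: E)
    also have "\<dots> \<le> (\<Sum>b\<in>{..<R}. \<Sum>i\<in>{..L}. e)" by (intro sum_mono E) auto
    finally show ?thesis by (simp add: algebra_simps)
  qed
  have "prob B5 \<le> (\<Sum>j\<in>{..<J}. prob (E5 j))"
    unfolding B5_def by (rule finite_measure_subadditive_finite) auto
  also have "\<dots> \<le> (\<Sum>j\<in>{..<J}. 2 * (p + 4 * q))" by (intro sum_mono P5)
  finally have P5': "prob B5 \<le> 2 * real J * (p + 4 * q)" by (simp add: mult_ac)
  define Bad where "Bad = E1 \<union> E2 \<union> B3 \<union> B4 \<union> B5"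
  have [measurable]: "Bad \<in> events" by (simp add: Bad_def)
  have "prob Bad \<le> prob E1 + prob E2 + prob B3 + prob B4 + prob B5"
    unfolding Bad_def by (intro order_trans[OF measure_Un_le] add_mono order_refl) auto
  also have "\<dots> \<le> 2 * q + 2 * q + real R * (real L + 1) * e + real R * (real L + 1) * e + 2 * real J * (p + 4 * q)"
    unfolding B3_def B4_def by (intro add_mono P1 P2 P5' PB P3 P4 ev)
  finally have PBad: "prob Bad \<le> 4 * q + 2 * real R * (real L + 1) * e + 2 * real J * (p + 4 * q)"
    by (simp add: algebra_simps)
  show ?thesis
  proof (intro bexI[of _ "space M - Bad"] conjI ballI allI impI)
    show "1 - (4 * ((real R * defect (R * L) + 1) / t)
        + 2 * real R * (real L + 1) * exp (- ((t / 2)\<^sup>2 / (2 * real L * real l)))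
        + 2 * real J * (p + 4 * ((real R * defect (R * L) + 1) / t))) \<le> prob (space M - Bad)"
      unfolding q_def[symmetric] e_def[symmetric] using PBad by (simp add: prob_compl)
  next
    fix \<omega> m j
    assume \<omega>: "\<omega> \<in> space M - Bad"
      and mj: "j < k * T" "j * n < k * (m + 1)" "m * k < n * (j + 1)"
    have "1 \<le> real R" using JR J0 by linarith
    then have "1 * defect (R * L) \<le> real R * defect (R * L)" by (intro mult_right_mono defect_nonneg)
    then have d: "defect (R * L) \<le> t" using small(1) pos by linarith
    have dJ: "real J * defect (J * (r * L)) \<le> real R * defect (R * L)"
    proof -
      have *: "J * (r * L) = R * L" by (simp add: R_def)
      show ?thesis unfolding * using JR(1) by (intro mult_right_mono defect_nonneg) simp
    qed
    have nE: "\<omega> \<notin> E1" "\<omega> \<notin> E2" "\<And>b i. b < R \<Longrightarrow> i \<le> L \<Longrightarrow> \<omega> \<notin> E3 b i"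
      "\<And>b i. b < R \<Longrightarrow> i \<le> L \<Longrightarrow> \<omega> \<notin> E4 b i" "\<And>j. j < J \<Longrightarrow> \<omega> \<notin> E5 j"
      using \<omega> by (auto simp: Bad_def B3_def B4_def B5_def)
    show "\<bar>cbar 0 m \<omega> - block_sum (r * L) 0 j \<omega>\<bar> \<le> 9 * t"
    proof (rule skeleton_approx[where T = T and n = n and k = k and L = L, folded r_def J_def, folded R_def])
      have "block_excess L 0 R \<omega> + 1 \<le> t / 2" using nE(1) \<omega> by (auto simp: E1_def)
      then show "(block_excess L 0 R \<omega> + 1) + (real R * defect (R * L) + 1) \<le> t"
        using small(1) pos by linarith
      have "block_excess (r * L) 0 J \<omega> + 1 \<le> t / 2" using nE(2) \<omega> by (auto simp: E2_def)
      then show "(block_excess (r * L) 0 J \<omega> + 1) + (real J * defect (J * (r * L)) + 1) \<le> t"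
        using small(1) dJ pos by linarith
      show "cbar (b * L) (b * L + i) \<omega> \<le> t" if "b < R" "i \<le> L" for b i
        using nE(3)[OF that] \<omega> by (auto simp: E3_def)
      show "cbar (b * L + (L - i)) (b * L + (L - i) + i) \<omega> \<le> t" if "b < R" "i \<le> L" for b i
        using nE(4)[OF that] \<omega> by (auto simp: E4_def)
      show "\<bar>block_sum L (j * r) i \<omega>\<bar> \<le> 2 * t" if "j < J" "i \<in> {j * r..j * r + r}" for j i
        using nE(5)[OF that(1)] that(2) \<omega> by (auto simp: E5_def not_less)
    qed (use pos r d mj in auto)
  qed measurable
qed

end

section \<open>Joint limits of independent blocks\<close>

lemma tendsto_fun_componentwise:
  fixes f :: "'b \<Rightarrow> 'i \<Rightarrow> 'c::topological_space"
  assumes "\<And>i. ((\<lambda>n. f n i) \<longlongrightarrow> l i) F"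
  shows "(f \<longlongrightarrow> l) F"
  using limitin_componentwise[of "\<lambda>_. euclidean" UNIV f l F] assms
  by (simp add: euclidean_product_topology limitin_canonical_iff)

text \<open>The joint law of an independent sequence is the product measure, and the Borel sets of
  the sequence space are the product ones.\<close>

lemma (in prob_space) integral_indep_sequence:
  fixes Z :: "nat \<Rightarrow> 'a \<Rightarrow> real" and g :: "(nat \<Rightarrow> real) \<Rightarrow> real"
  assumes indep: "indep_vars (\<lambda>_. borel) Z UNIV" and g: "g \<in> borel_measurable borel"
    and law: "\<And>i. distr M borel (Z i) = D"
  shows "expectation (\<lambda>\<omega>. g (\<lambda>i. Z i \<omega>)) = (\<integral>x. g x \<partial>PiM UNIV (\<lambda>_. D))"
proof -
  have Z: "Z i \<in> borel_measurable M" for i using indep by (auto simp: indep_vars_def)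
  have g': "g \<in> borel_measurable (PiM UNIV (\<lambda>_::nat. borel :: real measure))"
    using g by (simp add: measurable_cong_sets[OF sets_PiM_equal_borel refl])
  have "distr M (PiM UNIV (\<lambda>_. borel)) (\<lambda>\<omega> i. Z i \<omega>) = PiM UNIV (\<lambda>_. D)"
    using indep_vars_iff_distr_eq_PiM[of UNIV Z "\<lambda>_. borel", OF _ Z] indep
    by (simp add: restrict_UNIV law)
  then have "(\<integral>x. g x \<partial>PiM UNIV (\<lambda>_. D)) = (\<integral>x. g x \<partial>distr M (PiM UNIV (\<lambda>_. borel)) (\<lambda>\<omega> i. Z i \<omega>))"
    by simp
  also have "\<dots> = expectation (\<lambda>\<omega>. g (\<lambda>i. Z i \<omega>))"
    using Z by (intro integral_distr g' measurable_PiM_single') auto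
  finally show ?thesis by simp
qed

lemma integral_PiM_distr:
  fixes \<Omega> :: "'b measure" and g :: "(nat \<Rightarrow> real) \<Rightarrow> real"
  assumes "prob_space \<Omega>" "V \<in> borel_measurable \<Omega>" "g \<in> borel_measurable borel"
  shows "(\<integral>x. g (\<lambda>i. V (x i)) \<partial>PiM UNIV (\<lambda>_::nat. \<Omega>)) = (\<integral>x. g x \<partial>PiM UNIV (\<lambda>_. distr \<Omega> borel V))"
proof -
  interpret P: prob_space "PiM UNIV (\<lambda>_::nat. \<Omega>)" by (rule prob_space_PiM[OF assms(1)])
  show ?thesis
  proof (rule P.integral_indep_sequence[OF _ assms(3)])
    show "P.indep_vars (\<lambda>_. borel) (\<lambda>i x. V (x i)) UNIV"
      by (rule P.indep_vars_compose2[OF indep_vars_PiM_coordinates[OF assms(1)]]) (rule assms)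
    fix i :: nat
    have "distr (PiM UNIV (\<lambda>_. \<Omega>)) borel (\<lambda>x. V (x i)) = distr (distr (PiM UNIV (\<lambda>_. \<Omega>)) \<Omega> (\<lambda>x. x i)) borel V"
      using assms(2) by (subst distr_distr) (auto simp: o_def)
    then show "distr (PiM UNIV (\<lambda>_. \<Omega>)) borel (\<lambda>x. V (x i)) = distr \<Omega> borel V"
      using distr_PiM_component[of UNIV "\<lambda>_. \<Omega>" i] assms(1) by simp
  qed
qed

abbreviation (input) gaussian :: "real \<Rightarrow> real measure" where
  "gaussian \<sigma> \<equiv> density lborel (normal_density 0 \<sigma>)"

lemma integral_PiM_gaussian_coordinate:
  fixes f :: "real \<Rightarrow> real"
  assumes "0 < \<sigma>" "f \<in> borel_measurable borel"
  shows "(\<integral>x. f (x i) \<partial>PiM UNIV (\<lambda>_::nat. gaussian \<sigma>)) = (\<integral>x. normal_density 0 \<sigma> x * f x \<partial>lborel)"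
proof -
  have G: "prob_space (gaussian \<sigma>)" by (rule prob_space_normal_density) fact
  have "(\<integral>x. f (x i) \<partial>PiM UNIV (\<lambda>_::nat. gaussian \<sigma>))
      = (\<integral>x. f x \<partial>distr (PiM UNIV (\<lambda>_::nat. gaussian \<sigma>)) (gaussian \<sigma>) (\<lambda>x. x i))"
    using assms(2) by (subst integral_distr) auto
  also have "\<dots> = (\<integral>x. f x \<partial>gaussian \<sigma>)"
    using distr_PiM_component[of UNIV "\<lambda>_::nat. gaussian \<sigma>" i] G by simp
  also have "\<dots> = (\<integral>x. normal_density 0 \<sigma> x * f x \<partial>lborel)"
    using assms(2) by (subst integral_density) auto
  finally show ?thesis .
qed

locale subadditive_blocks_clt = subadditive_blocks +
  fixes \<sigma> :: real
  assumes \<sigma>_pos: "0 < \<sigma>"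
    and clt: "weak_conv_m (\<lambda>n. distr M borel (\<lambda>\<omega>. cbar 0 n \<omega> / sqrt (real n))) (gaussian \<sigma>)"
begin

text \<open>Trades convergence in law for pointwise convergence on an auxiliary space. Infinite
  powers of that space carry independent copies, which lifts the limit theorem from one variable to
  whole sequences of blocks.\<close>

lemma Skorohod_representation:
  "\<exists>(\<Omega> :: real measure) (Z :: nat \<Rightarrow> real \<Rightarrow> real) (W :: real \<Rightarrow> real).
    prob_space \<Omega> \<and> (\<forall>n. Z n \<in> borel_measurable \<Omega>) \<and>
    (\<forall>n. distr \<Omega> borel (Z n) = distr M borel (\<lambda>\<omega>. cbar 0 n \<omega> / sqrt (real n))) \<and>
    W \<in> borel_measurable \<Omega> \<and>
    distr \<Omega> borel W = gaussian \<sigma> \<and>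
    (\<forall>x\<in>space \<Omega>. (\<lambda>n. Z n x) \<longlonglongrightarrow> W x)"
proof -
  have 1: "real_distribution (distr M borel (\<lambda>\<omega>. cbar 0 n \<omega> / sqrt (real n)))" for n
    by (rule real_distribution_distr) measurable
  have 2: "real_distribution (gaussian \<sigma>)"
    using prob_space_normal_density[OF \<sigma>_pos]
    by (simp add: real_distribution_def real_distribution_axioms_def)
  from Skorohod[OF 1 2 clt] show ?thesis by simp
qed

text \<open>Pointwise convergent sequences are bounded, so the events that some Z m exceeds j
  decrease to the empty set. The level found is valid for every m, as the remaining sums in
  Ottaviani's inequality have all lengths.\<close>

lemma cbar_tight:
  "\<exists>A>0. \<forall>m. prob {\<omega>\<in>space M. A < \<bar>cbar 0 m \<omega> / sqrt (real m)\<bar>} \<le> 1 / 4"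
proof -
  obtain \<Omega> :: "real measure" and Z :: "nat \<Rightarrow> real \<Rightarrow> real" and W :: "real \<Rightarrow> real"
    where \<Omega>: "prob_space \<Omega>" and Zm: "\<forall>n. Z n \<in> borel_measurable \<Omega>"
      and laws: "\<forall>n. distr \<Omega> borel (Z n) = distr M borel (\<lambda>\<omega>. cbar 0 n \<omega> / sqrt (real n))"
      and W [measurable]: "W \<in> borel_measurable \<Omega>"
      and lawW: "distr \<Omega> borel W = gaussian \<sigma>"
      and lims: "\<forall>x\<in>space \<Omega>. (\<lambda>n. Z n x) \<longlonglongrightarrow> W x"
    using Skorohod_representation by blast
  note Z [measurable] = Zm[rule_format] and law = laws[rule_format] and lim = lims[rule_format]
  interpret O: prob_space \<Omega> by fact
  define E where "E j = {x\<in>space \<Omega>. \<exists>m. real j < \<bar>Z m x\<bar>}" for j :: nat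
  have E [measurable]: "E j \<in> sets \<Omega>" for j unfolding E_def by measurable
  have "(\<lambda>j. O.prob (E j)) \<longlonglongrightarrow> O.prob (\<Inter>j. E j)"
  proof (rule O.finite_Lim_measure_decseq)
    show "decseq E"
      unfolding decseq_def E_def
    proof safe
      fix i j m x assume "i \<le> j" "real j < \<bar>Z m x\<bar>"
      then show "\<exists>m. real i < \<bar>Z m x\<bar>" by (intro exI[of _ m]) linarith
    qed
  qed auto
  also have "(\<Inter>j. E j) = {}"
  proof safe
    fix x assume x: "x \<in> (\<Inter>j. E j)"
    then have "Bseq (\<lambda>n. Z n x)"
      using lim[of x] by (intro convergent_imp_Bseq convergentI) (auto simp: E_def)
    then obtain B where "\<And>n. \<bar>Z n x\<bar> \<le> B" by (auto simp: Bseq_def)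
    moreover obtain j :: nat where "B \<le> real j" using real_arch_simple by blast
    ultimately have "x \<notin> E j" by (auto simp: E_def not_less intro: order_trans)
    then show "x \<in> {}" using x by auto
  qed
  finally have "\<forall>\<^sub>F j in sequentially. O.prob (E j) < 1 / 4"
    by (intro order_tendstoD(2)) auto
  then obtain j0 where j0: "\<And>j. j0 \<le> j \<Longrightarrow> O.prob (E j) < 1 / 4" by (auto simp: eventually_sequentially)
  define j where "j = Suc j0"
  have "prob {\<omega>\<in>space M. real j < \<bar>cbar 0 m \<omega> / sqrt (real m)\<bar>} \<le> 1 / 4" for m
  proof -
    have "prob {\<omega>\<in>space M. real j < \<bar>cbar 0 m \<omega> / sqrt (real m)\<bar>}
        = measure (distr M borel (\<lambda>\<omega>. cbar 0 m \<omega> / sqrt (real m))) {y. real j < \<bar>y\<bar>}"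
      by (subst measure_distr) (auto intro!: arg_cong[of _ _ prob])
    also have "\<dots> = O.prob {x\<in>space \<Omega>. real j < \<bar>Z m x\<bar>}"
      unfolding law[symmetric] by (subst measure_distr) (auto intro!: arg_cong[of _ _ O.prob])
    also have "\<dots> \<le> O.prob (E j)" by (rule O.finite_measure_mono) (auto simp: E_def)
    finally show ?thesis using j0[of j] by (simp add: j_def)
  qed
  then show ?thesis by (intro exI[of _ "real j"]) (simp add: j_def)
qed

text \<open>For each n with m n > 0 the blocks are exactly i.i.d., so their joint law is that of a n
  * Z (m n) on independent copies of the auxiliary space. There every coordinate converges
  pointwise, and dominated convergence applies to the bounded continuous g.\<close>

lemma block_clt:
  fixes g :: "(nat \<Rightarrow> real) \<Rightarrow> real" and m :: "nat \<Rightarrow> nat"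
  assumes g: "continuous_on UNIV g" "\<And>x. \<bar>g x\<bar> \<le> b"
    and m: "filterlim m at_top sequentially" "(\<lambda>n. real (m n) / real n) \<longlonglongrightarrow> \<kappa>"
  shows "(\<lambda>n. expectation (\<lambda>\<omega>. g (\<lambda>i. cbar (i * m n) (Suc i * m n) \<omega> / sqrt (real n))))
    \<longlonglongrightarrow> (\<integral>x. g (\<lambda>i. sqrt \<kappa> * x i) \<partial>PiM UNIV (\<lambda>_. gaussian \<sigma>))"
proof -
  obtain \<Omega> :: "real measure" and Z :: "nat \<Rightarrow> real \<Rightarrow> real" and W :: "real \<Rightarrow> real"
    where \<Omega>: "prob_space \<Omega>" and Zm: "\<forall>n. Z n \<in> borel_measurable \<Omega>"
      and laws: "\<forall>n. distr \<Omega> borel (Z n) = distr M borel (\<lambda>\<omega>. cbar 0 n \<omega> / sqrt (real n))"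
      and W [measurable]: "W \<in> borel_measurable \<Omega>"
      and lawW: "distr \<Omega> borel W = gaussian \<sigma>"
      and lims: "\<forall>x\<in>space \<Omega>. (\<lambda>n. Z n x) \<longlonglongrightarrow> W x"
    using Skorohod_representation by blast
  note Z [measurable] = Zm[rule_format] and law = laws[rule_format] and lim = lims[rule_format]
  interpret P: prob_space "PiM UNIV (\<lambda>_::nat. \<Omega>)" by (rule prob_space_PiM[OF \<Omega>])
  have gm [measurable]: "g \<in> borel_measurable borel" by (rule borel_measurable_continuous_onI[OF g(1)])
  have coord: "(\<lambda>x i. V (x i)) \<in> PiM UNIV (\<lambda>_::nat. \<Omega>) \<rightarrow>\<^sub>M borel" if [measurable]: "V \<in> borel_measurable \<Omega>" for V :: "real \<Rightarrow> real"
    by (rule measurable_coordinatewise_then_product) measurable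
  \<comment> \<open>Blocks have length m n but are normalised by sqrt n.\<close>
  define a where "a n = sqrt (real (m n)) / sqrt (real n)" for n
  have a: "a \<longlonglongrightarrow> sqrt \<kappa>"
    using tendsto_real_sqrt[OF m(2)] by (simp add: a_def[abs_def] real_sqrt_divide)
  have eq: "expectation (\<lambda>\<omega>. g (\<lambda>i. cbar (i * m n) (Suc i * m n) \<omega> / sqrt (real n)))
      = P.expectation (\<lambda>x. g (\<lambda>i. a n * Z (m n) (x i)))" if n: "0 < m n" for n
  proof -
    have "expectation (\<lambda>\<omega>. g (\<lambda>i. cbar (i * m n) (Suc i * m n) \<omega> / sqrt (real n)))
        = (\<integral>x. g x \<partial>PiM UNIV (\<lambda>_. distr \<Omega> borel (\<lambda>x. a n * Z (m n) x)))"
    proof (rule integral_indep_sequence[OF _ gm])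
      show "indep_vars (\<lambda>_. borel) (\<lambda>i \<omega>. cbar (i * m n) (Suc i * m n) \<omega> / sqrt (real n)) UNIV"
        by (rule indep_vars_compose2[OF cbar_indep]) simp
      fix i
      have "distr M borel (\<lambda>\<omega>. cbar (i * m n) (Suc i * m n) \<omega> / sqrt (real n))
          = distr (distr M borel (cbar (i * m n) (i * m n + m n))) borel (\<lambda>y. y / sqrt (real n))"
        by (subst distr_distr) (auto simp: o_def add.commute)
      also have "\<dots> = distr (distr M borel (\<lambda>\<omega>. cbar 0 (m n) \<omega> / sqrt (real (m n)))) borel (\<lambda>y. a n * y)"
        unfolding cbar_stationary using n by (subst (1 2) distr_distr) (auto simp: o_def a_def)
      also have "\<dots> = distr \<Omega> borel (\<lambda>x. a n * Z (m n) x)"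
        unfolding law[symmetric] by (subst distr_distr) (auto simp: o_def)
      finally show "distr M borel (\<lambda>\<omega>. cbar (i * m n) (Suc i * m n) \<omega> / sqrt (real n)) = distr \<Omega> borel (\<lambda>x. a n * Z (m n) x)" .
    qed
    also have "\<dots> = P.expectation (\<lambda>x. g (\<lambda>i. a n * Z (m n) (x i)))"
      by (rule integral_PiM_distr[OF \<Omega> _ gm, symmetric]) measurable
    finally show ?thesis .
  qed
  have "(\<lambda>n. P.expectation (\<lambda>x. g (\<lambda>i. a n * Z (m n) (x i)))) \<longlonglongrightarrow> P.expectation (\<lambda>x. g (\<lambda>i. sqrt \<kappa> * W (x i)))"
  proof (rule integral_dominated_convergence[where w = "\<lambda>_. b"])
    show "(\<lambda>x. g (\<lambda>i. sqrt \<kappa> * W (x i))) \<in> borel_measurable (PiM UNIV (\<lambda>_::nat. \<Omega>))"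
      by (rule measurable_compose[OF coord gm]) measurable
    show "(\<lambda>x. g (\<lambda>i. a n * Z (m n) (x i))) \<in> borel_measurable (PiM UNIV (\<lambda>_::nat. \<Omega>))" for n
      by (rule measurable_compose[OF coord gm]) measurable
    show "AE x in PiM UNIV (\<lambda>_::nat. \<Omega>). (\<lambda>n. g (\<lambda>i. a n * Z (m n) (x i))) \<longlonglongrightarrow> g (\<lambda>i. sqrt \<kappa> * W (x i))"
    proof (rule AE_I2)
      fix x assume x: "x \<in> space (PiM UNIV (\<lambda>_::nat. \<Omega>))"
      have "(\<lambda>n. (\<lambda>i. a n * Z (m n) (x i))) \<longlonglongrightarrow> (\<lambda>i. sqrt \<kappa> * W (x i))"
      proof (rule tendsto_fun_componentwise)
        fix i
        have "x i \<in> space \<Omega>" using x by (auto simp: space_PiM)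
        then show "(\<lambda>n. a n * Z (m n) (x i)) \<longlonglongrightarrow> sqrt \<kappa> * W (x i)"
          by (intro tendsto_mult a filterlim_compose[OF lim m(1)])
      qed
      moreover have "isCont g (\<lambda>i. sqrt \<kappa> * W (x i))"
        using g(1) by (simp add: continuous_on_eq_continuous_at)
      ultimately show "(\<lambda>n. g (\<lambda>i. a n * Z (m n) (x i))) \<longlonglongrightarrow> g (\<lambda>i. sqrt \<kappa> * W (x i))"
        by (rule isCont_tendsto_compose[rotated])
    qed
  qed (use g(2) in auto)
  also have "P.expectation (\<lambda>x. g (\<lambda>i. sqrt \<kappa> * W (x i))) = (\<integral>x. g (\<lambda>i. sqrt \<kappa> * x i) \<partial>PiM UNIV (\<lambda>_. gaussian \<sigma>))"
  proof -
    have "(\<lambda>x. g (\<lambda>i. sqrt \<kappa> * x i)) \<in> borel_measurable borel"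
      by (rule borel_measurable_continuous_onI, rule continuous_on_compose2[OF g(1)])
         (auto intro!: continuous_on_coordinatewise_then_product continuous_intros continuous_on_product_coordinates)
    from integral_PiM_distr[OF \<Omega> W this] show ?thesis by (simp add: lawW)
  qed
  finally have conv: "(\<lambda>n. P.expectation (\<lambda>x. g (\<lambda>i. a n * Z (m n) (x i))))
    \<longlonglongrightarrow> (\<integral>x. g (\<lambda>i. sqrt \<kappa> * x i) \<partial>PiM UNIV (\<lambda>_. gaussian \<sigma>))" .
  have "\<forall>\<^sub>F n in sequentially. 0 < m n"
    using m(1)[unfolded filterlim_at_top, rule_format, of 1] by eventually_elim simp
  then have "\<forall>\<^sub>F n in sequentially. P.expectation (\<lambda>x. g (\<lambda>i. a n * Z (m n) (x i)))
     = expectation (\<lambda>\<omega>. g (\<lambda>i. cbar (i * m n) (Suc i * m n) \<omega> / sqrt (real n)))"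
    by eventually_elim (rule eq[symmetric])
  with conv show ?thesis by (rule Lim_transform_eventually)
qed

text \<open>The power 4 is what counts: for \<kappa> = 1/k the bound has order k^-2, so a union over
  order k skeleton intervals still vanishes as k grows. Second moments would leave a
  constant.\<close>

lemma cbar_tail:
  fixes m :: "nat \<Rightarrow> nat"
  assumes m: "filterlim m at_top sequentially" "(\<lambda>n. real (m n) / real n) \<longlonglongrightarrow> \<kappa>"
    and pos: "0 < t" "0 < \<kappa>"
  shows "\<forall>\<^sub>F n in sequentially. prob {\<omega>\<in>space M. t * sqrt (real n) < \<bar>cbar 0 (m n) \<omega>\<bar>} \<le> 4 * \<sigma> ^ 4 * \<kappa>\<^sup>2 / t ^ 4"
proof -
  \<comment> \<open>A bounded continuous majorant of the indicator of |y| > t that lies below the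
    fourth power.\<close>
  define f where "f y = min 1 ((y / t) ^ 4)" for y :: real
  have f [continuous_intros]: "continuous_on UNIV f" unfolding f_def[abs_def] by (intro continuous_intros) (use pos in auto)
  have fm [measurable]: "f \<in> borel_measurable borel" by (rule borel_measurable_continuous_onI[OF f])
  have f01: "0 \<le> f y" "f y \<le> 1" for y by (auto simp: f_def)
  have fabs: "\<bar>f (x 0)\<bar> \<le> 1" for x :: "nat \<Rightarrow> real" using f01[of "x 0"] by linarith
  have g: "continuous_on UNIV (\<lambda>x::nat \<Rightarrow> real. f (x 0))"
    by (rule continuous_on_compose2[OF f]) (auto intro: continuous_on_product_coordinates)
  have "(\<lambda>n. expectation (\<lambda>\<omega>. f (cbar (0 * m n) (Suc 0 * m n) \<omega> / sqrt (real n))))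
      \<longlonglongrightarrow> (\<integral>x. f (sqrt \<kappa> * x 0) \<partial>PiM UNIV (\<lambda>_::nat. gaussian \<sigma>))"
    by (rule block_clt[where g = "\<lambda>x. f (x 0)" and b = 1, OF g _ m]) (rule fabs)
  \<comment> \<open>The Gaussian fourth moment is 3 \<sigma>^4; the constant 4 leaves strict room,
    so that the bound holds for all large n.\<close>
  moreover have "(\<integral>x. f (sqrt \<kappa> * x 0) \<partial>PiM UNIV (\<lambda>_::nat. gaussian \<sigma>)) < 4 * \<sigma> ^ 4 * \<kappa>\<^sup>2 / t ^ 4"
  proof -
    have mom: "has_bochner_integral lborel (\<lambda>x. normal_density 0 \<sigma> x * (x - 0) ^ (2 * 2)) (fact (2 * 2) / ((2 / \<sigma>\<^sup>2) ^ 2 * fact 2))"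
      by (rule normal_moment_even) (rule \<sigma>_pos)
    have int4: "integrable lborel (\<lambda>x. normal_density 0 \<sigma> x * x ^ 4)"
      and eq4: "(\<integral>x. normal_density 0 \<sigma> x * x ^ 4 \<partial>lborel) = 3 * \<sigma> ^ 4"
      using mom \<sigma>_pos unfolding has_bochner_integral_iff by (simp_all add: fact_numeral power_divide)
    have "(\<integral>x. f (sqrt \<kappa> * x 0) \<partial>PiM UNIV (\<lambda>_::nat. gaussian \<sigma>)) = (\<integral>x. normal_density 0 \<sigma> x * f (sqrt \<kappa> * x) \<partial>lborel)"
      by (rule integral_PiM_gaussian_coordinate[OF \<sigma>_pos]) measurable
    also have "\<dots> \<le> (\<integral>x. \<kappa>\<^sup>2 / t ^ 4 * (normal_density 0 \<sigma> x * x ^ 4) \<partial>lborel)"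
    proof (rule integral_mono_AE')
      show "integrable lborel (\<lambda>x. \<kappa>\<^sup>2 / t ^ 4 * (normal_density 0 \<sigma> x * x ^ 4))"
        using int4 by simp
      show "AE x in lborel. normal_density 0 \<sigma> x * f (sqrt \<kappa> * x) \<le> \<kappa>\<^sup>2 / t ^ 4 * (normal_density 0 \<sigma> x * x ^ 4)"
      proof (rule AE_I2)
        fix x
        have "sqrt \<kappa> ^ 4 = (sqrt \<kappa> ^ 2) ^ 2" by (simp flip: power_mult)
        then have "f (sqrt \<kappa> * x) \<le> \<kappa>\<^sup>2 / t ^ 4 * x ^ 4"
          using pos by (simp add: f_def power_divide power_mult_distrib)
        then have "normal_density 0 \<sigma> x * f (sqrt \<kappa> * x) \<le> normal_density 0 \<sigma> x * (\<kappa>\<^sup>2 / t ^ 4 * x ^ 4)"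
          by (rule mult_left_mono) simp
        then show "normal_density 0 \<sigma> x * f (sqrt \<kappa> * x) \<le> \<kappa>\<^sup>2 / t ^ 4 * (normal_density 0 \<sigma> x * x ^ 4)"
          by (simp add: mult_ac)
      qed
    qed (auto intro!: AE_I2 mult_nonneg_nonneg)
    also have "\<dots> = \<kappa>\<^sup>2 / t ^ 4 * (3 * \<sigma> ^ 4)" by (simp add: eq4)
    also have "\<dots> < \<kappa>\<^sup>2 / t ^ 4 * (4 * \<sigma> ^ 4)"
      using pos \<sigma>_pos by (intro mult_strict_left_mono) auto
    finally show ?thesis by (simp add: mult_ac)
  qed
  ultimately have "\<forall>\<^sub>F n in sequentially. expectation (\<lambda>\<omega>. f (cbar (0 * m n) (Suc 0 * m n) \<omega> / sqrt (real n))) < 4 * \<sigma> ^ 4 * \<kappa>\<^sup>2 / t ^ 4"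
    by (rule order_tendstoD(2))
  moreover have "\<forall>\<^sub>F n in sequentially. 0 < n" by (rule eventually_gt_at_top)
  ultimately show ?thesis
  proof eventually_elim
    case (elim n)
    let ?E = "{\<omega>\<in>space M. t * sqrt (real n) < \<bar>cbar 0 (m n) \<omega>\<bar>}"
    have "prob ?E = expectation (indicator ?E)" by simp
    also have "\<dots> \<le> expectation (\<lambda>\<omega>. f (cbar 0 (m n) \<omega> / sqrt (real n)))"
    proof (rule integral_mono)
      show "integrable M (\<lambda>\<omega>. f (cbar 0 (m n) \<omega> / sqrt (real n)))"
        using f01 by (intro integrable_const_bound[where B = 1] AE_I2) auto
      show "integrable M (indicator ?E :: 'a \<Rightarrow> real)"
        by (rule integrable_const_bound[where B = 1]) (auto simp: indicator_def)
      fix \<omega> assume "\<omega> \<in> space M"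
      show "indicator ?E \<omega> \<le> f (cbar 0 (m n) \<omega> / sqrt (real n))"
      proof (cases "\<omega> \<in> ?E")
        case True
        then have "1 \<le> \<bar>cbar 0 (m n) \<omega> / sqrt (real n) / t\<bar>"
          using elim(2) pos by (simp add: field_simps)
        then have "1 \<le> \<bar>cbar 0 (m n) \<omega> / sqrt (real n) / t\<bar> ^ 4" by (rule one_le_power)
        then have "1 \<le> (cbar 0 (m n) \<omega> / sqrt (real n) / t) ^ 4" by (subst (asm) power_even_abs) auto
        then show ?thesis using True by (simp add: f_def)
      qed (simp add: f01)
    qed
    finally show ?case using elim(1) by simp
  qed
qed

end

section \<open>The functional central limit theorem\<close>

text \<open>Exponents \<open>a\<close> for the long and \<open>b\<close> for the short blocks work whenever \<open>a > 1/2\<close>, \<open>b < 1/2\<close>,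
  \<open>a - b < 1/2\<close> and \<open>a + b < 1\<close>.\<close>

definition long_block :: "nat \<Rightarrow> nat" where
  "long_block n = nat \<lceil>real n powr (5/8)\<rceil>"

definition short_block :: "nat \<Rightarrow> nat" where
  "short_block n = nat \<lceil>real n powr (1/4)\<rceil>"

section \<open>Sizes of the two scales\<close>

lemma nat_ceiling_powr_bounds:
  assumes "1 \<le> n" "0 \<le> a"
  shows "real n powr a \<le> real (nat \<lceil>real n powr a\<rceil>)" "real (nat \<lceil>real n powr a\<rceil>) \<le> 2 * real n powr a"
    "1 \<le> real (nat \<lceil>real n powr a\<rceil>)"
proof -
  have 1: "1 \<le> real n powr a" using assms ge_one_powr_ge_zero by simp
  show 2: "real n powr a \<le> real (nat \<lceil>real n powr a\<rceil>)" by (simp add: real_nat_ceiling_ge)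
  have "real (nat \<lceil>real n powr a\<rceil>) \<le> real n powr a + 1"
    using 1 by linarith
  then show "real (nat \<lceil>real n powr a\<rceil>) \<le> 2 * real n powr a" using 1 by linarith
  show "1 \<le> real (nat \<lceil>real n powr a\<rceil>)" using 1 2 by linarith
qed

lemmas long_block_bounds = nat_ceiling_powr_bounds[of _ "5/8", folded long_block_def]
lemmas short_block_bounds = nat_ceiling_powr_bounds[of _ "1/4", folded short_block_def]

text \<open>The number of long blocks in a skeleton interval, rounded down so that k intervals fit
  into [0, n].\<close>

definition block_count :: "nat \<Rightarrow> nat \<Rightarrow> nat" where
  "block_count k n = n div (k * long_block n)"

lemma block_count_bounds:
  assumes "1 \<le> n" "1 \<le> k"
  shows "real (block_count k n) * real (long_block n) \<le> real n / real k"
    "real n / real k - real (long_block n) \<le> real (block_count k n) * real (long_block n)"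
proof -
  have L: "1 \<le> long_block n" using long_block_bounds(3)[OF assms(1)] by simp
  have pos: "0 < k * long_block n" using L assms by simp
  have "block_count k n * (k * long_block n) \<le> n" by (simp add: block_count_def)
  then have "real (block_count k n) * (real k * real (long_block n)) \<le> real n"
    by (metis of_nat_le_iff of_nat_mult)
  then show "real (block_count k n) * real (long_block n) \<le> real n / real k"
    using assms by (simp add: field_simps)
  have "n < block_count k n * (k * long_block n) + k * long_block n"
    using dividend_less_div_times[OF pos, of n] by (simp add: block_count_def add.commute)
  then have "real n < real (block_count k n) * (real k * real (long_block n)) + real k * real (long_block n)"
    by (metis of_nat_add of_nat_less_iff of_nat_mult)
  then show "real n / real k - real (long_block n) \<le> real (block_count k n) * real (long_block n)"
    using assms by (simp add: field_simps)
qed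

lemma block_count_upper:
  assumes "1 \<le> n" "1 \<le> k"
  shows "real (block_count k n) \<le> real n powr (3/8)"
proof -
  have L: "1 \<le> real (long_block n)" by (rule long_block_bounds(3)[OF assms(1)]) simp
  have "real (block_count k n) * real n powr (5/8) \<le> real (block_count k n) * real (long_block n)"
    using long_block_bounds(1)[OF assms(1)] by (intro mult_left_mono) auto
  also have "\<dots> \<le> real n / real k" by (rule block_count_bounds(1)[OF assms])
  also have "\<dots> \<le> real n" using assms by (simp add: divide_le_eq mult_le_cancel_left1)
  also have "\<dots> = real n powr (3/8) * real n powr (5/8)"
    using assms by (simp flip: powr_add)
  finally show ?thesis using assms by simp
qed

lemma long_block_asymp: "(\<lambda>n. real (long_block n) / real n) \<longlonglongrightarrow> 0"
proof (rule tendsto_sandwich[where f = "\<lambda>_. 0"])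
  show "\<forall>\<^sub>F n in sequentially. real (long_block n) / real n \<le> 2 * real n powr (5/8) / real n"
    using eventually_ge_at_top[of 1] by eventually_elim (intro divide_right_mono long_block_bounds(2), auto)
  show "(\<lambda>n. 2 * real n powr (5/8) / real n) \<longlonglongrightarrow> 0" by real_asymp
qed simp_all

lemma block_count_at_top:
  assumes "1 \<le> k" shows "filterlim (block_count k) at_top sequentially"
proof -
  have "filterlim (\<lambda>n. real (block_count k n)) at_top sequentially"
  proof (rule filterlim_at_top_mono)
    have "0 < 1 / real k" using assms by simp
    then show "filterlim (\<lambda>n. (1 / real k) / 2 * real n powr (3/8) - 1) at_top sequentially" by real_asymp
    show "\<forall>\<^sub>F n in sequentially. (1 / real k) / 2 * real n powr (3/8) - 1 \<le> real (block_count k n)"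
      using eventually_ge_at_top[of 1]
    proof eventually_elim
      case (elim n)
      have L: "1 \<le> real (long_block n)" by (rule long_block_bounds(3)[OF elim]) simp
      have "(1 / real k) / 2 * real n powr (3/8) * real (long_block n)
          \<le> (1 / real k) / 2 * real n powr (3/8) * (2 * real n powr (5/8))"
        by (intro mult_left_mono long_block_bounds(2)[OF elim]) auto
      also have "\<dots> = real n / real k" using elim by (simp flip: powr_add)
      also have "\<dots> \<le> real (block_count k n) * real (long_block n) + real (long_block n)"
        using block_count_bounds(2)[OF elim assms] by simp
      finally have "((1 / real k) / 2 * real n powr (3/8)) * real (long_block n) \<le> (real (block_count k n) + 1) * real (long_block n)"
        by (simp add: algebra_simps)
      then have "(1 / real k) / 2 * real n powr (3/8) \<le> real (block_count k n) + 1"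
        by (rule mult_right_le_imp_le) (use L in simp)
      then show ?case by simp
    qed
  qed
  then show ?thesis by (simp add: filterlim_sequentially_iff_filterlim_real)
qed

lemma block_length_asymp:
  assumes "1 \<le> k"
  shows "filterlim (\<lambda>n. block_count k n * long_block n) at_top sequentially"
    and "(\<lambda>n. real (block_count k n * long_block n) / real n) \<longlonglongrightarrow> 1 / real k"
proof -
  show "filterlim (\<lambda>n. block_count k n * long_block n) at_top sequentially"
  proof (rule filterlim_at_top_mono[OF block_count_at_top[OF assms]])
    show "\<forall>\<^sub>F n in sequentially. block_count k n \<le> block_count k n * long_block n"
      using eventually_ge_at_top[of 1]
      by eventually_elim (use long_block_bounds(3) in force)
  qed
  show "(\<lambda>n. real (block_count k n * long_block n) / real n) \<longlonglongrightarrow> 1 / real k"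
  proof (rule tendsto_sandwich)
    show "(\<lambda>n. 1 / real k - real (long_block n) / real n) \<longlonglongrightarrow> 1 / real k"
      using tendsto_diff[OF tendsto_const long_block_asymp, of "1 / real k"] by simp
    show "\<forall>\<^sub>F n in sequentially. 1 / real k - real (long_block n) / real n \<le> real (block_count k n * long_block n) / real n"
      using eventually_ge_at_top[of 1]
    proof eventually_elim
      case (elim n)
      show ?case using divide_right_mono[OF block_count_bounds(2)[OF elim assms], of "real n"] elim
        by (simp add: diff_divide_distrib)
    qed
    show "\<forall>\<^sub>F n in sequentially. real (block_count k n * long_block n) / real n \<le> 1 / real k"
      using eventually_ge_at_top[of 1]
    proof eventually_elim
      case (elim n)
      show ?case using divide_right_mono[OF block_count_bounds(1)[OF elim assms], of "real n"] elim
        by simp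
    qed
  qed simp
qed

section \<open>Negligible error terms\<close>

context subadditive_blocks
begin

text \<open>About n^(3/8) blocks, each with a logarithmic defect, against sqrt n.\<close>

lemma excess_asymp:
  assumes "0 < t" "1 \<le> k" and J: "1 \<le> J"
  shows "(\<lambda>n. (real (J * block_count k n) * defect (J * block_count k n * long_block n) + 1) / (t * sqrt (real n))) \<longlonglongrightarrow> 0"
proof (rule tendsto_sandwich[where f = "\<lambda>_. 0"])
  define j where "j = real J"
  have j: "0 < j" using J by (simp add: j_def)
  show "(\<lambda>n. (j * real n powr (3/8) * (K * (1 + ln (j * real n + 1))) + 1) / (t * sqrt (real n))) \<longlonglongrightarrow> 0"
    using j assms(1) by real_asymp
  show "\<forall>\<^sub>F n in sequentially. (real (J * block_count k n) * defect (J * block_count k n * long_block n) + 1) / (t * sqrt (real n))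
      \<le> (j * real n powr (3/8) * (K * (1 + ln (j * real n + 1))) + 1) / (t * sqrt (real n))"
    using eventually_ge_at_top[of 1]
  proof eventually_elim
    case (elim n)
    have "real (block_count k n) * real (long_block n) \<le> real n / real k"
      by (rule block_count_bounds(1)[OF elim assms(2)])
    also have "\<dots> \<le> real n" using assms by (simp add: divide_le_eq mult_le_cancel_left1)
    finally have "j * (real (block_count k n) * real (long_block n)) \<le> j * real n"
      using j by (intro mult_left_mono) auto
    then have "real (J * block_count k n * long_block n) \<le> j * real n"
      by (simp add: j_def mult.assoc)
    then have "defect (J * block_count k n * long_block n) \<le> K * (1 + ln (j * real n + 1))"
      unfolding defect_def using K_nonneg by (intro mult_left_mono add_left_mono) (auto intro!: ln_mono add_nonneg_pos)
    then show ?case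
      using block_count_upper[OF elim assms(2)] j assms(1) defect_nonneg
      by (intro divide_right_mono add_right_mono mult_mono) (auto simp: j_def)
  qed
qed (use assms in \<open>auto intro!: always_eventually divide_nonneg_nonneg add_nonneg_nonneg mult_nonneg_nonneg defect_nonneg\<close>)

text \<open>A long block holds O(n^(3/8)) short ones, each with a logarithmic defect, and the
  remainder has length O(n^(1/4)).\<close>

lemma short_block_asymp:
  assumes "0 < t"
  shows "\<forall>\<^sub>F n in sequentially.
    (real (long_block n) / real (short_block n) + 1) * defect (long_block n) + real (short_block n) + 2 \<le> t * sqrt (real n)"
proof -
  let ?u = "\<lambda>n. (2 * real n powr (3/8) + 1) * (K * (1 + ln (2 * real n powr (5/8) + 1))) + 2 * real n powr (1/4) + 2"
  have "(\<lambda>n. ?u n / sqrt (real n)) \<longlonglongrightarrow> 0" by real_asymp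
  then have "\<forall>\<^sub>F n in sequentially. ?u n / sqrt (real n) < t" using assms by (rule order_tendstoD(2))
  then show ?thesis using eventually_ge_at_top[of 1]
  proof eventually_elim
    case (elim n)
    have l: "1 \<le> real (short_block n)" by (rule short_block_bounds(3)[OF elim(2)]) simp
    have "real (long_block n) / real (short_block n) \<le> (2 * real n powr (5/8)) / real n powr (1/4)"
      using elim(2) long_block_bounds(2)[OF elim(2)] short_block_bounds(1)[OF elim(2)]
      by (intro frac_le) auto
    also have "real n powr (5/8) = real n powr (3/8) * real n powr (1/4)"
      using elim(2) by (simp flip: powr_add)
    also have "2 * (real n powr (3/8) * real n powr (1/4)) / real n powr (1/4) = 2 * real n powr (3/8)"
      using elim(2) by simp
    finally have "real (long_block n) / real (short_block n) \<le> 2 * real n powr (3/8)" .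
    moreover have "defect (long_block n) \<le> K * (1 + ln (2 * real n powr (5/8) + 1))"
      unfolding defect_def using K_nonneg long_block_bounds(2)[OF elim(2)]
      by (intro mult_left_mono add_left_mono) (auto intro!: ln_mono)
    ultimately have "(real (long_block n) / real (short_block n) + 1) * defect (long_block n) + real (short_block n) + 2 \<le> ?u n"
      using short_block_bounds(2)[OF elim(2)] defect_nonneg
      by (intro add_mono mult_mono) auto
    also have "\<dots> \<le> t * sqrt (real n)" using elim by (simp add: field_simps)
    finally show ?case .
  qed
qed

text \<open>The union bound runs over O(n) pieces, while the exponent grows like n / (n^(5/8)
  n^(1/4)) = n^(1/8).\<close>

lemma exponential_asymp:
  assumes "0 < t" "1 \<le> k" and J: "1 \<le> J"
  shows "(\<lambda>n. 2 * real (J * block_count k n) * (real (long_block n) + 1)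
    * exp (- ((t * sqrt (real n))\<^sup>2 / (2 * real (long_block n) * real (short_block n))))) \<longlonglongrightarrow> 0"
proof (rule tendsto_sandwich[where f = "\<lambda>_. 0"])
  define j where "j = real J"
  have j: "0 < j" using J by (simp add: j_def)
  have "0 < t\<^sup>2 / 8" using assms by simp
  then show "(\<lambda>n. 4 * j * real n * exp (- (t\<^sup>2 / 8 * real n powr (1/8)))) \<longlonglongrightarrow> 0"
    using j by real_asymp
  show "\<forall>\<^sub>F n in sequentially. 2 * real (J * block_count k n) * (real (long_block n) + 1)
      * exp (- ((t * sqrt (real n))\<^sup>2 / (2 * real (long_block n) * real (short_block n))))
      \<le> 4 * j * real n * exp (- (t\<^sup>2 / 8 * real n powr (1/8)))"
    using eventually_ge_at_top[of 1]
  proof eventually_elim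
    case (elim n)
    have l: "1 \<le> real (short_block n)" by (rule short_block_bounds(3)[OF elim]) simp
    have L: "1 \<le> real (long_block n)" by (rule long_block_bounds(3)[OF elim]) simp
    have "real (block_count k n) * (real (long_block n) + 1) \<le> real (block_count k n) * (2 * real (long_block n))"
      using L by (intro mult_left_mono) auto
    also have "\<dots> \<le> 2 * (real n / real k)" using block_count_bounds(1)[OF elim assms(2)] by simp
    also have "\<dots> \<le> 2 * real n" using assms by (simp add: divide_le_eq mult_le_cancel_left1)
    finally have 1: "2 * j * (real (block_count k n) * (real (long_block n) + 1)) \<le> 2 * j * (2 * real n)"
      using j by (intro mult_left_mono) auto
    have "2 * real (long_block n) * real (short_block n) \<le> 2 * (2 * real n powr (5/8)) * (2 * real n powr (1/4))"
      using long_block_bounds(2)[OF elim] short_block_bounds(2)[OF elim] by (intro mult_mono) auto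
    also have "\<dots> = 8 * real n powr (7/8)" by (simp flip: powr_add)
    finally have "(t * sqrt (real n))\<^sup>2 / (8 * real n powr (7/8)) \<le> (t * sqrt (real n))\<^sup>2 / (2 * real (long_block n) * real (short_block n))"
      using l L by (intro frac_le) auto
    moreover have "(t * sqrt (real n))\<^sup>2 / (8 * real n powr (7/8)) = t\<^sup>2 / 8 * real n powr (1/8)"
    proof -
      have "real n = real n powr (1/8) * real n powr (7/8)" using elim by (simp flip: powr_add)
      then show ?thesis using elim by (simp add: power_mult_distrib field_simps)
    qed
    ultimately have 2: "exp (- ((t * sqrt (real n))\<^sup>2 / (2 * real (long_block n) * real (short_block n)))) \<le> exp (- (t\<^sup>2 / 8 * real n powr (1/8)))"
      by simp
    have e1: "2 * real (J * block_count k n) * (real (long_block n) + 1)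
        = 2 * j * (real (block_count k n) * (real (long_block n) + 1))" by (simp add: j_def)
    have e2: "4 * j * real n = 2 * j * (2 * real n)" by simp
    show ?case unfolding e1 e2 by (rule mult_mono[OF 1 2]) (use j in auto)
  qed
qed (auto intro!: always_eventually)

end

context subadditive_blocks_clt
begin

text \<open>The condition \<open>kA\<close> makes the tightness level usable within a skeleton
  interval: A \<surd>m \<le> (e/2) \<surd>n for m \<le> n/k. All terms that vanish with n are
  collected in d; the other term is free of n.\<close>

lemma eventually_skeleton_approx:
  assumes e: "0 < e" and d: "0 < d" and k: "1 \<le> k"
    and A: "0 < A" "\<And>m. prob {\<omega>\<in>space M. A < \<bar>cbar 0 m \<omega> / sqrt (real m)\<bar>} \<le> 1 / 4"
    and kA: "A \<le> e / 2 * sqrt (real k)"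
  shows "\<forall>\<^sub>F n in sequentially. \<exists>G\<in>events.
    1 - (d + 2 * real (k * T + 2) * (4 * \<sigma> ^ 4 * (1 / real k)\<^sup>2 / (e / 2) ^ 4)) \<le> prob G \<and>
    (\<forall>\<omega>\<in>G. \<forall>m j. j < k * T \<longrightarrow> j * n < k * (m + 1) \<longrightarrow> m * k < n * (j + 1) \<longrightarrow>
      \<bar>cbar 0 m \<omega> - block_sum (block_count k n * long_block n) 0 j \<omega>\<bar> \<le> 9 * (e * sqrt (real n)))"
proof -
  define J where "J = k * T + 2"
  define p where "p = 4 * \<sigma> ^ 4 * (1 / real k)\<^sup>2 / (e / 2) ^ 4"
  define q where "q n = (real (J * block_count k n) * defect (J * block_count k n * long_block n) + 1) / (e * sqrt (real n))" for n
  define x where "x n = 2 * real (J * block_count k n) * (real (long_block n) + 1)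
    * exp (- ((e / 2 * sqrt (real n))\<^sup>2 / (2 * real (long_block n) * real (short_block n))))" for n
  have J: "1 \<le> J" by (simp add: J_def)
  have q0: "q \<longlonglongrightarrow> 0" unfolding q_def using excess_asymp[OF e k J] .
  have x0: "x \<longlonglongrightarrow> 0" unfolding x_def by (rule exponential_asymp) (use e k J in auto)
  have "(\<lambda>n. 4 * q n + x n + 8 * real J * q n) \<longlonglongrightarrow> 4 * 0 + 0 + 8 * real J * 0"
    by (intro tendsto_intros q0 x0)
  then have "\<forall>\<^sub>F n in sequentially. 4 * q n + x n + 8 * real J * q n < d"
    using d by (intro order_tendstoD(2)) auto
  moreover have "\<forall>\<^sub>F n in sequentially. q n < 1 / 16" using q0 by (rule order_tendstoD(2)) simp
  moreover have "\<forall>\<^sub>F n in sequentially. J \<le> block_count k n"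
    using block_count_at_top[OF k] by (simp add: filterlim_at_top)
  moreover have "\<forall>\<^sub>F n in sequentially. (real (long_block n) / real (short_block n) + 1) * defect (long_block n)
      + real (short_block n) + 2 \<le> (e / 2) * sqrt (real n)"
    by (rule short_block_asymp) (use e in simp)
  moreover have "\<forall>\<^sub>F n in sequentially. prob {\<omega>\<in>space M. (e / 2) * sqrt (real n) < \<bar>cbar 0 (block_count k n * long_block n) \<omega>\<bar>} \<le> p"
    unfolding p_def using block_length_asymp[OF k] e k by (intro cbar_tail) auto
  moreover have "\<forall>\<^sub>F n in sequentially. 1 \<le> (e / 2) * sqrt (real n)"
  proof -
    have "filterlim (\<lambda>n. (e / 2) * sqrt (real n)) at_top sequentially" using e by real_asymp
    then show ?thesis unfolding filterlim_at_top by blast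
  qed
  moreover have "\<forall>\<^sub>F n in sequentially. 1 \<le> n" by (rule eventually_ge_at_top)
  ultimately show ?thesis
  proof eventually_elim
    case (elim n)
    define t where "t = e * sqrt (real n)"
    have n: "0 < real n" using elim by simp
    have t: "0 < t" using e n by (simp add: t_def)
    have t2: "t / 2 = (e / 2) * sqrt (real n)" by (simp add: t_def)
    have qt: "q n = (real (J * block_count k n) * defect (J * block_count k n * long_block n) + 1) / t"
      by (simp add: q_def t_def)
    have xt: "x n = 2 * real (J * block_count k n) * (real (long_block n) + 1)
        * exp (- ((t / 2)\<^sup>2 / (2 * real (long_block n) * real (short_block n))))"
      by (simp only: x_def t2)
    have L: "0 < long_block n" using long_block_bounds(3)[of n] elim by simp
    have l: "0 < short_block n" using short_block_bounds(3)[of n] elim by simp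
    have s1: "real (J * block_count k n) * defect (J * block_count k n * long_block n) + 1 \<le> t / 16"
      using elim(2) t unfolding qt by (simp add: field_simps)
    have tight: "prob {\<omega>\<in>space M. t / 2 < \<bar>cbar 0 m \<omega>\<bar>} \<le> 1 / 4" if m: "m \<le> block_count k n * long_block n" for m
    proof (cases "m = 0")
      case True
      \<comment> \<open>Division by sqrt 0 gives 0, so the tightness bound says nothing at m = 0;
        there the trivial bound 1 is used.\<close>
      have c1: "\<bar>cbar 0 0 \<omega>\<bar> \<le> 1" for \<omega>
        using cbar_le[of 0 0 \<omega>] c_nonneg[of 0 0 \<omega>] mean_nonneg[of 0]
          integral_mono[of M "c 0 0" "\<lambda>_. 1"] c_le[of 0 0]
        by (simp add: cbar_def mean_def prob_space)
      have "\<not> t / 2 < \<bar>cbar 0 m \<omega>\<bar>" for \<omega>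
        using c1[of \<omega>] elim(6) unfolding t2 True by linarith
      then have none: "{\<omega>\<in>space M. t / 2 < \<bar>cbar 0 m \<omega>\<bar>} = {}" by blast
      show ?thesis unfolding none by simp
    next
      case False
      have "real m \<le> real n / real k"
        using block_count_bounds(1)[OF elim(7) k] m
        by (metis (no_types, lifting) of_nat_le_iff of_nat_mult order_trans)
      then have "sqrt (real m) * sqrt (real k) \<le> sqrt (real n)"
        using k by (simp add: real_sqrt_mult[symmetric] field_simps)
      then have "A * sqrt (real m) \<le> t / 2"
      proof -
        have "A * sqrt (real m) \<le> e / 2 * sqrt (real k) * sqrt (real m)"
          using kA by (intro mult_right_mono) auto
        also have "\<dots> = e / 2 * (sqrt (real m) * sqrt (real k))" by simp
        also have "\<dots> \<le> e / 2 * sqrt (real n)"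
          using e \<open>sqrt (real m) * sqrt (real k) \<le> sqrt (real n)\<close> by (intro mult_left_mono) auto
        finally show ?thesis by (simp add: t2)
      qed
      then have "prob {\<omega>\<in>space M. t / 2 < \<bar>cbar 0 m \<omega>\<bar>} \<le> prob {\<omega>\<in>space M. A < \<bar>cbar 0 m \<omega> / sqrt (real m)\<bar>}"
        using False by (intro finite_measure_mono) (auto simp: field_simps)
      also have "\<dots> \<le> 1 / 4" by (rule A(2))
      finally show ?thesis .
    qed
    have "\<exists>G\<in>events. 1 - (4 * q n + x n + 2 * real J * (p + 4 * q n)) \<le> prob G \<and>
      (\<forall>\<omega>\<in>G. \<forall>m j. j < k * T \<longrightarrow> j * n < k * (m + 1) \<longrightarrow> m * k < n * (j + 1) \<longrightarrow>
        \<bar>cbar 0 m \<omega> - block_sum (block_count k n * long_block n) 0 j \<omega>\<bar> \<le> 9 * t)"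
      unfolding qt xt J_def
      by (unfold block_count_def, rule prob_skeleton_approx, unfold block_count_def[symmetric] J_def[symmetric])
         (use L l k t elim(3-5) s1 tight t2 in auto)
    then obtain G where G: "G \<in> events" "1 - (4 * q n + x n + 2 * real J * (p + 4 * q n)) \<le> prob G"
      "\<forall>\<omega>\<in>G. \<forall>m j. j < k * T \<longrightarrow> j * n < k * (m + 1) \<longrightarrow> m * k < n * (j + 1) \<longrightarrow>
        \<bar>cbar 0 m \<omega> - block_sum (block_count k n * long_block n) 0 j \<omega>\<bar> \<le> 9 * t" by blast
    have "1 - (d + 2 * real J * p) \<le> prob G"
      using G(2) elim(1) by (simp add: algebra_simps)
    with G(1,3) show ?case unfolding J_def p_def t_def by blast
  qed
qed

definition rescaled_path :: "nat \<Rightarrow> 'a \<Rightarrow> real \<Rightarrow> real" where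
  "rescaled_path n \<omega> = step_path n (\<lambda>m. cbar 0 m \<omega> / (\<sigma> * sqrt (real n)))"

definition skeleton_path :: "nat \<Rightarrow> nat \<Rightarrow> 'a \<Rightarrow> real \<Rightarrow> real" where
  "skeleton_path k n \<omega> =
    step_path k (\<lambda>j. block_sum (block_count k n * long_block n) 0 j \<omega> / (\<sigma> * sqrt (real n)))"

text \<open>The arithmetic conditions in \<open>close\<close> are the floor inequalities for m =
  floor (n t) and j = floor (k t), with t eliminated.\<close>

lemma path_dist_skeleton_le:
  assumes n: "0 < n" and k: "0 < k"
    and close: "\<And>m j. j < k * T \<Longrightarrow> j * n < k * (m + 1) \<Longrightarrow> m * k < n * (j + 1) \<Longrightarrow>
      \<bar>cbar 0 m \<omega> - block_sum (block_count k n * long_block n) 0 j \<omega>\<bar> \<le> 9 * (e * sqrt (real n))"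
  shows "path_dist (rescaled_path n \<omega>) (skeleton_path k n \<omega>) \<le> max (9 * e / \<sigma>) (1 / (1 + real T))"
proof (rule path_dist_le_max)
  fix t :: real assume t: "0 \<le> t" "t < real T"
  define m where "m = nat \<lfloor>real n * t\<rfloor>"
  define j where "j = nat \<lfloor>real k * t\<rfloor>"
  have m: "real m \<le> real n * t" "real n * t < real m + 1"
    using t by (simp_all add: m_def)
  have j: "real j \<le> real k * t" "real k * t < real j + 1"
    using t by (simp_all add: j_def)
  have "real k * t < real k * real T" using t(2) k by simp
  with j(1) have "real j < real k * real T" by linarith
  then have 1: "j < k * T" by (metis of_nat_less_iff of_nat_mult)
  have "real j * real n \<le> real k * (real n * t)"
    using mult_right_mono[OF j(1), of "real n"] by (simp add: mult_ac)
  also have "\<dots> < real k * (real m + 1)" using m(2) k by simp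
  finally have "real (j * n) < real (k * (m + 1))" by (simp add: algebra_simps)
  then have 2: "j * n < k * (m + 1)" by (simp only: of_nat_less_iff)
  have "real m * real k \<le> real n * (real k * t)"
    using mult_right_mono[OF m(1), of "real k"] by (simp add: mult_ac)
  also have "\<dots> < real n * (real j + 1)" using j(2) n by simp
  finally have "real (m * k) < real (n * (j + 1))" by (simp add: algebra_simps)
  then have 3: "m * k < n * (j + 1)" by (simp only: of_nat_less_iff)
  let ?B = "block_sum (block_count k n * long_block n) 0 j \<omega>"
  have pos: "0 < \<sigma> * sqrt (real n)" using \<sigma>_pos n by simp
  have "\<bar>rescaled_path n \<omega> t - skeleton_path k n \<omega> t\<bar> = \<bar>cbar 0 m \<omega> - ?B\<bar> / (\<sigma> * sqrt (real n))"
    using t pos by (simp add: rescaled_path_def skeleton_path_def step_path_def m_def j_def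
        diff_divide_distrib[symmetric] abs_divide)
  also have "\<dots> \<le> 9 * (e * sqrt (real n)) / (\<sigma> * sqrt (real n))"
    using pos by (intro divide_right_mono close 1 2 3) auto
  also have "\<dots> = 9 * e / \<sigma>" using n by simp
  finally show "\<bar>rescaled_path n \<omega> t - skeleton_path k n \<omega> t\<bar> \<le> 9 * e / \<sigma>" .
qed simp

lemma rescaled_path_measurable:
  "path_lipschitz L h \<Longrightarrow> (\<lambda>\<omega>. h (rescaled_path n \<omega>)) \<in> borel_measurable M"
  unfolding rescaled_path_def by (rule path_lipschitz_step_path_measurable) measurable

lemma skeleton_path_measurable:
  "path_lipschitz L h \<Longrightarrow> (\<lambda>\<omega>. h (skeleton_path k n \<omega>)) \<in> borel_measurable M"
  unfolding skeleton_path_def by (rule path_lipschitz_step_path_measurable) measurable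

text \<open>The Lipschitz bound applies on G, the trivial bound 2 b off G.\<close>

lemma expectation_skeleton_diff_le:
  assumes h: "path_lipschitz L h" "\<And>x. \<bar>h x\<bar> \<le> b"
    and G: "G \<in> events" "1 - p \<le> prob G" and r: "0 \<le> r"
    and close: "\<And>\<omega>. \<omega> \<in> G \<Longrightarrow> path_dist (rescaled_path n \<omega>) (skeleton_path k n \<omega>) \<le> r"
  shows "\<bar>expectation (\<lambda>\<omega>. h (rescaled_path n \<omega>)) - expectation (\<lambda>\<omega>. h (skeleton_path k n \<omega>))\<bar> \<le> L * r + 2 * b * p"
proof -
  have L0: "0 \<le> L" using h(1) by (simp add: path_lipschitz_def)
  have b0: "0 \<le> b" using h(2)[of undefined] by linarith
  note [measurable] = rescaled_path_measurable[OF h(1)] skeleton_path_measurable[OF h(1)] G(1)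
  have int: "integrable M (\<lambda>\<omega>. h (rescaled_path n \<omega>))" "integrable M (\<lambda>\<omega>. h (skeleton_path k n \<omega>))"
    using h(2) by (auto intro!: integrable_const_bound[where B = b])
  have "\<bar>expectation (\<lambda>\<omega>. h (rescaled_path n \<omega>)) - expectation (\<lambda>\<omega>. h (skeleton_path k n \<omega>))\<bar>
      = \<bar>expectation (\<lambda>\<omega>. h (rescaled_path n \<omega>) - h (skeleton_path k n \<omega>))\<bar>"
    using int by simp
  also have "\<dots> \<le> expectation (\<lambda>\<omega>. \<bar>h (rescaled_path n \<omega>) - h (skeleton_path k n \<omega>)\<bar>)"
    by (rule integral_abs_bound)
  also have "\<dots> \<le> expectation (\<lambda>\<omega>. L * r * indicator G \<omega> + 2 * b * indicator (space M - G) \<omega>)"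
  proof (rule integral_mono)
    show "integrable M (\<lambda>\<omega>. \<bar>h (rescaled_path n \<omega>) - h (skeleton_path k n \<omega>)\<bar>)"
      using int by (intro integrable_abs Bochner_Integration.integrable_diff)
    show "integrable M (\<lambda>\<omega>. L * r * indicator G \<omega> + 2 * b * indicator (space M - G) \<omega>)"
      by (intro Bochner_Integration.integrable_add integrable_mult_right integrable_real_indicator) (auto simp: emeasure_eq_measure)
    fix \<omega> assume \<omega>: "\<omega> \<in> space M"
    show "\<bar>h (rescaled_path n \<omega>) - h (skeleton_path k n \<omega>)\<bar> \<le> L * r * indicator G \<omega> + 2 * b * indicator (space M - G) \<omega>"
    proof (cases "\<omega> \<in> G")
      case True
      have "\<bar>h (rescaled_path n \<omega>) - h (skeleton_path k n \<omega>)\<bar> \<le> L * path_dist (rescaled_path n \<omega>) (skeleton_path k n \<omega>)"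
        by (rule path_lipschitzD[OF h(1)])
      also have "\<dots> \<le> L * r" by (intro mult_left_mono close True L0)
      finally show ?thesis using True by simp
    next
      case False
      then show ?thesis using \<omega> h(2)[of "rescaled_path n \<omega>"] h(2)[of "skeleton_path k n \<omega>"] by simp
    qed
  qed
  also have "\<dots> = L * r * prob G + 2 * b * prob (space M - G)"
    by (subst Bochner_Integration.integral_add) (auto simp: emeasure_eq_measure)
  also have "\<dots> \<le> L * r * 1 + 2 * b * p"
  proof (intro add_mono)
    show "L * r * prob G \<le> L * r * 1"
      using r L0 by (intro mult_left_mono) auto
    show "2 * b * prob (space M - G) \<le> 2 * b * p"
      using G b0 by (intro mult_left_mono) (auto simp: prob_compl)
  qed
  finally show ?thesis by simp
qed

end

text \<open>Puts the Brownian side into the form of the block limit: increments over 1/k are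
  independent normals of variance 1/k, that is, Gaussians of deviation \<sigma> multiplied by sqrt
  (1/k) / \<sigma>.\<close>

lemma standard_brownian_motion_skeleton:
  fixes N :: "'b measure" and B :: "real \<Rightarrow> 'b \<Rightarrow> real" and g :: "(nat \<Rightarrow> real) \<Rightarrow> real"
  assumes B: "standard_brownian_motion N B" and k: "0 < k" and s: "0 < \<sigma>"
    and g: "continuous_on UNIV g"
  shows "(\<integral>\<omega>. g (\<lambda>j. B (real j / real k) \<omega>) \<partial>N)
    = (\<integral>x. g (\<lambda>j. (\<Sum>i<j. sqrt (1 / real k) * x i) / \<sigma>) \<partial>PiM UNIV (\<lambda>_. gaussian \<sigma>))"
proof -
  interpret N: prob_space N using B by (simp add: standard_brownian_motion_def)
  define u where "u j = real j / real k" for j :: nat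
  have u: "0 \<le> u 0" "u i \<le> u (Suc i)" "u i < u (Suc i)" "0 \<le> u i" for i
    using k by (auto simp: u_def divide_simps)
  have Bm [measurable]: "B (u j) \<in> borel_measurable N" for j
    using B u(4) by (simp add: standard_brownian_motion_def)
  define I where "I i \<omega> = B (u (Suc i)) \<omega> - B (u i) \<omega>" for i \<omega>
  have Im: "I i \<in> borel_measurable N" for i unfolding I_def[abs_def] by measurable
  have fin: "N.indep_vars (\<lambda>_. borel) I {..<j}" for j
    using B u unfolding standard_brownian_motion_def I_def[abs_def] by blast
  \<comment> \<open>Brownian increments are independent in finite families, and independence of a
    sequence is a statement about its finite subfamilies.\<close>
  have indep: "N.indep_vars (\<lambda>_. borel) I UNIV"
    unfolding N.indep_vars_def2
  proof (intro conjI ballI Im)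
    show "N.indep_sets (\<lambda>i. {I i -` A \<inter> space N |A. A \<in> sets borel}) UNIV"
    proof (subst N.indep_sets_finite_index_sets, intro allI impI)
      fix J :: "nat set" assume "finite J"
      then obtain j where "J \<subseteq> {..<j}" using finite_nat_iff_bounded by blast
      moreover have "N.indep_sets (\<lambda>i. {I i -` A \<inter> space N |A. A \<in> sets borel}) {..<j}"
        using fin[of j] by (simp add: N.indep_vars_def2)
      ultimately show "N.indep_sets (\<lambda>i. {I i -` A \<inter> space N |A. A \<in> sets borel}) J"
        by (rule N.indep_sets_mono_index)
    qed
  qed
  define a where "a = sqrt (1 / real k) / \<sigma>"
  have a: "0 < a" using k s by (simp add: a_def)
  define V where "V x = a * x" for x :: real
  have V [measurable]: "V \<in> borel_measurable (gaussian \<sigma>)" unfolding V_def[abs_def] by simp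
  have G: "prob_space (gaussian \<sigma>)" by (rule prob_space_normal_density[OF s])
  interpret G: prob_space "gaussian \<sigma>" by (rule G)
  have law: "distr N borel (I i) = distr (gaussian \<sigma>) borel V" for i
  proof -
    have "distributed (gaussian \<sigma>) lborel (\<lambda>x. x) (normal_density 0 \<sigma>)"
      by (auto simp: distributed_def distr_id2)
    from G.normal_density_affine[OF this s, of a 0] a
    have "distributed (gaussian \<sigma>) lborel V (normal_density 0 (a * \<sigma>))"
      by (simp add: V_def[abs_def])
    then have "distr (gaussian \<sigma>) lborel V = density lborel (normal_density 0 (a * \<sigma>))"
      by (simp add: distributed_def)
    moreover have "distributed N lborel (I i) (normal_density 0 (sqrt (u (Suc i) - u i)))"
      using B u(3,4)[of i] unfolding standard_brownian_motion_def I_def[abs_def] by blast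
    then have "distr N lborel (I i) = density lborel (normal_density 0 (sqrt (u (Suc i) - u i)))"
      by (simp add: distributed_def)
    moreover have "u (Suc i) - u i = 1 / real k" by (simp add: u_def diff_divide_distrib[symmetric])
    moreover have "a * \<sigma> = sqrt (1 / real k)" using s by (simp add: a_def)
    ultimately have "distr N lborel (I i) = distr (gaussian \<sigma>) lborel V" by simp
    moreover have "distr N borel (I i) = distr N lborel (I i)" "distr (gaussian \<sigma>) borel V = distr (gaussian \<sigma>) lborel V"
      by (auto intro!: distr_cong)
    ultimately show ?thesis by simp
  qed
  define g' where "g' z = g (\<lambda>j. \<Sum>i<j. z i)" for z :: "nat \<Rightarrow> real"
  have g'c: "continuous_on UNIV g'"
    unfolding g'_def
    by (rule continuous_on_compose2[OF g])
       (auto intro!: continuous_on_coordinatewise_then_product continuous_on_sum continuous_on_product_coordinates)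
  have g'm: "g' \<in> borel_measurable borel" by (rule borel_measurable_continuous_onI[OF g'c])
  \<comment> \<open>The start at 0 is almost sure only, so the telescoped identity is one
    too.\<close>
  have "AE \<omega> in N. B (u 0) \<omega> = 0"
    using B by (simp add: standard_brownian_motion_def u_def)
  then have "AE \<omega> in N. g (\<lambda>j. B (u j) \<omega>) = g' (\<lambda>i. I i \<omega>)"
  proof eventually_elim
    case (elim \<omega>)
    have "(\<Sum>i<j. I i \<omega>) = B (u j) \<omega>" for j
      unfolding I_def using sum_lessThan_telescope[of "\<lambda>i. B (u i) \<omega>" j] elim by simp
    then show ?case by (simp add: g'_def)
  qed
  moreover have "(\<lambda>\<omega>. g (\<lambda>j. B (u j) \<omega>)) \<in> borel_measurable N"
    by (rule measurable_compose[OF measurable_coordinatewise_then_product borel_measurable_continuous_onI[OF g]]) measurable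
  moreover have "(\<lambda>\<omega>. g' (\<lambda>i. I i \<omega>)) \<in> borel_measurable N"
    by (rule measurable_compose[OF measurable_coordinatewise_then_product g'm]) (rule Im)
  ultimately have "(\<integral>\<omega>. g (\<lambda>j. B (u j) \<omega>) \<partial>N) = (\<integral>\<omega>. g' (\<lambda>i. I i \<omega>) \<partial>N)"
    by (intro integral_cong_AE)
  also have "\<dots> = (\<integral>x. g' x \<partial>PiM UNIV (\<lambda>_. distr (gaussian \<sigma>) borel V))"
    by (rule N.integral_indep_sequence[OF indep g'm law])
  also have "\<dots> = (\<integral>x. g' (\<lambda>i. V (x i)) \<partial>PiM UNIV (\<lambda>_. gaussian \<sigma>))"
    by (rule integral_PiM_distr[OF G V g'm, symmetric])
  finally show ?thesis
    by (simp add: g'_def V_def a_def u_def sum_divide_distrib)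
qed

section \<open>Passage to the limit\<close>

context subadditive_blocks_clt
begin

lemma skeleton_path_converges:
  fixes N :: "'b measure" and B :: "real \<Rightarrow> 'b \<Rightarrow> real"
  assumes B: "standard_brownian_motion N B" and k: "1 \<le> k"
    and h: "path_lipschitz L h" "\<And>x. \<bar>h x\<bar> \<le> b"
  shows "(\<lambda>n. expectation (\<lambda>\<omega>. h (skeleton_path k n \<omega>)))
    \<longlonglongrightarrow> (\<integral>\<omega>. h (step_path k (\<lambda>j. B (real j / real k) \<omega>)) \<partial>N)"
proof -
  define g where "g z = h (step_path k (\<lambda>j. (\<Sum>i<j. z i) / \<sigma>))" for z :: "nat \<Rightarrow> real"
  have hc: "continuous_on UNIV (\<lambda>c. h (step_path k c))"
    by (rule path_lipschitz_step_path_continuous[OF h(1)])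
  have gc: "continuous_on UNIV g"
    unfolding g_def
    by (rule continuous_on_compose2[OF hc])
       (auto intro!: continuous_on_coordinatewise_then_product continuous_on_divide continuous_on_sum
          continuous_on_product_coordinates continuous_on_const simp: \<sigma>_pos less_imp_neq[OF \<sigma>_pos, symmetric])
  have "(\<lambda>n. expectation (\<lambda>\<omega>. g (\<lambda>i. cbar (i * (block_count k n * long_block n)) (Suc i * (block_count k n * long_block n)) \<omega> / sqrt (real n))))
      \<longlonglongrightarrow> (\<integral>x. g (\<lambda>i. sqrt (1 / real k) * x i) \<partial>PiM UNIV (\<lambda>_. gaussian \<sigma>))"
  proof (rule block_clt[OF gc])
    show "\<bar>g z\<bar> \<le> b" for z by (simp add: g_def h)
  qed (rule block_length_asymp[OF k])+
  also have "(\<lambda>n. expectation (\<lambda>\<omega>. g (\<lambda>i. cbar (i * (block_count k n * long_block n)) (Suc i * (block_count k n * long_block n)) \<omega> / sqrt (real n))))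
      = (\<lambda>n. expectation (\<lambda>\<omega>. h (skeleton_path k n \<omega>)))"
    by (simp add: g_def skeleton_path_def block_sum_def sum_divide_distrib atLeast0LessThan mult.commute[of \<sigma>])
  also have "(\<integral>x. g (\<lambda>i. sqrt (1 / real k) * x i) \<partial>PiM UNIV (\<lambda>_. gaussian \<sigma>))
      = (\<integral>\<omega>. h (step_path k (\<lambda>j. B (real j / real k) \<omega>)) \<partial>N)"
    using standard_brownian_motion_skeleton[OF B _ \<sigma>_pos hc, of k] k by (simp add: g_def)
  finally show ?thesis .
qed

text \<open>The order of choices matters: e and T from the tolerance, then k for the oscillation and
  for the Brownian discretisation, and n last, with k fixed.\<close>

theorem functional_clt:
  fixes N :: "'b measure" and B :: "real \<Rightarrow> 'b \<Rightarrow> real"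
  assumes B: "standard_brownian_motion N B"
    and h: "path_lipschitz L h" "\<And>x. \<bar>h x\<bar> \<le> b"
  shows "(\<lambda>n. expectation (\<lambda>\<omega>. h (rescaled_path n \<omega>))) \<longlonglongrightarrow> (\<integral>\<omega>. h (restrict (\<lambda>t. B t \<omega>) {0..}) \<partial>N)"
proof (rule tendstoI)
  fix \<epsilon> :: real assume \<epsilon>: "0 < \<epsilon>"
  interpret N: prob_space N using B by (simp add: standard_brownian_motion_def)
  let ?E = "\<integral>\<omega>. h (restrict (\<lambda>t. B t \<omega>) {0..}) \<partial>N"
  let ?EB = "\<lambda>k. \<integral>\<omega>. h (step_path k (\<lambda>j. B (real j / real k) \<omega>)) \<partial>N"
  have L0: "0 \<le> L" using h(1) by (simp add: path_lipschitz_def)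
  have b0: "0 \<le> b" using h(2)[of undefined] by linarith
  have Bk: "(\<lambda>\<omega>. h (step_path k (\<lambda>j. B (real j / real k) \<omega>))) \<in> borel_measurable N" for k
    by (rule path_lipschitz_step_path_measurable[OF h(1)]) (use B in \<open>simp add: standard_brownian_motion_def\<close>)
  have lim: "(\<lambda>k. h (step_path k (\<lambda>j. B (real j / real k) \<omega>))) \<longlonglongrightarrow> h (restrict (\<lambda>t. B t \<omega>) {0..})"
    if "\<omega> \<in> space N" for \<omega>
    using B that
    by (intro path_lipschitz_tendsto[OF h(1)] continuous_path_step_approx) (simp add: standard_brownian_motion_def)
  have EB: "?EB \<longlonglongrightarrow> ?E"
  proof (rule integral_dominated_convergence[where w = "\<lambda>_. b"])
    show "(\<lambda>\<omega>. h (restrict (\<lambda>t. B t \<omega>) {0..})) \<in> borel_measurable N"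
      by (rule borel_measurable_LIMSEQ_real[OF lim Bk])
  qed (use Bk lim h(2) in auto)
  \<comment> \<open>This will be 9 e / \<sigma>; L times it is at most \<epsilon>/8, and the + 1
    covers L = 0.\<close>
  define w where "w = \<epsilon> / 8 / (L + 1)"
  define e where "e = \<sigma> * w / 9"
  have e: "0 < e" using \<epsilon> \<sigma>_pos L0 by (simp add: e_def w_def)
  \<comment> \<open>Makes L times the weight beyond T at most \<epsilon>/8.\<close>
  obtain T :: nat where T: "8 * L / \<epsilon> \<le> real T" using real_arch_simple by blast
  define r where "r = max (9 * e / \<sigma>) (1 / (1 + real T))"
  have r0: "0 \<le> r" using e \<sigma>_pos by (simp add: r_def le_max_iff_disj)
  have Lr: "L * r \<le> \<epsilon> / 8"
  proof -
    have "9 * e / \<sigma> = w" using \<sigma>_pos by (simp add: e_def)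
    then have "L * (9 * e / \<sigma>) = L / (L + 1) * (\<epsilon> / 8)" by (simp add: w_def)
    also have "\<dots> \<le> 1 * (\<epsilon> / 8)" using L0 \<epsilon> by (intro mult_right_mono) auto
    finally have "L * (9 * e / \<sigma>) \<le> \<epsilon> / 8" by simp
    moreover have "L * (1 / (1 + real T)) \<le> \<epsilon> / 8"
      using T \<epsilon> by (simp add: field_simps)
    ultimately show ?thesis unfolding r_def max_def by simp
  qed
  \<comment> \<open>The bad event will have probability at most 2 d, one d from large n and one from
    large k, and contributes at most 2 b * 2 d \<le> \<epsilon>/4.\<close>
  define d where "d = \<epsilon> / (16 * (b + 1))"
  have d: "0 < d" using \<epsilon> b0 by (simp add: d_def)
  have small: "2 * b * (2 * d) \<le> \<epsilon> / 4"
  proof -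
    have "2 * b * (2 * d) = b / (b + 1) * (\<epsilon> / 4)" using b0 by (simp add: d_def field_simps)
    also have "\<dots> \<le> 1 * (\<epsilon> / 4)" using b0 \<epsilon> by (intro mult_right_mono) auto
    finally show ?thesis by simp
  qed
  obtain A where A: "0 < A" "\<And>m. prob {\<omega>\<in>space M. A < \<bar>cbar 0 m \<omega> / sqrt (real m)\<bar>} \<le> 1 / 4"
    using cbar_tight by blast
  define C where "C = 4 * \<sigma> ^ 4 / (e / 2) ^ 4"
  \<comment> \<open>Order k events of probability of order k^-2.\<close>
  have "(\<lambda>k. 2 * real (k * T + 2) * (4 * \<sigma> ^ 4 * (1 / real k)\<^sup>2 / (e / 2) ^ 4)) \<longlonglongrightarrow> 0"
  proof -
    have "(\<lambda>k. 2 * (real k * \<tau> + 2) * (C * (1 / real k)\<^sup>2)) \<longlonglongrightarrow> 0" for \<tau> by real_asymp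
    from this[of "real T"] show ?thesis by (simp add: C_def algebra_simps)
  qed
  then have "\<forall>\<^sub>F k in sequentially. 2 * real (k * T + 2) * (4 * \<sigma> ^ 4 * (1 / real k)\<^sup>2 / (e / 2) ^ 4) < d"
    using d by (rule order_tendstoD(2))
  moreover have "\<forall>\<^sub>F k in sequentially. A \<le> e / 2 * sqrt (real k)"
  proof -
    have "filterlim (\<lambda>k. e / 2 * sqrt (real k)) at_top sequentially" using e by real_asymp
    then show ?thesis unfolding filterlim_at_top by blast
  qed
  moreover have "\<forall>\<^sub>F k in sequentially. dist (?EB k) ?E < \<epsilon> / 4"
    using EB \<epsilon> by (intro tendstoD) auto
  moreover have "\<forall>\<^sub>F k in sequentially. (1::nat) \<le> k" by (rule eventually_ge_at_top)
  ultimately have "\<forall>\<^sub>F k in sequentially. 2 * real (k * T + 2) * (4 * \<sigma> ^ 4 * (1 / real k)\<^sup>2 / (e / 2) ^ 4) < d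
      \<and> A \<le> e / 2 * sqrt (real k) \<and> dist (?EB k) ?E < \<epsilon> / 4 \<and> 1 \<le> k"
    by eventually_elim simp
  then obtain k where k: "2 * real (k * T + 2) * (4 * \<sigma> ^ 4 * (1 / real k)\<^sup>2 / (e / 2) ^ 4) < d"
      "A \<le> e / 2 * sqrt (real k)" "dist (?EB k) ?E < \<epsilon> / 4" "1 \<le> k"
    by (auto simp: eventually_sequentially)
  have "\<forall>\<^sub>F n in sequentially. dist (expectation (\<lambda>\<omega>. h (skeleton_path k n \<omega>))) (?EB k) < \<epsilon> / 4"
    using skeleton_path_converges[OF B k(4) h] \<epsilon> by (intro tendstoD) auto
  moreover note eventually_skeleton_approx[OF e d k(4) A k(2), of T]
  moreover have "\<forall>\<^sub>F n in sequentially. (1::nat) \<le> n" by (rule eventually_ge_at_top)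
  ultimately show "\<forall>\<^sub>F n in sequentially. dist (expectation (\<lambda>\<omega>. h (rescaled_path n \<omega>))) ?E < \<epsilon>"
  proof eventually_elim
    case (elim n)
    from elim(2) obtain G where G: "G \<in> events"
      "1 - (d + 2 * real (k * T + 2) * (4 * \<sigma> ^ 4 * (1 / real k)\<^sup>2 / (e / 2) ^ 4)) \<le> prob G"
      "\<And>\<omega> m j. \<omega> \<in> G \<Longrightarrow> j < k * T \<Longrightarrow> j * n < k * (m + 1) \<Longrightarrow> m * k < n * (j + 1) \<Longrightarrow>
        \<bar>cbar 0 m \<omega> - block_sum (block_count k n * long_block n) 0 j \<omega>\<bar> \<le> 9 * (e * sqrt (real n))"
      by blast
    have "1 - 2 * d \<le> prob G" using G(2) k(1) by linarith
    moreover have "path_dist (rescaled_path n \<omega>) (skeleton_path k n \<omega>) \<le> r" if "\<omega> \<in> G" for \<omega>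
      unfolding r_def using elim(3) k(4) that by (intro path_dist_skeleton_le G(3)) auto
    ultimately have "\<bar>expectation (\<lambda>\<omega>. h (rescaled_path n \<omega>)) - expectation (\<lambda>\<omega>. h (skeleton_path k n \<omega>))\<bar>
        \<le> L * r + 2 * b * (2 * d)"
      by (intro expectation_skeleton_diff_le[OF h G(1) _ r0])
    \<comment> \<open>\<epsilon>/8 + \<epsilon>/4 for the comparison, \<epsilon>/4 for the skeleton
      limit and \<epsilon>/4 for the Brownian discretisation.\<close>
    then show ?case using Lr small elim(1) k(3) \<epsilon> unfolding dist_real_def by linarith
  qed
qed

end

theorem theorem2p1:
  fixes M :: "'a measure" and S :: "nat \<Rightarrow> 'a \<Rightarrow> int ^ 'd" and \<sigma> :: real
    and N :: "'b measure" and B :: "real \<Rightarrow> 'b \<Rightarrow> real"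
  assumes dim: "CARD('d) \<ge> 6"
    and walk: "simple_random_walk M S 0"
    and sigma_pos: "\<sigma> > 0"
    and sigma_clt: "weak_conv_m
          (\<lambda>n. distr M borel (\<lambda>\<omega>. (range_capacity S n \<omega>
                 - (\<integral>\<omega>'. range_capacity S n \<omega>' \<partial>M)) / sqrt (real n)))
          (density lborel (normal_density 0 \<sigma>))"
    and brownian: "standard_brownian_motion N B"
  shows "weakly_converges skorohod_J1
          (\<lambda>n. path_law M (\<lambda>t \<omega>. (range_capacity S (nat \<lfloor>real n * t\<rfloor>) \<omega>
                 - (\<integral>\<omega>'. range_capacity S (nat \<lfloor>real n * t\<rfloor>) \<omega>' \<partial>M)) / (\<sigma> * sqrt (real n))))
          (path_law N B)"
proof -
  obtain K where K: "subadditive_blocks M (segment_capacity S) K"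
    using subadditive_blocks_segment_capacity[OF dim walk] by blast
  interpret subadditive_blocks M "segment_capacity S" K by (rule K)
  \<comment> \<open>Turns the assumed limit theorem for the capacity of the range into the
    assumption of the locale.\<close>
  have cbar: "cbar 0 m \<omega> = range_capacity S m \<omega> - (\<integral>\<omega>'. range_capacity S m \<omega>' \<partial>M)" for m \<omega>
    by (simp add: cbar_def mean_def range_capacity_eq_segment)
  interpret subadditive_blocks_clt M "segment_capacity S" K \<sigma>
    by unfold_locales (use sigma_pos sigma_clt in \<open>simp_all add: cbar\<close>)
  have N: "prob_space N" and cont: "\<And>\<omega>. \<omega> \<in> space N \<Longrightarrow> continuous_on {0..} (\<lambda>t. B t \<omega>)"
    and Bm: "\<And>t. 0 \<le> t \<Longrightarrow> B t \<in> borel_measurable N"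
    using brownian by (simp_all add: standard_brownian_motion_def)
  have "weakly_converges skorohod_J1 (\<lambda>n. distr M (borel_of skorohod_J1) (rescaled_path n))
      (distr N (borel_of skorohod_J1) (\<lambda>\<omega>. restrict (\<lambda>t. B t \<omega>) {0..}))"
  proof (rule weakly_converges_skorohod_J1I[OF prob_space_axioms N])
    show "rescaled_path n \<omega> \<in> cadlag_paths" for n \<omega>
      by (simp add: rescaled_path_def step_path_cadlag)
    show "restrict (\<lambda>t. B t \<omega>) {0..} \<in> cadlag_paths" if "\<omega> \<in> space N" for \<omega>
      by (rule continuous_path_cadlag[OF cont[OF that]])
    fix L h assume h: "path_lipschitz L h"
    show "(\<lambda>\<omega>. h (rescaled_path n \<omega>)) \<in> borel_measurable M" for n
      by (rule rescaled_path_measurable[OF h])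
    show "(\<lambda>\<omega>. h (restrict (\<lambda>t. B t \<omega>) {0..})) \<in> borel_measurable N"
    proof (rule borel_measurable_LIMSEQ_real)
      show "(\<lambda>k. h (step_path k (\<lambda>j. B (real j / real k) \<omega>))) \<longlonglongrightarrow> h (restrict (\<lambda>t. B t \<omega>) {0..})"
        if "\<omega> \<in> space N" for \<omega>
        by (rule path_lipschitz_tendsto[OF h continuous_path_step_approx[OF cont[OF that]]])
      show "(\<lambda>\<omega>. h (step_path k (\<lambda>j. B (real j / real k) \<omega>))) \<in> borel_measurable N" for k
        by (rule path_lipschitz_step_path_measurable[OF h]) (rule Bm, simp)
    qed
    show "(\<lambda>n. expectation (\<lambda>\<omega>. h (rescaled_path n \<omega>))) \<longlonglongrightarrow> (\<integral>\<omega>. h (restrict (\<lambda>t. B t \<omega>) {0..}) \<partial>N)"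
      if "\<And>x. \<bar>h x\<bar> \<le> b" for b
      by (rule functional_clt[OF brownian h that])
  qed
  \<comment> \<open>The process of the statement is the step path with n steps per unit of time, its
    index at time t being floor (n t).\<close>
  then show ?thesis
    by (simp add: path_law_def rescaled_path_def[abs_def] step_path_def cbar)
qed

end
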